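(* Assume (A1), (A2), (A3) and (A3'). Let $u_0,v_0:\mathbb{R}^N\to\mathbb{R}$ be two bounded Lipschitz continuous functions and let $u$, $v$ be the bounded continuous viscosity solutions of $$\partial_t u=\mu(\widehat{Du})\,\big[c_1(x)+\kappa[x,u]\big]\,|Du|\quad\text{in }(0,+\infty)\times\mathbb{R}^N$$ with initial conditions $u(0,\cdot)=u_0$ and $v(0,\cdot)=v_0$ respectively. If $$\{x\in\mathbb{R}^N:u_0(x)>0\}=\{x\in\mathbb{R}^N:v_0(x)>0\}\quad\text{and}\quad\{x\in\mathbb{R}^N:u_0(x)<0\}=\{x\in\mathbb{R}^N:v_0(x)<0\},$$ then, for all $t>0$, $$\{x\in\mathbb{R}^N:u(t,x)>0\}=\{x\in\mathbb{R}^N:v(t,x)>0\}\quad\text{and}\quad\{x\in\mathbb{R}^N:u(t,x)<0\}=\{x\in\mathbb{R}^N:v(t,x)<0\}.$$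
   Context: Notation: $\mathbb{S}^{N-1}$ is the unit sphere of $\mathbb{R}^N$; $B_\delta$ is the ball of radius $\delta$ centered at the origin and $B=B_1$; $\hat p=p/|p|$ for $p\ne0$; $D$ denotes the gradient in $x$. Assumptions. (A1) $\mu:\mathbb{S}^{N-1}\to(0,+\infty)$ is continuous. (A2) $c_1:\mathbb{R}^N\to\mathbb{R}$ is Lipschitz continuous. (A3) $\nu$ is a non-negative Radon measure on $\mathbb{R}^N\setminus\{0\}$ (regarded as a measure on $\mathbb{R}^N$ with $\nu(\{0\})=0$; it may have infinite mass near $0$) such that: for all $\delta>0$, $\nu(\mathbb{R}^N\setminus B_\delta)<+\infty$; for all $r>0$ and $e\in\mathbb{S}^{N-1}$, $\nu\{z\in B: r|z\cdot e|\le|z-(z\cdot e)e|^2\}<+\infty$; $\delta\,\nu(\mathbb{R}^N\setminus B_\delta)\to0$ as $\delta\to0$; and $r\,\nu\{z\in B: r|z\cdot e|\le|z-(z\cdot e)e|^2\}\to0$ as $r\to0$, uniformly with respect to $e\in\mathbb{S}^{N-1}$. (A3') $r\,\nu\{z\in B_\delta: r|z\cdot e|\le|z-(z\cdot e)e|^2\}\to0$ as $\delta\to0$, uniformly in $e\in\mathbb{S}^{N-1}$ and $r\in(0,1)$; and $\nu(dz)=J(z)\,dz$ with $J\in W^{1,1}(\mathbb{R}^N\setminus B_\delta)$ for all $\delta>0$. Fractional mean curvature. For $\phi:\mathbb{R}^N\to\mathbb{R}$ smooth with $D\phi(x)\neq0$, $$\kappa^*[x,\phi]=\nu\{z:\phi(x+z)\ge\phi(x),\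 D\phi(x)\cdot z\le0\}-\nu\{z:\phi(x+z)<\phi(x),\ D\phi(x)\cdot z>0\},$$ $$\kappa_*[x,\phi]=\nu\{z:\phi(x+z)>\phi(x),\ D\phi(x)\cdot z<0\}-\nu\{z:\phi(x+z)\le\phi(x),\ D\phi(x)\cdot z\ge0\}.$$ Viscosity solutions. An upper semicontinuous function $u:[0,+\infty)\times\mathbb{R}^N\to\mathbb{R}$ is a subsolution if for every smooth test function $\phi$ such that $u-\phi$ admits a global zero maximum at $(t,x)\in(0,+\infty)\times\mathbb{R}^N$, one has $\partial_t\phi(t,x)\le\mu(\widehat{D\phi(t,x)})\big[c_1(x)+\kappa^*[x,\phi(t,\cdot)]\big]|D\phi(t,x)|$ if $D\phi(t,x)\ne0$, and $\partial_t\phi(t,x)\le0$ if $D\phi(t,x)=0$. A lower semicontinuous function $u$ is a supersolution if for every smooth test function $\phi$ such that $u-\phi$ admits a global zero minimum at $(t,x)\in(0,+\infty)\times\mathbb{R}^N$, one has $\partial_t\phi(t,x)\ge\mu(\widehat{D\phi(t,x)})\big[c_1(x)+\kappa_*[x,\phi(t,\cdot)]\big]|D\phi(t,x)|$ if $D\phi(t,x)\ne0$, and $\partial_t\phi(t,x)\ge0$ if $D\phi(t,x)=0$. A locally bounded function is a viscosity solution if its upper semicontinuous envelope is a subsolution and its lower semicontinuous envelope is a supersolution; a continuous one is thus both a sub- and a supersolution. *)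

theory Defs
  imports "HOL-Analysis.Analysis"
begin

section \<open>Smooth functions and gradients\<close>

primrec Ck :: "nat \<Rightarrow> ('a::euclidean_space \<Rightarrow> real) \<Rightarrow> bool" where
  "Ck 0 f \<longleftrightarrow> continuous_on UNIV f"
| "Ck (Suc k) f \<longleftrightarrow>
     (\<forall>x. f differentiable (at x)) \<and> (\<forall>v. Ck k (\<lambda>x. frechet_derivative f (at x) v))"

definition smooth :: "('a::euclidean_space \<Rightarrow> real) \<Rightarrow> bool" where
  "smooth f \<longleftrightarrow> (\<forall>k. Ck k f)"

definition grad :: "('a::euclidean_space \<Rightarrow> real) \<Rightarrow> 'a \<Rightarrow> 'a" where
  "grad f x = (THE D. GDERIV f x :> D)"

definition test_function_on :: "'a::euclidean_space set \<Rightarrow> ('a \<Rightarrow> real) \<Rightarrow> bool" where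
  "test_function_on U \<psi> \<longleftrightarrow> smooth \<psi> \<and> (\<exists>K. compact K \<and> K \<subseteq> U \<and> (\<forall>x. x \<notin> K \<longrightarrow> \<psi> x = 0))"

text \<open>The Sobolev space \<open>W\<^sup>1\<^sup>,\<^sup>1(U)\<close> of an open set \<open>U\<close>; the witness \<open>g\<close> is the weak gradient.\<close>

definition W11 :: "'a::euclidean_space set \<Rightarrow> ('a \<Rightarrow> real) \<Rightarrow> bool" where
  "W11 U f \<longleftrightarrow> set_integrable lborel U f \<and>
     (\<exists>g :: 'a \<Rightarrow> 'a. set_integrable lborel U g \<and>
        (\<forall>\<psi>. test_function_on U \<psi> \<longrightarrow>
           (LINT x:U|lborel. f x *\<^sub>R grad \<psi> x) = - (LINT x:U|lborel. \<psi> x *\<^sub>R g x)))"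


section \<open>Assumptions on the singular measure\<close>

text \<open>
  A Radon measure on the space without the origin, extended by zero to the origin. Regularity is
  automatic for Borel measures on this space that are finite on compact sets.
\<close>

definition radon_off_origin :: "'a::euclidean_space measure \<Rightarrow> bool" where
  "radon_off_origin \<nu> \<longleftrightarrow> sets \<nu> = sets borel \<and> emeasure \<nu> {0} = 0 \<and>
     (\<forall>K. compact K \<and> 0 \<notin> K \<longrightarrow> emeasure \<nu> K < \<infinity>)"

definition parabola_region :: "real \<Rightarrow> real \<Rightarrow> 'a::euclidean_space \<Rightarrow> 'a set" where
  "parabola_region \<delta> r e =
     {z \<in> ball 0 \<delta>. r * \<bar>z \<bullet> e\<bar> \<le> (norm (z - (z \<bullet> e) *\<^sub>R e))\<^sup>2}"

text \<open>
  The real-valued \<open>measure\<close> is \<open>0\<close> on sets of infinite measure. In the limits below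
  it is only evaluated on sets (for small \<open>\<delta>\<close>) whose finiteness is required by the first two
  conditions of \<open>assumption_A3\<close>.
\<close>

definition assumption_A3 :: "'a::euclidean_space measure \<Rightarrow> bool" where
  "assumption_A3 \<nu> \<longleftrightarrow> radon_off_origin \<nu> \<and>
     (\<forall>\<delta>>0. emeasure \<nu> (- ball 0 \<delta>) < \<infinity>) \<and>
     (\<forall>r>0. \<forall>e\<in>sphere 0 1. emeasure \<nu> (parabola_region 1 r e) < \<infinity>) \<and>
     ((\<lambda>\<delta>. \<delta> * measure \<nu> (- ball 0 \<delta>)) \<longlongrightarrow> 0) (at_right 0) \<and>
     uniform_limit (sphere 0 1) (\<lambda>r e. r * measure \<nu> (parabola_region 1 r e)) (\<lambda>_. 0) (at_right 0)"

text \<open>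
  The density is given by a non-negative Borel representative, and the Sobolev condition outside
  a ball is stated on the interior of the complement of the ball.
\<close>

definition assumption_A3' :: "'a::euclidean_space measure \<Rightarrow> bool" where
  "assumption_A3' \<nu> \<longleftrightarrow>
     uniform_limit ({0<..<1} \<times> sphere 0 1)
       (\<lambda>\<delta> (r, e). r * measure \<nu> (parabola_region \<delta> r e)) (\<lambda>_. 0) (at_right 0) \<and>
     (\<exists>J :: 'a \<Rightarrow> real. J \<in> borel_measurable borel \<and> (\<forall>z. 0 \<le> J z) \<and>
        \<nu> = density lborel (\<lambda>z. ennreal (J z)) \<and> (\<forall>\<delta>>0. W11 (- cball 0 \<delta>) J))"


section \<open>Fractional mean curvature\<close>

text \<open>
  Under \<open>assumption_A3\<close> the sets below have finite measure whenever \<open>\<phi>\<close> is smooth with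
  \<open>grad \<phi> x \<noteq> 0\<close>, so that the differences of real-valued measures are the intended ones.
\<close>

definition kappa_upper :: "'a::euclidean_space measure \<Rightarrow> 'a \<Rightarrow> ('a \<Rightarrow> real) \<Rightarrow> real" where
  "kappa_upper \<nu> x \<phi> =
     measure \<nu> {z. \<phi> (x + z) \<ge> \<phi> x \<and> grad \<phi> x \<bullet> z \<le> 0} -
     measure \<nu> {z. \<phi> (x + z) < \<phi> x \<and> grad \<phi> x \<bullet> z > 0}"

definition kappa_lower :: "'a::euclidean_space measure \<Rightarrow> 'a \<Rightarrow> ('a \<Rightarrow> real) \<Rightarrow> real" where
  "kappa_lower \<nu> x \<phi> =
     measure \<nu> {z. \<phi> (x + z) > \<phi> x \<and> grad \<phi> x \<bullet> z < 0} -
     measure \<nu> {z. \<phi> (x + z) \<le> \<phi> x \<and> grad \<phi> x \<bullet> z \<ge> 0}"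


section \<open>Viscosity solutions\<close>

abbreviation spacetime :: "(real \<times> 'a::euclidean_space) set" where
  "spacetime \<equiv> {0..} \<times> UNIV"

definition usc_on :: "'b::topological_space set \<Rightarrow> ('b \<Rightarrow> real) \<Rightarrow> bool" where
  "usc_on S u \<longleftrightarrow> (\<forall>a. openin (top_of_set S) {p \<in> S. u p < a})"

definition lsc_on :: "'b::topological_space set \<Rightarrow> ('b \<Rightarrow> real) \<Rightarrow> bool" where
  "lsc_on S u \<longleftrightarrow> (\<forall>a. openin (top_of_set S) {p \<in> S. a < u p})"

text \<open>
  Semicontinuous envelopes relative to \<open>S\<close>. For locally bounded \<open>u\<close> the extended real values
  are finite at the points of \<open>S\<close>.
\<close>

definition usc_envelope :: "'b::metric_space set \<Rightarrow> ('b \<Rightarrow> real) \<Rightarrow> 'b \<Rightarrow> real" where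
  "usc_envelope S u p = real_of_ereal (INF r\<in>{0<..}. SUP q\<in>ball p r \<inter> S. ereal (u q))"

definition lsc_envelope :: "'b::metric_space set \<Rightarrow> ('b \<Rightarrow> real) \<Rightarrow> 'b \<Rightarrow> real" where
  "lsc_envelope S u p = real_of_ereal (SUP r\<in>{0<..}. INF q\<in>ball p r \<inter> S. ereal (u q))"

text \<open>
  Test functions are smooth on the whole of \<open>\<real> \<times> \<real>\<^sup>N\<close>, but are compared with \<open>u\<close> only at
  nonnegative times. The direction of a nonzero vector \<open>p\<close> is \<open>sgn p\<close>.
\<close>

definition viscosity_subsolution ::
  "('a::euclidean_space \<Rightarrow> real) \<Rightarrow> ('a \<Rightarrow> real) \<Rightarrow> 'a measure \<Rightarrow> (real \<times> 'a \<Rightarrow> real) \<Rightarrow> bool" where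
  "viscosity_subsolution \<mu> c\<^sub>1 \<nu> u \<longleftrightarrow> usc_on spacetime u \<and>
     (\<forall>\<phi> t x. smooth \<phi> \<and> t > 0 \<and> u (t, x) - \<phi> (t, x) = 0 \<and>
        (\<forall>q\<in>spacetime. u q - \<phi> q \<le> 0) \<longrightarrow>
        (let p = grad (\<lambda>y. \<phi> (t, y)) x; \<phi>\<^sub>t = deriv (\<lambda>s. \<phi> (s, x)) t in
          (p \<noteq> 0 \<longrightarrow> \<phi>\<^sub>t \<le> \<mu> (sgn p) * (c\<^sub>1 x + kappa_upper \<nu> x (\<lambda>y. \<phi> (t, y))) * norm p) \<and>
          (p = 0 \<longrightarrow> \<phi>\<^sub>t \<le> 0)))"

definition viscosity_supersolution ::
  "('a::euclidean_space \<Rightarrow> real) \<Rightarrow> ('a \<Rightarrow> real) \<Rightarrow> 'a measure \<Rightarrow> (real \<times> 'a \<Rightarrow> real) \<Rightarrow> bool" where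
  "viscosity_supersolution \<mu> c\<^sub>1 \<nu> u \<longleftrightarrow> lsc_on spacetime u \<and>
     (\<forall>\<phi> t x. smooth \<phi> \<and> t > 0 \<and> u (t, x) - \<phi> (t, x) = 0 \<and>
        (\<forall>q\<in>spacetime. u q - \<phi> q \<ge> 0) \<longrightarrow>
        (let p = grad (\<lambda>y. \<phi> (t, y)) x; \<phi>\<^sub>t = deriv (\<lambda>s. \<phi> (s, x)) t in
          (p \<noteq> 0 \<longrightarrow> \<phi>\<^sub>t \<ge> \<mu> (sgn p) * (c\<^sub>1 x + kappa_lower \<nu> x (\<lambda>y. \<phi> (t, y))) * norm p) \<and>
          (p = 0 \<longrightarrow> \<phi>\<^sub>t \<ge> 0)))"

definition locally_bounded_on :: "'b::metric_space set \<Rightarrow> ('b \<Rightarrow> real) \<Rightarrow> bool" where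
  "locally_bounded_on S u \<longleftrightarrow> (\<forall>p\<in>S. \<exists>r>0. bounded (u ` (ball p r \<inter> S)))"

definition viscosity_solution ::
  "('a::euclidean_space \<Rightarrow> real) \<Rightarrow> ('a \<Rightarrow> real) \<Rightarrow> 'a measure \<Rightarrow> (real \<times> 'a \<Rightarrow> real) \<Rightarrow> bool" where
  "viscosity_solution \<mu> c\<^sub>1 \<nu> u \<longleftrightarrow> locally_bounded_on spacetime u \<and>
     viscosity_subsolution \<mu> c\<^sub>1 \<nu> (usc_envelope spacetime u) \<and>
     viscosity_supersolution \<mu> c\<^sub>1 \<nu> (lsc_envelope spacetime u)"

end

theory Submission
  imports Defs
begin

text \<open>
  By duality (\<open>u\<close> to \<open>- u\<close>) and symmetry it suffices to show that \<open>v (t, x) \<ge> 0\<close> forces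
  \<open>u (t, x) \<ge> 0\<close>. The equation is geometric, so for large \<open>k\<close> the function
  \<open>w = - exp (- k (k v + 1))\<close> is again a subsolution; it is negative, and initially it lies below
  \<open>u\<close> up to a small error on any given compact set, since \<open>v (0, x) < 0\<close> wherever
  \<open>u (0, x) < 0\<close>. One compares \<open>w\<close> with \<open>u\<close> by doubling the variables. At a maximum point the
  superlevel set of \<open>w\<close> around \<open>x\<close>, translated by a small multiple of \<open>x - y\<close>, lies strictly
  inside that of \<open>u\<close> around \<open>y\<close>; as \<open>\<nu>\<close> has a density, translations are continuous in
  \<open>L\<^sup>1\<close> away from the origin, so the far parts of the curvatures compare up to a small error,
  while the near parts are small by the parabola conditions.

  Since \<open>\<mu>\<close> is merely continuous and \<open>c\<^sub>1\<close> may be unbounded, the gradient of the penalty that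
  localises the maximum produces an error that is not small where \<open>c\<^sub>1\<close> is large. It is
  absorbed by running time slightly faster for \<open>u\<close> where \<open>c\<^sub>1\<close> is large and slightly slower
  where \<open>- c\<^sub>1\<close> is large: this yields a gain proportional to \<open>\<bar>c\<^sub>1\<bar>\<close>. The transition depends on
  a third space variable \<open>\<xi>\<close> coupled to \<open>y\<close>, so that \<open>c\<^sub>1\<close> never has to be differentiated.
\<close>

section \<open>Continuity of translations in \<open>L\<^sup>1\<close>\<close>

text \<open>Two errors compete at the maximum point, and they dictate the order of the parameters.
  First, the localisation spoils the inclusion of the superlevel sets. Shifting y and \<xi> relative
  to x by a small multiple of x - y shortens x - y and so lowers the quadratic penalty by an amount
  fixed in advance, which pays for every term chosen later. If x - y is too short for this, the
  gradient is small as well, and as a factor it makes the curvature terms negligible. Second, the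
  gradients p and p' of the two sides differ by y - \<xi>. Where c is moderate, continuity of the
  speed suffices. Where c is large, the inequality for u enters multiplied by 1 + \<theta> or 1 -
  \<theta>, which gives the terms in c the right sign as soon as p - p' is small relative to p.
  Otherwise both gradients are of the order of y - \<xi>, and a logarithmic localisation makes this
  of order \<alpha> / (1 + |\<xi>|), against the linear growth of c.\<close>

lemma integrable_lborel_translation:
  fixes f :: "'a::euclidean_space \<Rightarrow> real"
  assumes "integrable lborel f"
  shows "integrable lborel (\<lambda>z. f (h + z))" "(\<integral>z. f (h + z) \<partial>lborel) = (\<integral>z. f z \<partial>lborel)"
proof -
  have f: "integrable (distr lborel borel ((+) h)) f" using assms by (simp add: lborel_distr_plus)
  then show "integrable lborel (\<lambda>z. f (h + z))"
    by (subst (asm) integrable_distr_eq) (use assms in auto)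
  have "(\<integral>z. f z \<partial>lborel) = (\<integral>z. f z \<partial>(distr lborel borel ((+) h)))" by (simp add: lborel_distr_plus)
  also have "\<dots> = (\<integral>z. f (h + z) \<partial>lborel)" by (rule integral_distr) (use assms in auto)
  finally show "(\<integral>z. f (h + z) \<partial>lborel) = (\<integral>z. f z \<partial>lborel)" by simp
qed

definition L1_translation_continuous :: "('a::euclidean_space \<Rightarrow> real) \<Rightarrow> bool" where
  "L1_translation_continuous f \<longleftrightarrow>
     (\<forall>h. h \<longlonglongrightarrow> 0 \<longrightarrow> (\<lambda>n. \<integral>z. \<bar>f (h n + z) - f z\<bar> \<partial>lborel) \<longlonglongrightarrow> 0)"

text \<open>Three-term splitting: by translation invariance the shifted error has the same integral
  as the error of \<open>g\<close> itself, so one approximation bound serves twice.\<close>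

lemma L1_translation_continuous_approx:
  fixes f :: "'a::euclidean_space \<Rightarrow> real"
  assumes f: "integrable lborel f"
    and app: "\<And>e. 0 < e \<Longrightarrow> \<exists>g. integrable lborel g \<and> L1_translation_continuous g \<and> (\<integral>z. \<bar>f z - g z\<bar> \<partial>lborel) \<le> e"
  shows "L1_translation_continuous f"
  unfolding L1_translation_continuous_def
proof (intro allI impI LIMSEQ_I)
  fix h :: "nat \<Rightarrow> 'a" and e :: real
  assume h: "h \<longlonglongrightarrow> 0" and e: "0 < e"
  obtain g where g: "integrable lborel g" "L1_translation_continuous g" "(\<integral>z. \<bar>f z - g z\<bar> \<partial>lborel) \<le> e/4"
    using app[of "e/4"] e by auto
  obtain N where N: "\<And>n. n \<ge> N \<Longrightarrow> norm ((\<integral>z. \<bar>g (h n + z) - g z\<bar> \<partial>lborel) - 0) < e/4"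
    using LIMSEQ_D[OF g(2)[unfolded L1_translation_continuous_def, rule_format, OF h], of "e/4"] e by auto
  show "\<exists>no. \<forall>n\<ge>no. norm ((\<integral>z. \<bar>f (h n + z) - f z\<bar> \<partial>lborel) - 0) < e"
  proof (intro exI allI impI)
    fix n assume n: "N \<le> n"
    have 1: "integrable lborel (\<lambda>z. f (h n + z))" "integrable lborel (\<lambda>z. g (h n + z))"
      by (rule integrable_lborel_translation; fact)+
    have fg: "integrable lborel (\<lambda>z. \<bar>f z - g z\<bar>)" using f g by simp
    have "(\<integral>z. \<bar>f (h n + z) - f z\<bar> \<partial>lborel) \<le>
      (\<integral>z. \<bar>f (h n + z) - g (h n + z)\<bar> + (\<bar>g (h n + z) - g z\<bar> + \<bar>f z - g z\<bar>) \<partial>lborel)"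
      by (rule integral_mono) (use 1 f g in auto)
    also have "\<dots> = (\<integral>z. \<bar>f (h n + z) - g (h n + z)\<bar> \<partial>lborel) + ((\<integral>z. \<bar>g (h n + z) - g z\<bar> \<partial>lborel) + (\<integral>z. \<bar>f z - g z\<bar> \<partial>lborel))"
      using 1 f g by simp
    also have "(\<integral>z. \<bar>f (h n + z) - g (h n + z)\<bar> \<partial>lborel) = (\<integral>z. \<bar>f z - g z\<bar> \<partial>lborel)"
      by (rule integrable_lborel_translation(2)[OF fg])
    finally have "(\<integral>z. \<bar>f (h n + z) - f z\<bar> \<partial>lborel) < e" using N[OF n] g(3) e by simp
    moreover have "0 \<le> (\<integral>z. \<bar>f (h n + z) - f z\<bar> \<partial>lborel)" by simp
    ultimately show "norm ((\<integral>z. \<bar>f (h n + z) - f z\<bar> \<partial>lborel) - 0) < e" by simp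
  qed
qed

text \<open>A point of an open set stays in it under a small shift, so the part of \<open>U\<close>
  that is lost tends to 0 by dominated convergence. The part gained has the same volume, because
  translations preserve volume; hence the factor 2.\<close>

lemma L1_translation_continuous_open:
  fixes U :: "'a::euclidean_space set"
  assumes "open U" "emeasure lborel U < \<infinity>"
  shows "L1_translation_continuous (indicat_real U)"
  unfolding L1_translation_continuous_def
proof (intro allI impI)
  fix h :: "nat \<Rightarrow> 'a" assume h: "h \<longlonglongrightarrow> 0"
  have [measurable]: "U \<in> sets borel" using assms by simp
  have i: "integrable lborel (indicat_real U)" using assms by (intro integrable_real_indicator) auto
  have ih: "integrable lborel (\<lambda>z. indicat_real U (h n + z))" for n by (rule integrable_lborel_translation[OF i])
  define d where "d n = (\<lambda>z. indicat_real U z * (1 - indicat_real U (h n + z)))" for n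
  have dm[measurable]: "d n \<in> borel_measurable lborel" for n unfolding d_def by measurable
  have lim: "(\<lambda>n. \<integral>z. d n z \<partial>lborel) \<longlonglongrightarrow> (\<integral>z. 0 \<partial>(lborel :: 'a measure))"
  proof (rule integral_dominated_convergence[where w = "indicat_real U"])
    show "AE z in lborel. (\<lambda>n. d n z) \<longlonglongrightarrow> 0"
    proof (rule AE_I2)
      fix z :: 'a
      show "(\<lambda>n. d n z) \<longlonglongrightarrow> 0"
      proof (cases "z \<in> U")
        case True
        have "(\<lambda>n. h n + z) \<longlonglongrightarrow> 0 + z" using h by (intro tendsto_intros)
        then have "\<forall>\<^sub>F n in sequentially. h n + z \<in> U"
          using assms(1) True topological_tendstoD by fastforce
        then have "\<forall>\<^sub>F n in sequentially. d n z = 0" by eventually_elim (simp add: d_def)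
        then show ?thesis by (rule tendsto_eventually)
      qed (simp add: d_def)
    qed
    show "AE z in lborel. norm (d n z) \<le> indicat_real U z" for n
      by (rule AE_I2) (auto simp: d_def indicator_def)
  qed (use i in auto)
  have id: "integrable lborel (d n)" for n
    by (rule Bochner_Integration.integrable_bound[OF i]) (auto simp: d_def indicator_def)
  have "(\<integral>z. \<bar>indicat_real U (h n + z) - indicat_real U z\<bar> \<partial>lborel) = 2 * (\<integral>z. d n z \<partial>lborel)" for n
  proof -
    have "(\<integral>z. \<bar>indicat_real U (h n + z) - indicat_real U z\<bar> \<partial>lborel)
       = (\<integral>z. (indicat_real U (h n + z) - indicat_real U z) + 2 * d n z \<partial>lborel)"
      by (rule Bochner_Integration.integral_cong) (auto simp: d_def indicator_def)
    also have "\<dots> = (\<integral>z. indicat_real U (h n + z) \<partial>lborel) - (\<integral>z. indicat_real U z \<partial>lborel) + 2 * (\<integral>z. d n z \<partial>lborel)"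
      using i ih id by simp
    also have "(\<integral>z. indicat_real U (h n + z) \<partial>lborel) = (\<integral>z. indicat_real U z \<partial>lborel)"
      by (rule integrable_lborel_translation(2)[OF i])
    finally show ?thesis by simp
  qed
  then show "(\<lambda>n. \<integral>z. \<bar>indicat_real U (h n + z) - indicat_real U z\<bar> \<partial>lborel) \<longlonglongrightarrow> 0"
    using tendsto_mult_right_zero[of _ _ 2] lim by simp
qed

lemma L1_translation_continuous_scale:
  assumes "L1_translation_continuous f"
  shows "L1_translation_continuous (\<lambda>z. f z * c)"
  unfolding L1_translation_continuous_def
proof (intro allI impI)
  fix h :: "nat \<Rightarrow> 'a" assume h: "h \<longlonglongrightarrow> 0"
  have "\<bar>f (h n + z) * c - f z * c\<bar> = \<bar>f (h n + z) - f z\<bar> * \<bar>c\<bar>" for n z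
    by (metis abs_mult left_diff_distrib)
  moreover have "(\<lambda>n. (\<integral>z. \<bar>f (h n + z) - f z\<bar> \<partial>lborel) * \<bar>c\<bar>) \<longlonglongrightarrow> 0"
    using assms h unfolding L1_translation_continuous_def by (intro tendsto_mult_left_zero) auto
  ultimately show "(\<lambda>n. \<integral>z. \<bar>f (h n + z) * c - f z * c\<bar> \<partial>lborel) \<longlonglongrightarrow> 0" by simp
qed

text \<open>Induction over simple functions and dominated limits leaves indicators of sets of finite
  measure; outer regularity replaces such a set by an open one.\<close>

lemma integrable_imp_L1_translation_continuous:
  fixes f :: "'a::euclidean_space \<Rightarrow> real"
  assumes "integrable lborel f"
  shows "L1_translation_continuous f"
  using assms
proof (induction rule: integrable_induct)
  case (base A c)
  have A: "A \<in> sets borel" "emeasure lborel A < \<infinity>" using base by auto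
  have iA: "integrable lborel (indicat_real A)" using A by (intro integrable_real_indicator) auto
  have "L1_translation_continuous (indicat_real A)"
  proof (rule L1_translation_continuous_approx[OF iA])
    fix e :: real assume e: "0 < e"
    obtain U where U: "open U" "A \<subseteq> U" "emeasure lborel (U - A) < ennreal e"
      using outer_regular_lborel[OF A(1) e] by auto
    have [measurable]: "U \<in> sets borel" "A \<in> sets borel" using U A by auto
    have "emeasure lborel U \<le> emeasure lborel A + emeasure lborel (U - A)"
      using U(2) by (subst plus_emeasure) (auto simp: Un_absorb1)
    also have "\<dots> < \<infinity>"
      by (metis A(2) U(3) ennreal_add_less_top ennreal_less_top infinity_ennreal_def order_less_trans)
    finally have Uf: "emeasure lborel U < \<infinity>" .
    have "\<bar>indicat_real A z - indicat_real U z\<bar> = indicat_real (U - A) z" for z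
      using U(2) by (auto simp: indicator_def)
    then have "(\<integral>z. \<bar>indicat_real A z - indicat_real U z\<bar> \<partial>lborel) = measure lborel (U - A)"
      by simp
    also have "\<dots> \<le> e" using U(3) e by (simp add: measure_def enn2real_leI order_less_imp_le)
    finally show "\<exists>g. integrable lborel g \<and> L1_translation_continuous g \<and> (\<integral>z. \<bar>indicat_real A z - g z\<bar> \<partial>lborel) \<le> e"
      using L1_translation_continuous_open[OF U(1) Uf] Uf by (intro exI[of _ "indicat_real U"]) auto
  qed
  then show ?case using L1_translation_continuous_scale[of "indicat_real A" c] by simp
next
  case (add f g)
  show ?case unfolding L1_translation_continuous_def
  proof (intro allI impI)
    fix h :: "nat \<Rightarrow> 'a" assume h: "h \<longlonglongrightarrow> 0"
    have i: "integrable lborel (\<lambda>z. f (h n + z))" "integrable lborel (\<lambda>z. g (h n + z))" for n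
      by (rule integrable_lborel_translation; fact)+
    have "(\<lambda>n. (\<integral>z. \<bar>f (h n + z) - f z\<bar> \<partial>lborel) + (\<integral>z. \<bar>g (h n + z) - g z\<bar> \<partial>lborel)) \<longlonglongrightarrow> 0 + 0"
      using add h unfolding L1_translation_continuous_def by (intro tendsto_add) auto
    then have "(\<lambda>n. (\<integral>z. \<bar>f (h n + z) - f z\<bar> + \<bar>g (h n + z) - g z\<bar> \<partial>lborel)) \<longlonglongrightarrow> 0"
      using i add by simp
    then show "(\<lambda>n. \<integral>z. \<bar>f (h n + z) + g (h n + z) - (f z + g z)\<bar> \<partial>lborel) \<longlonglongrightarrow> 0"
    proof (rule tendsto_sandwich[rotated 3])
      show "\<forall>\<^sub>F n in sequentially. (\<integral>z. \<bar>f (h n + z) + g (h n + z) - (f z + g z)\<bar> \<partial>lborel)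
         \<le> (\<integral>z. \<bar>f (h n + z) - f z\<bar> + \<bar>g (h n + z) - g z\<bar> \<partial>lborel)"
        by (intro always_eventually allI integral_mono) (use i add in auto)
      show "\<forall>\<^sub>F n in sequentially. 0 \<le> (\<integral>z. \<bar>f (h n + z) + g (h n + z) - (f z + g z)\<bar> \<partial>lborel)"
        by simp
    qed auto
  qed
next
  case (lim f s)
  have [measurable]: "f \<in> borel_measurable lborel" "s i \<in> borel_measurable lborel" for i
    using lim by auto
  have conv: "(\<lambda>i. s i z) \<longlonglongrightarrow> f z" and bound: "\<bar>s i z\<bar> \<le> 2 * \<bar>f z\<bar>" and fi: "integrable lborel f" for i z
    using lim by auto
  have "(\<lambda>i. \<integral>z. \<bar>f z - s i z\<bar> \<partial>lborel) \<longlonglongrightarrow> (\<integral>z. 0 \<partial>(lborel :: 'a measure))"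
  proof (rule integral_dominated_convergence[where w = "\<lambda>z. 3 * norm (f z)"])
    show "AE z in lborel. (\<lambda>i. \<bar>f z - s i z\<bar>) \<longlonglongrightarrow> 0"
    proof (rule AE_I2)
      fix z
      have "(\<lambda>i. \<bar>f z - s i z\<bar>) \<longlonglongrightarrow> \<bar>f z - f z\<bar>" by (intro tendsto_intros conv)
      then show "(\<lambda>i. \<bar>f z - s i z\<bar>) \<longlonglongrightarrow> 0" by simp
    qed
    show "AE z in lborel. norm \<bar>f z - s i z\<bar> \<le> 3 * norm (f z)" for i
    proof (rule AE_I2)
      fix z show "norm \<bar>f z - s i z\<bar> \<le> 3 * norm (f z)" using bound[of i z] by (simp add: abs_if split: if_splits)
    qed
  qed (use lim in auto)
  then have l: "(\<lambda>i. \<integral>z. \<bar>f z - s i z\<bar> \<partial>lborel) \<longlonglongrightarrow> 0" by simp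
  show ?case
  proof (rule L1_translation_continuous_approx[OF fi])
    fix e :: real assume "0 < e"
    then obtain i where "norm ((\<integral>z. \<bar>f z - s i z\<bar> \<partial>lborel) - 0) < e"
      using LIMSEQ_D[OF l] by blast
    then show "\<exists>g. integrable lborel g \<and> L1_translation_continuous g \<and> (\<integral>z. \<bar>f z - g z\<bar> \<partial>lborel) \<le> e"
      using lim by (intro exI[of _ "s i"]) auto
  qed
qed

section \<open>Estimates for the singular measure\<close>

text \<open>If a quadratic with gradient \<open>p\<close> touches a function from above, this is
  where the superlevel set of the function can enter the half-space
  \<open>p \<bullet> z \<le> 0\<close>. In contrast to \<open>parabola_region\<close>,
  \<open>p\<close> carries its length, so that the dependence on small gradients stays
  visible.\<close>

definition paraboloid :: "real \<Rightarrow> 'a::euclidean_space \<Rightarrow> real \<Rightarrow> 'a set" where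
  "paraboloid \<delta> p C = {z \<in> ball 0 \<delta>. \<bar>p \<bullet> z\<bar> \<le> C * (norm z)\<^sup>2}"

text \<open>The curvature at the origin of the set \<open>A\<close>, relative to the halfspace \<open>p \<bullet> z > 0\<close>. Inside the
  ball the points of the halfspace outside \<open>A\<close>, which contribute negatively, are dropped: this
  only weakens a subsolution inequality and keeps all terms finite.\<close>

definition level_curvature :: "'a::euclidean_space measure \<Rightarrow> real \<Rightarrow> 'a \<Rightarrow> 'a set \<Rightarrow> real" where
  "level_curvature \<nu> \<delta> p A = measure \<nu> {z \<in> A. norm z < \<delta> \<and> p \<bullet> z \<le> 0}
     + measure \<nu> (A - ball 0 \<delta>) - measure \<nu> {z \<in> - ball 0 \<delta>. 0 < p \<bullet> z}"

lemma measurable_paraboloid [measurable]: "paraboloid \<delta> p C \<in> sets borel"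
  unfolding paraboloid_def by measurable

lemma measurable_parabola_region [measurable]: "parabola_region \<delta> r e \<in> sets borel"
  unfolding parabola_region_def by measurable

text \<open>For \<open>norm z < r/2\<close> the normal component satisfies \<open>(z \<bullet>
  e)\<^sup>2 \<le> (r/2) * \<bar>z \<bullet> e\<bar>\<close>, so replacing \<open>norm z\<close> by
  the length of the tangential part costs half of \<open>r\<close>. The other points avoid
  \<open>ball 0 (r/2)\<close> and carry finite mass.\<close>

lemma paraboloid_subset_parabola_region:
  fixes e :: "'a::euclidean_space"
  assumes e: "norm e = 1" and r: "0 < r"
  shows "paraboloid \<delta> (r *\<^sub>R e) 1 \<subseteq> parabola_region \<delta> (r/2) e \<union> (ball 0 \<delta> - ball 0 (r/2))"
proof
  fix z assume z: "z \<in> paraboloid \<delta> (r *\<^sub>R e) 1"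
  show "z \<in> parabola_region \<delta> (r/2) e \<union> (ball 0 \<delta> - ball 0 (r/2))"
  proof (cases "norm z < r/2")
    case True
    have "r * \<bar>z \<bullet> e\<bar> \<le> (norm z)\<^sup>2" using z r by (simp add: paraboloid_def abs_mult inner_commute)
    moreover have "(norm (z - (z \<bullet> e) *\<^sub>R e))\<^sup>2 = (norm z)\<^sup>2 - (z \<bullet> e)\<^sup>2"
      using e unfolding power2_norm_eq_inner norm_eq_1
      by (simp add: inner_diff_left inner_diff_right inner_commute power2_eq_square)
    moreover have "(z \<bullet> e)\<^sup>2 \<le> (r/2) * \<bar>z \<bullet> e\<bar>"
    proof -
      have "\<bar>z \<bullet> e\<bar> \<le> r/2" using Cauchy_Schwarz_ineq2[of z e] e True by simp
      then have "\<bar>z \<bullet> e\<bar> * \<bar>z \<bullet> e\<bar> \<le> (r/2) * \<bar>z \<bullet> e\<bar>" by (intro mult_right_mono) auto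
      then show ?thesis by (simp add: power2_eq_square)
    qed
    ultimately have "r/2 * \<bar>z \<bullet> e\<bar> \<le> (norm (z - (z \<bullet> e) *\<^sub>R e))\<^sup>2" by (simp add: field_simps)
    then show ?thesis using z by (simp add: parabola_region_def paraboloid_def)
  qed (use z in \<open>auto simp: paraboloid_def\<close>)
qed

lemma paraboloid_mono: "C \<le> C' \<Longrightarrow> \<delta> \<le> \<delta>' \<Longrightarrow> paraboloid \<delta> p C \<subseteq> paraboloid \<delta>' p C'"
  unfolding paraboloid_def
  by (smt (verit, best) Collect_mono mem_ball_0 mult_right_mono zero_le_power2)

lemma paraboloid_scale: "0 < l \<Longrightarrow> paraboloid \<delta> (l *\<^sub>R p) (l * C) = paraboloid \<delta> p C"
  unfolding paraboloid_def by (auto simp: abs_mult mult.assoc)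

locale singular_measure =
  fixes \<nu> :: "'a::euclidean_space measure"
  assumes A3: "assumption_A3 \<nu>" and A3': "assumption_A3' \<nu>"
begin

lemma sets_nu [simp, measurable_cong]: "sets \<nu> = sets borel"
  using A3 by (auto simp: assumption_A3_def radon_off_origin_def)

lemma space_nu [simp]: "space \<nu> = UNIV"
  using sets_eq_imp_space_eq[OF sets_nu] by simp

lemma fmeasurable_outside:
  assumes "0 < \<delta>" "A \<in> sets borel" "A \<subseteq> - ball 0 \<delta>"
  shows "A \<in> fmeasurable \<nu>"
proof (rule fmeasurableI2)
  show "- ball 0 \<delta> \<in> fmeasurable \<nu>"
    using A3 assms(1) by (intro fmeasurableI) (auto simp: assumption_A3_def)
qed (use assms in auto)

lemma fmeasurable_parabola_region:
  assumes "0 < r" "norm e = 1" "\<delta> \<le> 1"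
  shows "parabola_region \<delta> r e \<in> fmeasurable \<nu>"
proof (rule fmeasurableI2)
  show "parabola_region 1 r e \<in> fmeasurable \<nu>"
    using A3 assms by (intro fmeasurableI) (auto simp: assumption_A3_def)
qed (use assms in \<open>auto simp: parabola_region_def\<close>)

lemma fmeasurable_paraboloid:
  assumes "p \<noteq> 0" "\<delta> \<le> 1"
  shows "paraboloid \<delta> p C \<in> fmeasurable \<nu>"
proof (rule fmeasurableI2)
  \<comment> \<open>\<open>C\<close> may be non-positive; the larger constant permits the
    normalisation of \<open>p\<close> as \<open>C' *\<^sub>R (r *\<^sub>R e)\<close>.\<close>
  define C' where "C' = max C 1"
  define r where "r = norm p / C'"
  define e where "e = sgn p"
  have r: "0 < r" and e: "norm e = 1" using assms by (auto simp: r_def C'_def e_def norm_sgn)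
  have pe: "C' *\<^sub>R (r *\<^sub>R e) = p" using assms(1) by (simp add: r_def e_def C'_def sgn_div_norm max_def)
  have "parabola_region \<delta> (r/2) e \<union> (ball 0 \<delta> - ball 0 (r/2)) \<in> fmeasurable \<nu>"
    using r e assms
    by (intro fmeasurable.Un fmeasurable_parabola_region fmeasurable_outside[of "r/2"]) auto
  moreover have "paraboloid \<delta> p C' = paraboloid \<delta> (r *\<^sub>R e) 1"
    using paraboloid_scale[of C' \<delta> "r *\<^sub>R e" 1] unfolding pe by (simp add: C'_def)
  ultimately show "paraboloid \<delta> p C' \<in> fmeasurable \<nu>"
    by (metis fmeasurableI2 measurable_paraboloid paraboloid_subset_parabola_region[OF e r] sets_nu)
  show "paraboloid \<delta> p C \<subseteq> paraboloid \<delta> p C'" by (rule paraboloid_mono) (auto simp: C'_def)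
qed simp

text \<open>With \<open>r = norm p / C\<close>, which is below 1 because \<open>norm p < C\<close>,
  the claim bounds \<open>r\<close> times the measure of a normalised paraboloid by \<epsilon>. The
  parabola part is controlled by the limit that is uniform in \<open>r\<close>, the annulus by the
  decay of \<open>d * measure \<nu> (- ball 0 d)\<close> at \<open>d = r/2\<close>.\<close>

lemma measure_paraboloid_small:
  assumes \<epsilon>: "0 < \<epsilon>"
  obtains \<delta> where "0 < \<delta>" "\<delta> \<le> 1"
    "\<And>\<delta>' p C. 0 < \<delta>' \<Longrightarrow> \<delta>' \<le> \<delta> \<Longrightarrow> norm p < C \<Longrightarrow> norm p * measure \<nu> (paraboloid \<delta>' p C) \<le> C * \<epsilon>"
proof -
  have "((\<lambda>d. d * measure \<nu> (- ball 0 d)) \<longlongrightarrow> 0) (at_right 0)"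
    using A3 by (simp add: assumption_A3_def)
  then have "\<forall>\<^sub>F d in at_right 0. dist (d * measure \<nu> (- ball 0 d)) 0 < \<epsilon>/4"
    using \<epsilon> by (intro tendstoD) auto
  then obtain d1 where d1: "0 < d1" "\<And>d. 0 < d \<Longrightarrow> d < d1 \<Longrightarrow> d * measure \<nu> (- ball 0 d) < \<epsilon>/4"
    unfolding eventually_at_right[OF zero_less_one] by (auto simp: dist_real_def)
  have "uniform_limit ({0<..<1} \<times> sphere 0 1)
       (\<lambda>\<delta> (r, e). r * measure \<nu> (parabola_region \<delta> r e)) (\<lambda>_. 0) (at_right 0)"
    using A3' by (simp add: assumption_A3'_def)
  then have "\<forall>\<^sub>F d in at_right 0. \<forall>x\<in>{0<..<1} \<times> sphere 0 1.
      dist ((case x of (r, e) \<Rightarrow> r * measure \<nu> (parabola_region d r e))) 0 < \<epsilon>/4"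
    using \<epsilon> by (intro uniform_limitD) auto
  then obtain d2 where d2: "0 < d2"
    "\<And>d r e. 0 < d \<Longrightarrow> d < d2 \<Longrightarrow> 0 < r \<Longrightarrow> r < 1 \<Longrightarrow> norm e = 1 \<Longrightarrow> r * measure \<nu> (parabola_region d r e) < \<epsilon>/4"
    unfolding eventually_at_right[OF zero_less_one] by (fastforce simp: dist_real_def)
  define d where "d = min 1 (min (d1/2) (d2/2))"
  have main: "norm p * measure \<nu> (paraboloid d' p C) \<le> C * \<epsilon>" if d': "0 < d'" "d' \<le> d" and pC: "norm p < C" for d' C and p :: 'a
  proof (cases "p = 0")
    case False
    define r where "r = norm p / C"
    define e where "e = sgn p"
    have C: "0 < C" using pC norm_ge_zero[of p] by linarith
    have r: "0 < r" "r < 1" and e: "norm e = 1" using False C pC by (auto simp: r_def e_def norm_sgn)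
    have pe: "C *\<^sub>R (r *\<^sub>R e) = p" using C False by (simp add: r_def e_def sgn_div_norm)
    have eq: "paraboloid d' p C = paraboloid d' (r *\<^sub>R e) 1"
      using paraboloid_scale[of C d' "r *\<^sub>R e" 1] C unfolding pe by simp
    have d1': "d' \<le> 1" "d' < d1" "d' < d2" using d' d1(1) d2(1) by (auto simp: d_def)
    have f1: "parabola_region d' (r/2) e \<in> fmeasurable \<nu>"
      using r e d1' by (intro fmeasurable_parabola_region) auto
    have f2: "ball 0 d' - ball 0 (r/2) \<in> fmeasurable \<nu>"
      using r by (intro fmeasurable_outside[of "r/2"]) auto
    have "measure \<nu> (paraboloid d' p C) \<le> measure \<nu> (parabola_region d' (r/2) e \<union> (ball 0 d' - ball 0 (r/2)))"
      unfolding eq by (intro measure_mono_fmeasurable paraboloid_subset_parabola_region e r fmeasurable.Un f1 f2) auto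
    also have "\<dots> \<le> measure \<nu> (parabola_region d' (r/2) e) + measure \<nu> (ball 0 d' - ball 0 (r/2))"
      using f1 f2 by (intro measure_Un_le) auto
    finally have "r * measure \<nu> (paraboloid d' p C) \<le> r * measure \<nu> (parabola_region d' (r/2) e) + r * measure \<nu> (ball 0 d' - ball 0 (r/2))"
      using r by (metis distrib_left mult_left_mono less_imp_le)
    moreover have "(r/2) * measure \<nu> (parabola_region d' (r/2) e) < \<epsilon>/4"
      using d2(2)[of d' "r/2" e] d1' r e d' by auto
    moreover have "(r/2) * measure \<nu> (ball 0 d' - ball 0 (r/2)) \<le> \<epsilon>/4"
    \<comment> \<open>The decay is available for small radii only: \<open>r/2 < d'\<close> brings
      \<open>r/2\<close> below \<open>d1\<close>, and otherwise the annulus is empty.\<close>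
    proof (cases "r/2 < d'")
      case True
      have "measure \<nu> (ball 0 d' - ball 0 (r/2)) \<le> measure \<nu> (- ball 0 (r/2))"
        using r by (intro measure_mono_fmeasurable fmeasurable_outside[of "r/2"]) auto
      then have "(r/2) * measure \<nu> (ball 0 d' - ball 0 (r/2)) \<le> (r/2) * measure \<nu> (- ball 0 (r/2))"
        using r by (intro mult_left_mono) auto
      also have "\<dots> < \<epsilon>/4" using d1(2)[of "r/2"] True d1' r by auto
      finally show ?thesis by simp
    next
      case F: False
      then have "ball 0 d' - ball 0 (r/2) = ({} :: 'a set)" by auto
      then show ?thesis using \<epsilon> by (simp only: measure_empty mult_zero_right)
    qed
    ultimately have "r * measure \<nu> (paraboloid d' p C) \<le> \<epsilon>" by (simp add: field_simps)
    then have "C * (r * measure \<nu> (paraboloid d' p C)) \<le> C * \<epsilon>" using C by (intro mult_left_mono) auto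
    moreover have "C * r = norm p" using C by (simp add: r_def)
    ultimately show ?thesis by (metis mult.assoc)
  qed (use pC \<epsilon> in simp)
  have "0 < d" "d \<le> 1" using d1(1) d2(1) by (auto simp: d_def)
  then show ?thesis using that[of d] main by blast
qed

lemma tail_small:
  assumes "0 < \<epsilon>"
  obtains R where "1 \<le> R" "measure \<nu> (- ball 0 R) \<le> \<epsilon>"
proof -
  have "(\<lambda>n. measure \<nu> (- ball 0 (1 + real n))) \<longlonglongrightarrow> measure \<nu> (\<Inter>n. - ball 0 (1 + real n))"
  proof (rule Lim_measure_decseq)
    show "range (\<lambda>n. - ball 0 (1 + real n)) \<subseteq> sets \<nu>" by auto
    show "decseq (\<lambda>n. - ball (0::'a) (1 + real n))" by (auto simp: decseq_def)
    show "emeasure \<nu> (- ball 0 (1 + real n)) \<noteq> \<infinity>" for n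
      using fmeasurableD2[OF fmeasurable_outside[of "1 + real n" "- ball 0 (1 + real n)"]] by auto
  qed
  moreover have "(\<Inter>n. - ball 0 (1 + real n)) = ({} :: 'a set)"
  proof -
    have "\<exists>n. norm (z::'a) < 1 + real n" for z by (metis add.commute less_add_one order_less_trans reals_Archimedean2)
    then have "\<exists>n. z \<notin> - ball 0 (1 + real n)" for z :: 'a by simp
    then show ?thesis by blast
  qed
  ultimately have "(\<lambda>n. measure \<nu> (- ball 0 (1 + real n))) \<longlonglongrightarrow> 0" by simp
  then obtain n where "norm (measure \<nu> (- ball 0 (1 + real n)) - 0) < \<epsilon>"
    using LIMSEQ_D assms by blast
  then show ?thesis by (intro that[of "1 + real n"]) auto
qed

lemma obtain_density:
  obtains J where "J \<in> borel_measurable borel" "\<And>z. 0 \<le> J z" "\<nu> = density lborel (\<lambda>z. ennreal (J z))"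
  using A3' unfolding assumption_A3'_def by blast

lemma null_hyperplane:
  assumes "p \<noteq> 0"
  shows "measure \<nu> {z \<in> A. p \<bullet> z = 0} = 0"
proof -
  obtain J where J: "J \<in> borel_measurable borel" "\<And>z. 0 \<le> J z" "\<nu> = density lborel (\<lambda>z. ennreal (J z))"
    using obtain_density by metis
  have "{z. p \<bullet> z = 0} \<in> null_sets lborel"
    using negligible_hyperplane[of p 0] assms
    by (simp add: negligible_iff_null_sets null_sets_completion_iff)
  then have "AE z in lborel. p \<bullet> z \<noteq> 0" by (auto dest: AE_not_in)
  then have "{z. p \<bullet> z = 0} \<in> null_sets \<nu>"
    unfolding J(3) using J(1) by (subst null_sets_density_iff) (auto elim: eventually_mono)
  moreover have "{z \<in> A. p \<bullet> z = 0} \<subseteq> {z. p \<bullet> z = 0}" by auto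
  \<comment> \<open>\<open>A\<close> is arbitrary: if the set is not measurable,
    \<open>measure\<close> has its default value 0.\<close>
  ultimately show ?thesis
    by (metis (no_types, lifting) measure_eq_0_null_sets measure_notin_sets null_sets_subset)
qed

text \<open>Two level curvatures with almost opposite directions subtract these two half-spaces,
  which should together carry almost all the outer mass. What they miss lies in the thin double cone
  \<open>D k (sgn p)\<close>. Such cones have small mass uniformly in the direction: otherwise
  compactness of the sphere would produce a hyperplane of positive mass, which a measure with a
  density does not have.\<close>

lemma halfspaces_cover:
  assumes \<delta>: "0 < \<delta>" and \<epsilon>: "0 < \<epsilon>" and p1: "0 < p1"
  obtains \<theta> where "0 < \<theta>"
    "\<And>p p'. p1 \<le> norm p \<Longrightarrow> norm (p - p') \<le> \<theta> \<Longrightarrow>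
      measure \<nu> (- ball 0 \<delta>) - \<epsilon> \<le> measure \<nu> {z \<in> - ball 0 \<delta>. 0 < p \<bullet> z} + measure \<nu> {z \<in> - ball 0 \<delta>. p' \<bullet> z < 0}"
proof -
  define D where "D k e = {z \<in> - ball 0 \<delta>. \<bar>e \<bullet> z\<bar> \<le> k * norm z}" for k and e :: 'a
  have D[measurable]: "D k e \<in> sets borel" for k e unfolding D_def by measurable
  have Df: "D k e \<in> fmeasurable \<nu>" for k e by (rule fmeasurable_outside[OF \<delta>]) (auto simp: D_def intro: D[unfolded D_def])
  have "\<exists>k>0. \<forall>e. norm e = 1 \<longrightarrow> measure \<nu> (D k e) \<le> \<epsilon>"
  proof (rule ccontr)
    assume "\<not> ?thesis"
    then have "\<forall>n. \<exists>e. norm e = 1 \<and> \<epsilon> < measure \<nu> (D (1 / real (Suc n)) e)"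
      by (metis not_le of_nat_0_less_iff zero_less_Suc zero_less_divide_1_iff)
    then obtain e where e: "\<And>n. norm (e n) = 1" "\<And>n. \<epsilon> < measure \<nu> (D (1 / real (Suc n)) (e n))"
      by metis
    have "compact (sphere (0::'a) 1)" by simp
    then obtain l s where l: "norm l = 1" and s: "strict_mono s" "(e \<circ> s) \<longlonglongrightarrow> l"
      using e(1) unfolding compact_def by (metis mem_sphere_0)
    have "(\<lambda>m. measure \<nu> (D (1 / real (Suc m)) l)) \<longlonglongrightarrow> measure \<nu> (\<Inter>m. D (1 / real (Suc m)) l)"
    proof (rule Lim_measure_decseq)
      show "decseq (\<lambda>m. D (1 / real (Suc m)) l)"
      proof (rule decseq_SucI)
        fix m show "D (1 / real (Suc (Suc m))) l \<subseteq> D (1 / real (Suc m)) l"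
        proof
          fix z assume z: "z \<in> D (1 / real (Suc (Suc m))) l"
          have "1 / real (Suc (Suc m)) * norm z \<le> 1 / real (Suc m) * norm z"
            by (intro mult_right_mono divide_left_mono) auto
          then show "z \<in> D (1 / real (Suc m)) l" using z unfolding D_def by auto
        qed
      qed
    qed (use fmeasurableD2[OF Df] in auto)
    moreover have "measure \<nu> (\<Inter>m. D (1 / real (Suc m)) l) = 0"
    proof -
      have "(\<Inter>m. D (1 / real (Suc m)) l) = {z \<in> - ball 0 \<delta>. l \<bullet> z = 0}"
      proof (intro equalityI subsetI)
        fix z assume z: "z \<in> (\<Inter>m. D (1 / real (Suc m)) l)"
        have "(\<lambda>m. 1 / real (Suc m) * norm z) \<longlonglongrightarrow> 0"
          by (intro tendsto_mult_left_zero) (rule LIMSEQ_Suc[OF lim_1_over_n])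
        then have "\<bar>l \<bullet> z\<bar> \<le> 0"
          by (rule LIMSEQ_le_const) (use z in \<open>auto simp: D_def\<close>)
        then show "z \<in> {z \<in> - ball 0 \<delta>. l \<bullet> z = 0}" using z by (auto simp: D_def)
      qed (auto simp: D_def)
      moreover have "l \<noteq> 0" using l by auto
      ultimately show ?thesis using null_hyperplane[of l "- ball 0 \<delta>"] by simp
    qed
    ultimately have "(\<lambda>m. measure \<nu> (D (1 / real (Suc m)) l)) \<longlonglongrightarrow> 0" by simp
    then obtain m where "norm (measure \<nu> (D (1 / real (Suc m)) l) - 0) < \<epsilon>" using LIMSEQ_D \<epsilon> by blast
    then have m: "measure \<nu> (D (1 / real (Suc m)) l) < \<epsilon>" by simp
    have "0 < 1 / real (Suc m) / 2" by simp
    then obtain N where N: "\<And>n. n \<ge> N \<Longrightarrow> norm ((e \<circ> s) n - l) < 1 / real (Suc m) / 2"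
      using LIMSEQ_D[OF s(2)] by blast
    \<comment> \<open>Half of the aperture \<open>1 / real (Suc m)\<close> is reserved for the
      distance of the directions and half for the cone itself; the latter requires
      \<open>2 * Suc m \<le> Suc (s n)\<close>.\<close>
    define n where "n = max N (Suc (2 * m))"
    have sn: "n \<le> s n" using s(1) by (rule seq_suble)
    have "D (1 / real (Suc (s n))) (e (s n)) \<subseteq> D (1 / real (Suc m)) l"
    proof
      fix z assume z: "z \<in> D (1 / real (Suc (s n))) (e (s n))"
      have "\<bar>l \<bullet> z\<bar> \<le> \<bar>e (s n) \<bullet> z\<bar> + \<bar>(e (s n) - l) \<bullet> z\<bar>" by (simp add: inner_diff_left)
      also have "\<dots> \<le> 1 / real (Suc (s n)) * norm z + norm (e (s n) - l) * norm z"
        using z Cauchy_Schwarz_ineq2[of "e (s n) - l" z] by (auto simp: D_def)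
      also have "\<dots> \<le> 1 / real (Suc m) / 2 * norm z + 1 / real (Suc m) / 2 * norm z"
      proof (intro add_mono mult_right_mono)
        have "2 * real (Suc m) \<le> real (Suc (s n))" using sn by (simp add: n_def)
        then show "1 / real (Suc (s n)) \<le> 1 / real (Suc m) / 2" by (simp add: field_simps)
        show "norm (e (s n) - l) \<le> 1 / real (Suc m) / 2" using N[of n] by (simp add: n_def)
      qed auto
      also have "\<dots> = 1 / real (Suc m) * norm z" by (simp only: distrib_right[symmetric] field_sum_of_halves)
      finally show "z \<in> D (1 / real (Suc m)) l" using z by (simp add: D_def)
    qed
    then have "measure \<nu> (D (1 / real (Suc (s n))) (e (s n))) \<le> measure \<nu> (D (1 / real (Suc m)) l)"
      by (intro measure_mono_fmeasurable Df) auto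
    then show False using m e(2)[of "s n"] by linarith
  qed
  then obtain k where k: "0 < k" "\<And>e. norm e = 1 \<Longrightarrow> measure \<nu> (D k e) \<le> \<epsilon>" by blast
  show ?thesis
  proof (rule that[of "k * p1"])
    fix p p' :: 'a assume p: "p1 \<le> norm p" "norm (p - p') \<le> k * p1"
    have p0: "0 < norm p" using p p1 by linarith
    define A where "A = {z \<in> - ball 0 \<delta>. 0 < p \<bullet> z}"
    define B where "B = {z \<in> - ball 0 \<delta>. p' \<bullet> z < 0}"
    have [measurable]: "A \<in> sets borel" "B \<in> sets borel" unfolding A_def B_def by measurable
    have f: "A \<in> fmeasurable \<nu>" "B \<in> fmeasurable \<nu>"
      by (rule fmeasurable_outside[OF \<delta>]; auto simp: A_def B_def)+
    have "- ball 0 \<delta> \<subseteq> (A \<union> B) \<union> D k (sgn p)"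
    proof
      fix z :: 'a assume z: "z \<in> - ball 0 \<delta>"
      show "z \<in> (A \<union> B) \<union> D k (sgn p)"
      proof (cases "z \<in> A \<union> B")
        case False
        then have "p \<bullet> z \<le> 0" "0 \<le> p' \<bullet> z" using z by (auto simp: A_def B_def)
        then have "\<bar>p \<bullet> z\<bar> \<le> \<bar>(p - p') \<bullet> z\<bar>" by (simp add: inner_diff_left)
        also have "\<dots> \<le> norm (p - p') * norm z" by (rule Cauchy_Schwarz_ineq2)
        also have "\<dots> \<le> k * norm p * norm z"
          using p k(1) by (intro mult_right_mono) (auto intro: order_trans mult_left_mono)
        finally have "\<bar>sgn p \<bullet> z\<bar> \<le> k * norm z"
          using p0 by (simp add: sgn_div_norm abs_mult field_simps)
        then show ?thesis using z by (simp add: D_def)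
      qed auto
    qed
    then have "measure \<nu> (- ball 0 \<delta>) \<le> measure \<nu> ((A \<union> B) \<union> D k (sgn p))"
      using f Df by (intro measure_mono_fmeasurable) auto
    also have "\<dots> \<le> measure \<nu> (A \<union> B) + measure \<nu> (D k (sgn p))" using f Df by (intro measure_Un_le) auto
    also have "measure \<nu> (A \<union> B) \<le> measure \<nu> A + measure \<nu> B" using f by (intro measure_Un_le) auto
    also have "measure \<nu> (D k (sgn p)) \<le> \<epsilon>" using p0 by (intro k(2)) (auto simp: norm_sgn)
    finally show "measure \<nu> (- ball 0 \<delta>) - \<epsilon> \<le> measure \<nu> A + measure \<nu> B" by simp
  qed (use k p1 in simp)
qed

text \<open>For \<open>h = 0\<close> this is additivity on disjoint sets. In general the integral
  over \<open>B\<close> is shifted by \<open>h\<close>, after which the two indicators do not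
  overlap, and shifting the density costs its modulus of continuity in \<open>L\<^sup>1\<close>.
  Cutting the density off at radius \<delta> makes it integrable.\<close>

lemma translated_disjoint:
  assumes \<delta>: "0 < \<delta>" and \<epsilon>: "0 < \<epsilon>"
  obtains r where "0 < r"
    "\<And>(h::'a) A B. norm h \<le> r \<Longrightarrow> A \<in> sets borel \<Longrightarrow> B \<in> sets borel \<Longrightarrow> (\<And>z. z \<in> A \<Longrightarrow> z + h \<notin> B) \<Longrightarrow>
      measure \<nu> (A - ball 0 \<delta>) + measure \<nu> (B - ball 0 \<delta>) \<le> measure \<nu> (- ball 0 \<delta>) + \<epsilon>"
proof -
  obtain J where J[measurable]: "J \<in> borel_measurable borel" and J0: "\<And>z. 0 \<le> J z"
    and nu: "\<nu> = density lborel (\<lambda>z. ennreal (J z))"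
    using obtain_density by metis
  define g where "g z = indicat_real (- ball 0 \<delta>) z * J z" for z
  have g[measurable]: "g \<in> borel_measurable borel" unfolding g_def by measurable
  have g0: "0 \<le> g z" for z using J0 by (simp add: g_def)
  have em: "emeasure \<nu> (A - ball 0 \<delta>) = (\<integral>\<^sup>+z. ennreal (indicat_real A z * g z) \<partial>lborel)" if [measurable]: "A \<in> sets borel" for A
    unfolding nu by (subst emeasure_density) (auto intro!: nn_integral_cong simp: g_def indicator_def)
  have gi: "integrable lborel g"
  proof (rule integrableI_nonneg)
    have "emeasure \<nu> (UNIV - ball 0 \<delta>) < \<infinity>"
      using fmeasurableD2[OF fmeasurable_outside[OF \<delta>, of "UNIV - ball 0 \<delta>"]] by (auto simp: less_top)
    then show "(\<integral>\<^sup>+z. ennreal (g z) \<partial>lborel) < \<infinity>" using em[of UNIV] by simp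
  qed (use g0 in auto)
  have Ai: "integrable lborel (\<lambda>z. indicat_real A z * g z)" if "A \<in> sets borel" for A
    by (rule Bochner_Integration.integrable_bound[OF gi]) (use that g0 in \<open>auto simp: indicator_def\<close>)
  have me: "measure \<nu> (A - ball 0 \<delta>) = (\<integral>z. indicat_real A z * g z \<partial>lborel)" if A: "A \<in> sets borel" for A
    unfolding measure_def em[OF A] using A g0
    by (subst integral_eq_nn_integral) auto
  have "\<exists>r>0. \<forall>h :: 'a. norm h \<le> r \<longrightarrow> (\<integral>z. \<bar>g (h + z) - g z\<bar> \<partial>lborel) \<le> \<epsilon>"
  proof (rule ccontr)
    assume "\<not> ?thesis"
    then have "\<forall>n. \<exists>h :: 'a. norm h \<le> 1 / real (Suc n) \<and> \<epsilon> < (\<integral>z. \<bar>g (h + z) - g z\<bar> \<partial>lborel)"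
      by (metis not_le of_nat_0_less_iff zero_less_Suc zero_less_divide_1_iff)
    then obtain h :: "nat \<Rightarrow> 'a" where h: "\<And>n. norm (h n) \<le> 1 / real (Suc n)" "\<And>n. \<epsilon> < (\<integral>z. \<bar>g (h n + z) - g z\<bar> \<partial>lborel)"
      by metis
    have "h \<longlonglongrightarrow> 0"
      by (rule Lim_null_comparison[OF _ LIMSEQ_Suc[OF lim_1_over_n]]) (use h(1) in auto)
    then have "(\<lambda>n. \<integral>z. \<bar>g (h n + z) - g z\<bar> \<partial>lborel) \<longlonglongrightarrow> 0"
      using integrable_imp_L1_translation_continuous[OF gi] by (simp add: L1_translation_continuous_def)
    then obtain n where "norm ((\<integral>z. \<bar>g (h n + z) - g z\<bar> \<partial>lborel) - 0) < \<epsilon>" using LIMSEQ_D \<epsilon> by blast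
    then show False using h(2)[of n] by simp
  qed
  then obtain r where r: "0 < r" "\<And>h :: 'a. norm h \<le> r \<Longrightarrow> (\<integral>z. \<bar>g (h + z) - g z\<bar> \<partial>lborel) \<le> \<epsilon>" by blast
  show ?thesis
  proof (rule that[OF r(1)])
    fix h :: 'a and A B assume h: "norm h \<le> r" and A[measurable]: "A \<in> sets borel" and B[measurable]: "B \<in> sets borel"
      and dis: "\<And>z. z \<in> A \<Longrightarrow> z + h \<notin> B"
    have gh: "integrable lborel (\<lambda>z. g (h + z))" by (rule integrable_lborel_translation[OF gi])
    have Bh: "integrable lborel (\<lambda>z. indicat_real B (h + z) * g (h + z))"
      by (rule integrable_lborel_translation[OF Ai[OF B]])
    have "measure \<nu> (A - ball 0 \<delta>) + measure \<nu> (B - ball 0 \<delta>) =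
       (\<integral>z. indicat_real A z * g z \<partial>lborel) + (\<integral>z. indicat_real B (h + z) * g (h + z) \<partial>lborel)"
      using me[OF A] me[OF B] integrable_lborel_translation(2)[OF Ai[OF B], of h] by simp
    also have "\<dots> = (\<integral>z. indicat_real A z * g z + indicat_real B (h + z) * g (h + z) \<partial>lborel)"
      using Ai[OF A] Bh by simp
    also have "\<dots> \<le> (\<integral>z. g (h + z) + \<bar>g (h + z) - g z\<bar> \<partial>lborel)"
    proof (rule integral_mono)
      fix z
      have "h + z \<notin> B" if "z \<in> A" using dis[OF that] by (simp add: add.commute)
      then show "indicat_real A z * g z + indicat_real B (h + z) * g (h + z) \<le> g (h + z) + \<bar>g (h + z) - g z\<bar>"
        using g0[of "h + z"] g0[of z] by (auto simp: indicator_def)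
    qed (use Ai[OF A] Bh gh gi in auto)
    also have "\<dots> = (\<integral>z. g (h + z) \<partial>lborel) + (\<integral>z. \<bar>g (h + z) - g z\<bar> \<partial>lborel)"
      using gh gi by simp
    also have "(\<integral>z. g (h + z) \<partial>lborel) = measure \<nu> (- ball 0 \<delta>)"
      using integrable_lborel_translation(2)[OF gi, of h] me[of UNIV] by (simp add: Compl_eq_Diff_UNIV)
    finally show "measure \<nu> (A - ball 0 \<delta>) + measure \<nu> (B - ball 0 \<delta>) \<le> measure \<nu> (- ball 0 \<delta>) + \<epsilon>"
      using r(2)[OF h] by simp
  qed
qed

end

section \<open>Polynomial test functions\<close>

lemma real_polynomial_function_has_derivative:
  fixes f :: "'a::euclidean_space \<Rightarrow> real"
  assumes "real_polynomial_function f"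
  shows "\<exists>f'. (\<forall>x. (f has_derivative f' x) (at x)) \<and> (\<forall>v. real_polynomial_function (\<lambda>x. f' x v))"
  using assms
proof (induction rule: real_polynomial_function.induct)
  case (linear f)
  then show ?case
    by (intro exI[of _ "\<lambda>x. f"]) (auto intro: bounded_linear_imp_has_derivative real_polynomial_function.intros(2))
next
  case (const c)
  show ?case by (rule exI[of _ "\<lambda>x v. 0"]) (auto intro: real_polynomial_function.intros(2))
next
  case (add f g)
  then obtain f' g' where "\<forall>x. (f has_derivative f' x) (at x)" "\<forall>v. real_polynomial_function (\<lambda>x. f' x v)"
    "\<forall>x. (g has_derivative g' x) (at x)" "\<forall>v. real_polynomial_function (\<lambda>x. g' x v)" by metis
  then show ?case
    by (intro exI[of _ "\<lambda>x v. f' x v + g' x v"]) (auto intro: real_polynomial_function.intros(3) has_derivative_add)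
next
  case (mult f g)
  then obtain f' g' where "\<forall>x. (f has_derivative f' x) (at x)" "\<forall>v. real_polynomial_function (\<lambda>x. f' x v)"
    "\<forall>x. (g has_derivative g' x) (at x)" "\<forall>v. real_polynomial_function (\<lambda>x. g' x v)" by metis
  with mult show ?case
    by (intro exI[of _ "\<lambda>x v. f x * g' x v + f' x v * g x"])
       (auto intro!: real_polynomial_function.intros(3) real_polynomial_function.intros(4) has_derivative_mult)
qed

lemma real_polynomial_function_Ck: "real_polynomial_function f \<Longrightarrow> Ck k f"
proof (induction k arbitrary: f)
  case 0
  then show ?case
    using continuous_on_polymonial_function by (simp add: real_polynomial_function_eq)
next
  case (Suc k)
  obtain f' where f': "\<And>x. (f has_derivative f' x) (at x)" "\<And>v. real_polynomial_function (\<lambda>x. f' x v)"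
    using real_polynomial_function_has_derivative[OF Suc.prems] by metis
  have "frechet_derivative f (at x) = f' x" for x using frechet_derivative_at[OF f'(1)[of x]] by simp
  then show ?case using f' Suc.IH by (auto simp: differentiable_def)
qed

lemma real_polynomial_function_smooth: "real_polynomial_function f \<Longrightarrow> smooth f"
  by (simp add: smooth_def real_polynomial_function_Ck)

lemma real_polynomial_function_power2_norm:
  "real_polynomial_function (\<lambda>q. (norm (q - c :: 'a::euclidean_space))\<^sup>2)"
proof -
  have "(norm (q - c))\<^sup>2 = (\<Sum>i\<in>Basis. (q \<bullet> i - c \<bullet> i)\<^sup>2)" for q
    unfolding power2_norm_eq_inner
    by (subst euclidean_inner) (simp add: inner_diff_left power2_eq_square)
  moreover have "real_polynomial_function (\<lambda>q. \<Sum>i\<in>Basis. (q \<bullet> i - c \<bullet> i)\<^sup>2)"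
    by (intro real_polynomial_function_sum real_polynomial_function_power real_polynomial_function_diff
        real_polynomial_function.intros(2) real_polynomial_function.intros(1) bounded_linear_inner_left) auto
  ultimately show ?thesis by simp
qed

lemma real_polynomial_function_growth:
  fixes f :: "'a::euclidean_space \<Rightarrow> real"
  assumes "real_polynomial_function f"
  shows "\<exists>K d. 0 \<le> K \<and> (\<forall>x. \<bar>f x\<bar> \<le> K * (1 + (norm x)\<^sup>2) ^ d)"
  using assms
proof (induction rule: real_polynomial_function.induct)
  case (linear f)
  then obtain K where K: "0 < K" "\<And>x. norm (f x) \<le> norm x * K" using bounded_linear.pos_bounded by blast
  have "\<bar>f x\<bar> \<le> K * (1 + (norm x)\<^sup>2) ^ 1" for x
  proof -
    have "0 \<le> (norm x - 1)\<^sup>2" by simp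
    then have "2 * norm x \<le> 1 + (norm x)\<^sup>2" by (simp add: power2_diff)
    then have "norm x \<le> 1 + (norm x)\<^sup>2" using norm_ge_zero[of x] by linarith
    then have "norm x * K \<le> (1 + (norm x)\<^sup>2) * K" using K(1) by (intro mult_right_mono) auto
    then show ?thesis using K(2)[of x] by (simp add: mult.commute)
  qed
  then show ?case using K(1) by (metis less_imp_le)
next
  case (const c)
  show ?case by (rule exI[of _ "\<bar>c\<bar>"], rule exI[of _ 0]) simp
next
  case (add f g)
  then obtain K d K' d' where b: "0 \<le> K" "\<And>x. \<bar>f x\<bar> \<le> K * (1 + (norm x)\<^sup>2) ^ d"
    "0 \<le> K'" "\<And>x. \<bar>g x\<bar> \<le> K' * (1 + (norm x)\<^sup>2) ^ d'" by metis
  have "\<bar>f x + g x\<bar> \<le> (K + K') * (1 + (norm x)\<^sup>2) ^ (d + d')" for x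
  proof -
    have "(1 + (norm x)\<^sup>2) ^ d \<le> (1 + (norm x)\<^sup>2) ^ (d + d')" "(1 + (norm x)\<^sup>2) ^ d' \<le> (1 + (norm x)\<^sup>2) ^ (d + d')"
      by (auto intro: power_increasing)
    then have "K * (1 + (norm x)\<^sup>2) ^ d \<le> K * (1 + (norm x)\<^sup>2) ^ (d + d')" "K' * (1 + (norm x)\<^sup>2) ^ d' \<le> K' * (1 + (norm x)\<^sup>2) ^ (d + d')"
      using b by (auto intro: mult_left_mono)
    then show ?thesis using b(2)[of x] b(4)[of x] by (simp add: algebra_simps)
  qed
  then show ?case using b by (intro exI[of _ "K + K'"] exI[of _ "d + d'"]) auto
next
  case (mult f g)
  then obtain K d K' d' where b: "0 \<le> K" "\<And>x. \<bar>f x\<bar> \<le> K * (1 + (norm x)\<^sup>2) ^ d"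
    "0 \<le> K'" "\<And>x. \<bar>g x\<bar> \<le> K' * (1 + (norm x)\<^sup>2) ^ d'" by metis
  have "\<bar>f x * g x\<bar> \<le> (K * K') * (1 + (norm x)\<^sup>2) ^ (d + d')" for x
  proof -
    have "\<bar>f x\<bar> * \<bar>g x\<bar> \<le> (K * (1 + (norm x)\<^sup>2) ^ d) * (K' * (1 + (norm x)\<^sup>2) ^ d')"
      by (intro mult_mono b) (use b in auto)
    then show ?thesis by (simp add: abs_mult power_add mult_ac)
  qed
  then show ?case using b by (intro exI[of _ "K * K'"] exI[of _ "d + d'"]) auto
qed

text \<open>Test functions must be smooth on the whole space; polynomials are, so no cut-off
  functions have to be built. Weierstrass approximation serves on \<open>cball 0 (2*R)\<close>.
  Beyond it a high power of \<open>(norm x)\<^sup>2 / (2*R\<^sup>2)\<close>, which is at least 2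
  there, outgrows \<open>P\<close> and \<open>B\<close>, while for \<open>norm x \<le> R\<close>
  that power is at most 1.\<close>

lemma polynomial_majorant:
  fixes f :: "'a::euclidean_space \<Rightarrow> real"
  assumes f: "continuous_on UNIV f" and B: "\<And>x. f x \<le> B" and R: "0 < R" and \<gamma>: "0 < \<gamma>"
  obtains b where "real_polynomial_function b" "\<And>x. f x \<le> b x" "\<And>x. norm x \<le> R \<Longrightarrow> b x \<le> f x + \<gamma>"
proof -
  obtain P where P: "real_polynomial_function P" "\<And>x. x \<in> cball 0 (2*R) \<Longrightarrow> \<bar>f x - P x\<bar> < \<gamma>/4"
  proof (rule Stone_Weierstrass_real_polynomial_function[of "cball 0 (2*R)" f "\<gamma>/4"])
    show "continuous_on (cball 0 (2*R)) f" by (rule continuous_on_subset[OF f]) auto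
  qed (use \<gamma> in auto)
  obtain K d where K: "0 \<le> K" "\<And>x. \<bar>P x\<bar> \<le> K * (1 + (norm x)\<^sup>2) ^ d"
    using real_polynomial_function_growth[OF P(1)] by blast
  \<comment> \<open>Chosen so that \<open>1 + (norm x)\<^sup>2 \<le> c * y\<close> whenever
    \<open>y = (norm x)\<^sup>2 / (2*R\<^sup>2)\<close> is at least 2.\<close>
  define c where "c = 1/2 + 2*R\<^sup>2"
  obtain n where n: "2/\<gamma> * (\<bar>B\<bar> + K * c^d) < 2 ^ n" using real_arch_pow[of 2] by auto
  define b where "b x = P x + \<gamma>/4 + \<gamma>/2 * ((norm (x - 0))\<^sup>2 / (2*R\<^sup>2)) ^ (d + n)" for x
  show ?thesis
  proof (rule that)
    show "real_polynomial_function b" unfolding b_def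
      by (intro real_polynomial_function.intros(3) real_polynomial_function.intros(4) real_polynomial_function.intros(2) P(1)
          real_polynomial_function_power real_polynomial_function_divide real_polynomial_function_power2_norm)
    show "f x \<le> b x" for x
    proof (cases "norm x \<le> 2*R")
      case True
      have "0 \<le> \<gamma>/2 * ((norm x)\<^sup>2 / (2*R\<^sup>2)) ^ (d + n)" using \<gamma> by simp
      moreover have "\<bar>f x - P x\<bar> < \<gamma>/4" using True by (intro P(2)) simp
      ultimately show ?thesis unfolding b_def diff_0_right by linarith
    next
      case False
      define y where "y = (norm x)\<^sup>2 / (2*R\<^sup>2)"
      have "(2*R)\<^sup>2 \<le> (norm x)\<^sup>2" using False R by (intro power_mono) auto
      then have y: "2 \<le> y" using R by (simp add: y_def field_simps power2_eq_square)
      have xy: "(norm x)\<^sup>2 = 2*R\<^sup>2 * y" using R by (simp add: y_def)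
      have "(1 + (norm x)\<^sup>2) ^ d \<le> (c * y) ^ d"
        using y by (intro power_mono) (auto simp: xy c_def algebra_simps)
      then have "K * (1 + (norm x)\<^sup>2) ^ d \<le> K * c^d * y^d"
        using K(1) by (simp add: power_mult_distrib mult_left_mono mult.assoc)
      then have "- P x \<le> K * c^d * y^d" using K(2)[of x] by linarith
      moreover have "f x \<le> \<bar>B\<bar> * y^d"
      proof -
        have "1 \<le> y ^ d" using y by simp
        then have "\<bar>B\<bar> * 1 \<le> \<bar>B\<bar> * y^d" by (intro mult_left_mono) auto
        then show ?thesis using B[of x] by linarith
      qed
      ultimately have "f x - P x \<le> (\<bar>B\<bar> + K * c^d) * y^d" by (simp add: algebra_simps)
      also have "\<dots> \<le> (\<gamma>/2 * y^n) * y^d"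
      proof (rule mult_right_mono)
        have "(2::real)^n \<le> y^n" using y by (intro power_mono) auto
        then have "2/\<gamma> * (\<bar>B\<bar> + K * c^d) \<le> y^n" using n by linarith
        then show "\<bar>B\<bar> + K * c^d \<le> \<gamma>/2 * y^n" using \<gamma> by (simp add: field_simps)
      qed (use y in simp)
      also have "\<dots> = \<gamma>/2 * y^(d+n)" by (simp add: power_add)
      finally show ?thesis using \<gamma> by (simp add: b_def y_def)
    qed
    show "b x \<le> f x + \<gamma>" if "norm x \<le> R" for x
    proof -
      have "(norm x)\<^sup>2 \<le> R\<^sup>2" using that by (intro power_mono) auto
      then have "(norm x)\<^sup>2 \<le> 2*R\<^sup>2" using zero_le_power2[of R] by linarith
      then have "(norm x)\<^sup>2 / (2*R\<^sup>2) \<le> 1" using R by (simp add: divide_le_eq_1)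
      then have "((norm x)\<^sup>2 / (2*R\<^sup>2)) ^ (d + n) \<le> 1" by (intro power_le_one) auto
      then have "\<gamma>/2 * ((norm x)\<^sup>2 / (2*R\<^sup>2)) ^ (d + n) \<le> \<gamma>/2 * 1" using \<gamma> by (intro mult_left_mono) auto
      moreover have "P x \<le> f x + \<gamma>/4" using P(2)[of x] that R by (simp add: abs_if split: if_splits)
      ultimately show ?thesis by (simp add: b_def)
    qed
  qed
qed

text \<open>Subsolutions of \<open>\<partial>\<^sub>t f = h (Df) (c + \<kappa>)\<close> with \<open>h p = \<mu> (p / |p|) |p|\<close>: the function is touched
  by a quadratic, but the curvature is that of its own superlevel set.\<close>

definition geo_sub :: "('a::euclidean_space \<Rightarrow> real) \<Rightarrow> ('a \<Rightarrow> real) \<Rightarrow> 'a measure \<Rightarrow> (real \<times> 'a \<Rightarrow> real) \<Rightarrow> bool" where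
  "geo_sub h c \<nu> f \<longleftrightarrow>
     (\<forall>t x a p C \<rho> \<delta>. 0 < t \<and> 0 < \<rho> \<and> 0 < \<delta> \<and> \<delta> \<le> 1 \<and>
        (\<forall>q\<in>spacetime. dist q (t, x) < \<rho> \<longrightarrow>
           f q \<le> f (t, x) + a * (fst q - t) + p \<bullet> (snd q - x) + C * (dist q (t, x))\<^sup>2) \<longrightarrow>
        a \<le> h p * (c x + level_curvature \<nu> \<delta> p {z. f (t, x) \<le> f (t, x + z)}))"

text \<open>At distance at least \<rho> from \<open>q0\<close> the linear terms and the global bound
  are themselves at most multiples of the squared distance; these multiples are added to
  \<open>C\<close>.\<close>

lemma quadratic_bound_global:
  fixes G :: "real \<times> 'a::euclidean_space \<Rightarrow> real"
  assumes \<rho>: "0 < \<rho>"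
    and loc: "\<And>q. dist q q0 < \<rho> \<Longrightarrow> G q \<le> G0 + a * (fst q - fst q0) + p \<bullet> (snd q - snd q0) + C * (dist q q0)\<^sup>2"
    and M: "\<And>q. G q \<le> G0 + M"
  obtains C' where "0 \<le> C'" "\<And>q. G q \<le> G0 + a * (fst q - fst q0) + p \<bullet> (snd q - snd q0) + C' * (dist q q0)\<^sup>2"
proof -
  define C' where "C' = max 0 C + (\<bar>a\<bar> + norm p)/\<rho> + \<bar>M\<bar>/\<rho>\<^sup>2"
  have r0: "0 \<le> (\<bar>a\<bar> + norm p)/\<rho>" "0 \<le> \<bar>M\<bar>/\<rho>\<^sup>2" using \<rho> by auto
  show ?thesis
  proof (rule that)
    show "0 \<le> C'" using r0 by (simp add: C'_def)
    fix q
    define d where "d = dist q q0"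
    have d0: "0 \<le> d" by (simp add: d_def)
    show "G q \<le> G0 + a * (fst q - fst q0) + p \<bullet> (snd q - snd q0) + C' * (dist q q0)\<^sup>2"
    proof (cases "d < \<rho>")
      case True
      have "C \<le> C'" unfolding C'_def using r0 max.cobounded2[of C 0] by linarith
      then have "C * d\<^sup>2 \<le> C' * d\<^sup>2" by (intro mult_right_mono) auto
      then show ?thesis using loc[of q] True by (simp add: d_def)
    next
      case False
      have f: "\<bar>fst q - fst q0\<bar> \<le> d" "norm (snd q - snd q0) \<le> d"
        using dist_fst_le[of q q0] dist_snd_le[of q q0] by (auto simp: d_def dist_real_def dist_norm)
      have "\<bar>a * (fst q - fst q0)\<bar> \<le> \<bar>a\<bar> * d" using f(1) by (simp add: abs_mult mult_left_mono)
      moreover have "\<bar>p \<bullet> (snd q - snd q0)\<bar> \<le> norm p * d"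
        using Cauchy_Schwarz_ineq2[of p "snd q - snd q0"] f(2) by (meson mult_left_mono norm_ge_zero order_trans)
      moreover have "(\<bar>a\<bar> + norm p) * d \<le> (\<bar>a\<bar> + norm p)/\<rho> * d\<^sup>2"
      proof -
        have "(\<bar>a\<bar> + norm p) * (\<rho> * d) \<le> (\<bar>a\<bar> + norm p) * (d * d)"
          using False d0 by (intro mult_left_mono mult_right_mono) auto
        then show ?thesis using \<rho> by (simp add: field_simps power2_eq_square)
      qed
      moreover have "\<bar>M\<bar> \<le> \<bar>M\<bar>/\<rho>\<^sup>2 * d\<^sup>2"
      proof -
        have "\<rho>\<^sup>2 \<le> d\<^sup>2" using False \<rho> by (intro power_mono) auto
        then have "\<bar>M\<bar> * \<rho>\<^sup>2 \<le> \<bar>M\<bar> * d\<^sup>2" by (intro mult_left_mono) auto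
        then show ?thesis using \<rho> by (simp add: field_simps)
      qed
      moreover have "0 \<le> max 0 C * d\<^sup>2" by simp
      moreover have "C' * d\<^sup>2 = max 0 C * d\<^sup>2 + (\<bar>a\<bar> + norm p)/\<rho> * d\<^sup>2 + \<bar>M\<bar>/\<rho>\<^sup>2 * d\<^sup>2"
        by (simp add: C'_def algebra_simps)
      moreover have "(\<bar>a\<bar> + norm p) * d = \<bar>a\<bar> * d + norm p * d" by (rule distrib_right)
      moreover note M[of q]
      ultimately show ?thesis unfolding d_def[symmetric] by linarith
    qed
  qed
qed

text \<open>The test function is a polynomial \<open>L + b |q - q0|\<^sup>2\<close>: the factor \<open>b\<close> majorises a continuous
  function lying above \<open>(f - L) / |q - q0|\<^sup>2\<close> and equal to it outside a small ball.\<close>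

lemma polynomial_test_function:
  fixes f :: "real \<times> 'a::euclidean_space \<Rightarrow> real"
  assumes f: "continuous_on UNIV f"
    and glob: "\<And>q. f q \<le> f q0 + a * (fst q - fst q0) + p \<bullet> (snd q - snd q0) + C * (dist q q0)\<^sup>2"
    and C: "0 \<le> C" and d: "0 < \<delta>" and g: "0 < \<gamma>" and R: "0 < R"
  obtains b where "real_polynomial_function b"
    "\<And>q. f q \<le> f q0 + a * (fst q - fst q0) + p \<bullet> (snd q - snd q0) + b q * (dist q q0)\<^sup>2"
    "\<And>q. dist q q0 \<le> R \<Longrightarrow> b q \<le> C + \<gamma>"
    "\<And>q. \<delta> \<le> dist q q0 \<Longrightarrow> dist q q0 \<le> R \<Longrightarrow>
       f q0 + a * (fst q - fst q0) + p \<bullet> (snd q - snd q0) + b q * (dist q q0)\<^sup>2 \<le> f q + \<gamma> * (dist q q0)\<^sup>2"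
proof -
  define F where "F q = f q - f q0 - a * (fst q - fst q0) - p \<bullet> (snd q - snd q0)" for q
  define D where "D q = max (dist q q0) \<delta>" for q
  \<comment> \<open>A weight that is 1 off the \<delta>-ball and of third order at
    \<open>q0\<close>: the quotient of \<open>F\<close> by the squared distance, multiplied by
    \<open>s\<close>, becomes \<open>F q * (dist q q0 / (D q)^3)\<close>, which is continuous at
    \<open>q0\<close>. The remaining weight \<open>1 - s\<close> is put on the constant
    \<open>C\<close>.\<close>
  define s where "s q = (dist q q0 / D q)^3" for q
  define G where "G q = C * (1 - s q) + F q * (dist q q0 / (D q)^3)" for q
  have D0: "0 < D q" for q using d by (simp add: D_def)
  have s01: "0 \<le> s q" "s q \<le> 1" for q
    using D0[of q] by (auto simp: s_def D_def intro!: power_le_one divide_le_eq_1_pos[THEN iffD2])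
  have Fb: "F q \<le> C * (dist q q0)\<^sup>2" for q using glob[of q] by (simp add: F_def)
  have s3: "dist q q0 / (D q)^3 * (dist q q0)\<^sup>2 = s q" for q
    by (simp add: s_def power_divide power2_eq_square power3_eq_cube)
  have contG: "continuous_on UNIV G"
    unfolding G_def s_def F_def D_def using f d
    by (intro continuous_intros) (auto simp: max_def split: if_splits)
  have GC: "G q \<le> C" for q
  proof -
    have "F q * (dist q q0 / (D q)^3) \<le> C * (dist q q0)\<^sup>2 * (dist q q0 / (D q)^3)"
      using Fb D0[of q] by (intro mult_right_mono) auto
    also have "\<dots> = C * (dist q q0 / (D q)^3 * (dist q q0)\<^sup>2)" by (simp only: mult_ac)
    also have "\<dots> = C * s q" by (simp only: s3)
    finally show ?thesis by (simp add: G_def algebra_simps)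
  qed
  have GF: "F q \<le> G q * (dist q q0)\<^sup>2" for q
  proof -
    have "G q * (dist q q0)\<^sup>2 = C * (dist q q0)\<^sup>2 * (1 - s q) + F q * (dist q q0 / (D q)^3 * (dist q q0)\<^sup>2)"
      by (simp add: G_def algebra_simps)
    also have "\<dots> = C * (dist q q0)\<^sup>2 * (1 - s q) + F q * s q" by (simp only: s3)
    also have "\<dots> \<ge> F q * (1 - s q) + F q * s q"
      using Fb[of q] s01[of q] by (intro add_mono mult_right_mono) auto
    finally show ?thesis by (simp add: algebra_simps)
  qed
  have GE: "G q * (dist q q0)\<^sup>2 = F q" if "\<delta> \<le> dist q q0" for q
  proof -
    have "D q = dist q q0" "dist q q0 \<noteq> 0" using that d by (auto simp: D_def)
    then have "s q = 1" by (simp add: s_def)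
    have "G q * (dist q q0)\<^sup>2 = C * (dist q q0)\<^sup>2 * (1 - s q) + F q * (dist q q0 / (D q)^3 * (dist q q0)\<^sup>2)"
      by (simp add: G_def algebra_simps)
    also have "\<dots> = F q" unfolding s3 by (simp add: \<open>s q = 1\<close>)
    finally show ?thesis .
  qed
  obtain b where b: "real_polynomial_function b" "\<And>q. G q \<le> b q" "\<And>q. norm q \<le> R + norm q0 \<Longrightarrow> b q \<le> G q + \<gamma>"
    using polynomial_majorant[of G C "R + norm q0" \<gamma>] contG GC R g by (metis add_pos_nonneg norm_ge_zero)
  have near: "norm q \<le> R + norm q0" if "dist q q0 \<le> R" for q
    using that norm_triangle_sub[of q q0] by (simp add: dist_norm)
  show ?thesis
  proof (rule that[OF b(1)])
    fix q
    have "G q * (dist q q0)\<^sup>2 \<le> b q * (dist q q0)\<^sup>2" using b(2) by (intro mult_right_mono) auto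
    then show "f q \<le> f q0 + a * (fst q - fst q0) + p \<bullet> (snd q - snd q0) + b q * (dist q q0)\<^sup>2"
      using GF[of q] by (simp add: F_def)
  next
    fix q assume "dist q q0 \<le> R"
    from b(3)[OF near[OF this]] GC[of q] show "b q \<le> C + \<gamma>" by linarith
  next
    fix q assume q: "\<delta> \<le> dist q q0" "dist q q0 \<le> R"
    have "b q * (dist q q0)\<^sup>2 \<le> (G q + \<gamma>) * (dist q q0)\<^sup>2" using b(3)[OF near[OF q(2)]] by (intro mult_right_mono) auto
    also have "\<dots> = F q + \<gamma> * (dist q q0)\<^sup>2" using GE[OF q(1)] by (simp add: algebra_simps)
    finally show "f q0 + a * (fst q - fst q0) + p \<bullet> (snd q - snd q0) + b q * (dist q q0)\<^sup>2 \<le> f q + \<gamma> * (dist q q0)\<^sup>2"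
      by (simp add: F_def)
  qed
qed

lemma GDERIV_imp_grad: "GDERIV f x :> D \<Longrightarrow> grad f x = D"
  unfolding grad_def
proof (rule the_equality)
  fix D' assume "GDERIV f x :> D'" "GDERIV f x :> D"
  then have "(\<lambda>h. h \<bullet> D') = (\<lambda>h. h \<bullet> D)" unfolding gderiv_def by (rule has_derivative_unique)
  then show "D' = D" by (metis inner_commute vector_eq_ldot)
qed

lemma quadratic_polynomial_derivatives:
  fixes b :: "real \<times> 'a::euclidean_space \<Rightarrow> real" and c a t :: real and p x :: 'a
  assumes b: "real_polynomial_function b"
    and \<phi>_def: "\<phi> = (\<lambda>q. c + a * (fst q - t) + p \<bullet> (snd q - x) + b q * (dist q (t, x))\<^sup>2)"
  shows "smooth \<phi>" "grad (\<lambda>y. \<phi> (t, y)) x = p" "deriv (\<lambda>s. \<phi> (s, x)) t = a"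
proof -
  have eq: "\<phi> = (\<lambda>q. c + (a * fst q - a * t) + (p \<bullet> snd q - p \<bullet> x) + b q * (norm (q - (t, x)))\<^sup>2)"
    by (simp add: \<phi>_def dist_norm inner_diff_right right_diff_distrib)
  have "bounded_linear (\<lambda>q :: real \<times> 'a. a * fst q)" "bounded_linear (\<lambda>q :: real \<times> 'a. p \<bullet> snd q)"
    by (intro bounded_linear_intros)+
  then have "real_polynomial_function \<phi>"
    unfolding eq
    by (intro real_polynomial_function.intros(3,4) real_polynomial_function.intros(1,2)
        real_polynomial_function_diff real_polynomial_function_power2_norm b)
  then show "smooth \<phi>" by (rule real_polynomial_function_smooth)
  obtain b' where b': "\<And>q. (b has_derivative b' q) (at q)"
    using real_polynomial_function_has_derivative[OF b] by blast
  have b1: "((\<lambda>y. b (t, y)) has_derivative (\<lambda>v. b' (t, x) (0, v))) (at x)"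
    by (rule has_derivative_compose[where f = "\<lambda>y. (t, y)"]) (auto intro!: derivative_eq_intros b')
  have b2: "((\<lambda>s. b (s, x)) has_derivative (\<lambda>v. b' (t, x) (v, 0))) (at t)"
    by (rule has_derivative_compose[where f = "\<lambda>s. (s, x)"]) (auto intro!: derivative_eq_intros b')
  have e1: "\<phi> (t, y) = c + p \<bullet> (y - x) + b (t, y) * ((y - x) \<bullet> (y - x))" for y
    by (simp add: \<phi>_def dist_Pair_Pair dist_norm power2_norm_eq_inner)
  have e2: "\<phi> (s, x) = c + a * (s - t) + b (s, x) * ((s - t) * (s - t))" for s
    by (simp add: \<phi>_def dist_Pair_Pair dist_real_def power2_eq_square)
  have "((\<lambda>y. \<phi> (t, y)) has_derivative (\<lambda>v. v \<bullet> p)) (at x)"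
    unfolding e1 by (auto intro!: derivative_eq_intros b1 simp: inner_commute)
  then show "grad (\<lambda>y. \<phi> (t, y)) x = p" by (intro GDERIV_imp_grad) (simp add: gderiv_def)
  have "((\<lambda>s. \<phi> (s, x)) has_derivative (\<lambda>v. a * v)) (at t)"
    unfolding e2 by (auto intro!: derivative_eq_intros b2)
  then show "deriv (\<lambda>s. \<phi> (s, x)) t = a" by (intro DERIV_imp_deriv) (simp add: has_field_derivative_def)
qed

section \<open>Viscosity and geometric subsolutions\<close>

lemma measurable_level_sets:
  assumes "continuous_on UNIV (g :: 'a::euclidean_space \<Rightarrow> real)"
  shows "{z. c \<le> g z} \<in> sets borel" "{z. g z < c} \<in> sets borel"
proof -
  have [measurable]: "g \<in> borel_measurable borel" using assms by (rule borel_measurable_continuous_onI)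
  show "{z. c \<le> g z} \<in> sets borel" "{z. g z < c} \<in> sets borel" by measurable
qed

context singular_measure
begin

text \<open>The curvature of \<phi> can exceed that of the superlevel set of \<open>g\<close> in
  three places only: in a paraboloid inside radius \<open>\<delta>'\<close>, where \<open>g\<close>
  is slightly below its level, and off \<open>ball 0 R\<close>. The scales are fixed before \<phi>
  is quantified because \<phi> will be constructed from them. The bound with \<open>B\<close> keeps
  the subtracted set of finite measure, so \<open>B\<close> may depend on \<phi>.\<close>

lemma kappa_of_majorant_le:
  fixes g :: "'a \<Rightarrow> real"
  assumes g: "continuous_on UNIV g" and p: "p \<noteq> 0" and \<delta>: "0 < \<delta>" "\<delta> \<le> 1" and C: "0 \<le> C"
    and gb: "\<And>z. g z \<le> g 0 + p \<bullet> z + C * (norm z)\<^sup>2" and \<epsilon>: "0 < \<epsilon>"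
  obtains \<delta>' \<gamma> R where "0 < \<delta>'" "0 < \<gamma>" "\<gamma> \<le> 1" "1 \<le> R"
    "\<forall>\<phi> B. continuous_on UNIV \<phi> \<and> \<phi> 0 = g 0 \<and>
       (\<forall>z. norm z \<le> R \<longrightarrow> \<phi> z \<le> g 0 + p \<bullet> z + (C + \<gamma>) * (norm z)\<^sup>2) \<and>
       (\<forall>z. \<delta>' \<le> norm z \<and> norm z \<le> R \<longrightarrow> \<phi> z \<le> g z + \<gamma> * (norm z)\<^sup>2) \<and>
       (\<forall>z. norm z \<le> 1 \<longrightarrow> g 0 + p \<bullet> z - B * (norm z)\<^sup>2 \<le> \<phi> z) \<longrightarrow>
       measure \<nu> {z. \<phi> 0 \<le> \<phi> z \<and> p \<bullet> z \<le> 0} - measure \<nu> {z. \<phi> z < \<phi> 0 \<and> 0 < p \<bullet> z}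
       \<le> level_curvature \<nu> \<delta> p {z. g 0 \<le> g z} + \<epsilon>"
proof -
  have gm[measurable]: "g \<in> borel_measurable borel" using g by (rule borel_measurable_continuous_onI)
  define C1 where "C1 = max (C + 1) (norm p + 1)"
  have C1: "0 < C1" "norm p < C1" "C + 1 \<le> C1" using C by (auto simp: C1_def)
  have "0 < \<epsilon> * norm p / (3 * C1)" using \<epsilon> p C1 by simp
  from measure_paraboloid_small[OF this] obtain d where d: "0 < d" "d \<le> 1"
    "\<And>\<delta>' q C. 0 < \<delta>' \<Longrightarrow> \<delta>' \<le> d \<Longrightarrow> norm q < C \<Longrightarrow> norm q * measure \<nu> (paraboloid \<delta>' q C) \<le> C * (\<epsilon> * norm p / (3 * C1))"
    by blast
  define \<delta>' where "\<delta>' = min d (\<delta>/2)"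
  have \<delta>': "0 < \<delta>'" "\<delta>' \<le> d" "\<delta>' < \<delta>" "\<delta>' \<le> 1" using d \<delta> by (auto simp: \<delta>'_def)
  have "norm p * measure \<nu> (paraboloid \<delta>' p C1) \<le> C1 * (\<epsilon> * norm p / (3 * C1))"
    using d(3) \<delta>' C1 by blast
  then have P1: "measure \<nu> (paraboloid \<delta>' p C1) \<le> \<epsilon>/3"
    using C1 p by (simp add: field_simps)
  obtain R where R: "1 \<le> R" "measure \<nu> (- ball 0 R) \<le> \<epsilon>/3" using tail_small[of "\<epsilon>/3"] \<epsilon> by auto
  \<comment> \<open>As \<open>s\<close> decreases to 0 these sets shrink to \<open>Y 0\<close>,
    which is covered by the two sets counted positively in \<open>level_curvature\<close>. Finite
    mass off \<open>ball 0 \<delta>'\<close> makes the measures converge.\<close>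
  define Y where "Y s = {z. \<delta>' \<le> norm z \<and> g 0 - s \<le> g z \<and> (p \<bullet> z \<le> 0 \<or> \<delta> \<le> norm z)}" for s
  have Ym[measurable]: "Y s \<in> sets borel" for s unfolding Y_def by measurable
  have Yf: "Y s \<in> fmeasurable \<nu>" for s by (rule fmeasurable_outside[OF \<delta>'(1) Ym]) (auto simp: Y_def)
  have "(\<lambda>n. measure \<nu> (Y (1 / real (Suc n)))) \<longlonglongrightarrow> measure \<nu> (\<Inter>n. Y (1 / real (Suc n)))"
  proof (rule Lim_measure_decseq)
    show "decseq (\<lambda>n. Y (1 / real (Suc n)))"
    proof (rule decseq_SucI)
      fix n have "1 / real (Suc (Suc n)) \<le> 1 / real (Suc n)" by (intro divide_left_mono) auto
      then show "Y (1 / real (Suc (Suc n))) \<subseteq> Y (1 / real (Suc n))" unfolding Y_def by auto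
    qed
  qed (use fmeasurableD2[OF Yf] in auto)
  moreover have "(\<Inter>n. Y (1 / real (Suc n))) = Y 0"
  proof (intro equalityI subsetI)
    fix z assume z: "z \<in> (\<Inter>n. Y (1 / real (Suc n)))"
    have "(\<lambda>n. g 0 - 1 / real (Suc n)) \<longlonglongrightarrow> g 0 - 0" by (intro tendsto_intros LIMSEQ_Suc[OF lim_1_over_n])
    then have "g 0 - 0 \<le> g z" by (rule LIMSEQ_le_const2) (use z in \<open>auto simp: Y_def\<close>)
    then show "z \<in> Y 0" using z by (auto simp: Y_def)
  next
    fix z assume z: "z \<in> Y 0"
    have "g 0 - 1 / real (Suc n) \<le> g z" for n
    proof -
      have "0 < 1 / real (Suc n)" by simp
      moreover have "g 0 \<le> g z" using z by (simp add: Y_def)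
      ultimately show ?thesis by linarith
    qed
    then show "z \<in> (\<Inter>n. Y (1 / real (Suc n)))" using z by (auto simp: Y_def)
  qed
  ultimately have "(\<lambda>n. measure \<nu> (Y (1 / real (Suc n)))) \<longlonglongrightarrow> measure \<nu> (Y 0)" by simp
  then obtain n where "norm (measure \<nu> (Y (1 / real (Suc n))) - measure \<nu> (Y 0)) < \<epsilon>/3"
    using LIMSEQ_D[of _ _ "\<epsilon>/3"] \<epsilon> by (metis order_refl zero_less_divide_iff zero_less_numeral)
  then have "measure \<nu> (Y (1 / real (Suc n))) \<le> measure \<nu> (Y 0) + \<epsilon>/3" unfolding real_norm_def by linarith
  then obtain s where s: "0 < s" "measure \<nu> (Y s) \<le> measure \<nu> (Y 0) + \<epsilon>/3"
    by (rule that[of "1 / real (Suc n)", rotated]) simp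
  define \<gamma> where "\<gamma> = min 1 (s / R\<^sup>2)"
  have \<gamma>: "0 < \<gamma>" "\<gamma> \<le> 1" "\<gamma> * R\<^sup>2 \<le> s" using s R by (auto simp: \<gamma>_def min_def field_simps)
  define I where "I = {z \<in> {z. g 0 \<le> g z}. norm z < \<delta> \<and> p \<bullet> z \<le> 0}"
  have [measurable]: "I \<in> sets borel" unfolding I_def by measurable
  have If: "I \<in> fmeasurable \<nu>"
  proof (rule fmeasurableI2[OF fmeasurable_paraboloid[OF p \<delta>(2), of C]])
    show "I \<subseteq> paraboloid \<delta> p C"
    proof
      fix z assume "z \<in> I"
      then show "z \<in> paraboloid \<delta> p C" using gb[of z] unfolding I_def paraboloid_def by simp
    qed
  qed simp
  have Af: "{z. g 0 \<le> g z} - ball 0 \<delta> \<in> fmeasurable \<nu>" by (rule fmeasurable_outside[OF \<delta>(1)]) auto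
  have "measure \<nu> (Y 0) \<le> measure \<nu> (I \<union> ({z. g 0 \<le> g z} - ball 0 \<delta>))"
    using If Af by (intro measure_mono_fmeasurable) (auto simp: Y_def I_def)
  also have "\<dots> \<le> measure \<nu> I + measure \<nu> ({z. g 0 \<le> g z} - ball 0 \<delta>)"
    using If Af by (intro measure_Un_le) auto
  finally have Y0: "measure \<nu> (Y 0) \<le> measure \<nu> I + measure \<nu> ({z. g 0 \<le> g z} - ball 0 \<delta>)" .
  show ?thesis
  proof (rule that[OF \<delta>'(1) \<gamma>(1,2) R(1)], intro allI impI, elim conjE)
    fix \<phi> B assume \<phi>: "continuous_on UNIV \<phi>" "\<phi> 0 = g 0"
      and up: "\<forall>z. norm z \<le> R \<longrightarrow> \<phi> z \<le> g 0 + p \<bullet> z + (C + \<gamma>) * (norm z)\<^sup>2"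
      and out: "\<forall>z. \<delta>' \<le> norm z \<and> norm z \<le> R \<longrightarrow> \<phi> z \<le> g z + \<gamma> * (norm z)\<^sup>2"
      and lo: "\<forall>z. norm z \<le> 1 \<longrightarrow> g 0 + p \<bullet> z - B * (norm z)\<^sup>2 \<le> \<phi> z"
    have [measurable]: "\<phi> \<in> borel_measurable borel" using \<phi>(1) by (rule borel_measurable_continuous_onI)
    define X1 where "X1 = {z. \<phi> 0 \<le> \<phi> z \<and> p \<bullet> z \<le> 0}"
    define X2 where "X2 = {z. \<phi> z < \<phi> 0 \<and> 0 < p \<bullet> z}"
    define Z where "Z = {z \<in> - ball 0 \<delta>. 0 < p \<bullet> z}"
    \<comment> \<open>\<open>Z\<close> is contained in \<open>X2 \<union> Z'\<close>, so the
      curvature of \<phi> is at most the measure of \<open>X1 \<union> Z'\<close> minus that of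
      \<open>Z\<close>, and only a superset \<open>W\<close> of \<open>X1 \<union> Z'\<close> has to
      be estimated.\<close>
    define Z' where "Z' = {z \<in> Z. \<phi> 0 \<le> \<phi> z}"
    have [measurable]: "X1 \<in> sets borel" "X2 \<in> sets borel" "Z \<in> sets borel" "Z' \<in> sets borel"
      unfolding X1_def X2_def Z_def Z'_def by measurable
    define W where "W = paraboloid \<delta>' p C1 \<union> Y s \<union> - ball 0 R"
    have tf: "- ball (0::'a) R \<in> fmeasurable \<nu>" using R(1) by (intro fmeasurable_outside[of R]) auto
    have Wf: "W \<in> fmeasurable \<nu>" unfolding W_def by (intro fmeasurable.Un fmeasurable_paraboloid p \<delta>'(4) Yf tf)
    have sub: "X1 \<union> Z' \<subseteq> W"
    proof
      fix z assume z: "z \<in> X1 \<union> Z'"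
      have \<phi>z: "g 0 \<le> \<phi> z" using z \<phi>(2) by (auto simp: X1_def Z'_def)
      consider "norm z < \<delta>'" | "\<delta>' \<le> norm z" "norm z \<le> R" | "R < norm z" by linarith
      then show "z \<in> W"
      proof cases
        case 1
        then have pz: "p \<bullet> z \<le> 0" using z \<delta>'(3) by (auto simp: X1_def Z'_def Z_def)
        have "\<phi> z \<le> g 0 + p \<bullet> z + (C + \<gamma>) * (norm z)\<^sup>2" using up[rule_format, of z] 1 \<delta>'(4) R(1) by linarith
        moreover have "(C + \<gamma>) * (norm z)\<^sup>2 \<le> C1 * (norm z)\<^sup>2" using C1 \<gamma> by (intro mult_right_mono) auto
        ultimately show ?thesis using \<phi>z pz 1 by (simp add: W_def paraboloid_def)
      next
        case 2
        have "\<gamma> * (norm z)\<^sup>2 \<le> \<gamma> * R\<^sup>2" using 2 \<gamma> by (intro mult_left_mono power_mono) auto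
        then have "g 0 - s \<le> g z" using out[rule_format, OF conjI, OF 2] \<phi>z \<gamma>(3) by linarith
        moreover have "p \<bullet> z \<le> 0 \<or> \<delta> \<le> norm z" using z by (auto simp: X1_def Z'_def Z_def)
        ultimately have "z \<in> Y s" using 2(1) by (simp add: Y_def)
        then show ?thesis by (simp add: W_def)
      qed (simp add: W_def)
    qed
    have X2f: "X2 \<in> fmeasurable \<nu>"
    proof (rule fmeasurableI2)
      show "paraboloid 1 p B \<union> - ball 0 1 \<in> fmeasurable \<nu>"
        by (intro fmeasurable.Un fmeasurable_paraboloid p fmeasurable_outside[of 1]) auto
      show "X2 \<subseteq> paraboloid 1 p B \<union> - ball 0 1"
      proof
        fix z assume "z \<in> X2"
        then show "z \<in> paraboloid 1 p B \<union> - ball 0 1"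
          using lo[rule_format, of z] \<phi>(2) by (cases "norm z < 1") (auto simp: X2_def paraboloid_def)
      qed
    qed simp
    have Zf: "Z \<in> fmeasurable \<nu>" by (rule fmeasurable_outside[OF \<delta>(1)]) (auto simp: Z_def)
    have X1f: "X1 \<in> fmeasurable \<nu>" "Z' \<in> fmeasurable \<nu>"
      using sub by (auto intro: fmeasurableI2[OF Wf])
    have "measure \<nu> Z \<le> measure \<nu> (X2 \<union> Z')"
      using X2f X1f by (intro measure_mono_fmeasurable) (auto simp: Z'_def X2_def Z_def)
    also have "\<dots> \<le> measure \<nu> X2 + measure \<nu> Z'" using X2f X1f by (intro measure_Un_le) auto
    finally have 1: "measure \<nu> Z \<le> measure \<nu> X2 + measure \<nu> Z'" .
    have "X1 \<inter> Z' = {}" by (auto simp: X1_def Z'_def Z_def)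
    then have "measure \<nu> X1 + measure \<nu> Z' = measure \<nu> (X1 \<union> Z')"
      using X1f by (simp add: measure_Un3)
    also have "\<dots> \<le> measure \<nu> W" using sub Wf by (intro measure_mono_fmeasurable) auto
    also have "\<dots> \<le> measure \<nu> (paraboloid \<delta>' p C1 \<union> Y s) + measure \<nu> (- ball 0 R)"
      unfolding W_def by (intro measure_Un_le) auto
    also have "measure \<nu> (paraboloid \<delta>' p C1 \<union> Y s) \<le> measure \<nu> (paraboloid \<delta>' p C1) + measure \<nu> (Y s)"
      by (intro measure_Un_le) auto
    finally have "measure \<nu> X1 + measure \<nu> Z' \<le> measure \<nu> (Y 0) + \<epsilon>" using P1 R(2) s(2) by linarith
    then have "measure \<nu> X1 - measure \<nu> X2 \<le> measure \<nu> I + measure \<nu> ({z. g 0 \<le> g z} - ball 0 \<delta>) - measure \<nu> Z + \<epsilon>"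
      using 1 Y0 by linarith
    then show "measure \<nu> {z. \<phi> 0 \<le> \<phi> z \<and> p \<bullet> z \<le> 0} - measure \<nu> {z. \<phi> z < \<phi> 0 \<and> 0 < p \<bullet> z}
       \<le> level_curvature \<nu> \<delta> p {z. g 0 \<le> g z} + \<epsilon>"
      unfolding level_curvature_def X1_def X2_def Z_def I_def by simp
  qed
qed

text \<open>The local quadratic above \<open>f\<close> becomes a global one and then a polynomial
  test function, whose curvature exceeds that of the superlevel set of \<open>f\<close> by at most
  \<epsilon>. When \<open>p = 0\<close>, the viscosity inequality says \<open>a \<le> 0\<close>,
  which is the claim because the factor \<open>norm p\<close> vanishes.\<close>

lemma viscosity_subsolution_imp_geo_sub:
  fixes f :: "real \<times> 'a \<Rightarrow> real"
  assumes f: "continuous_on spacetime f" and M: "\<And>q. q \<in> spacetime \<Longrightarrow> \<bar>f q\<bar> \<le> M"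
    and \<mu>: "\<And>e. norm e = 1 \<Longrightarrow> 0 < \<mu> e"
    and sub: "viscosity_subsolution \<mu> c \<nu> f"
  shows "geo_sub (\<lambda>p. \<mu> (sgn p) * norm p) c \<nu> f"
  unfolding geo_sub_def
proof (intro allI impI, elim conjE)
  fix t a C \<rho> \<delta> :: real and x p :: 'a
  assume t: "0 < t" and \<rho>: "0 < \<rho>" and \<delta>: "0 < \<delta>" "\<delta> \<le> 1"
    and touch: "\<forall>q\<in>spacetime. dist q (t, x) < \<rho> \<longrightarrow>
           f q \<le> f (t, x) + a * (fst q - t) + p \<bullet> (snd q - x) + C * (dist q (t, x))\<^sup>2"
  \<comment> \<open>Constant extension to negative times: the polynomial majorant asks for
    continuity on the whole space, whereas test functions are compared with \<open>f\<close> on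
    \<open>spacetime\<close> only.\<close>
  define F where "F q = f (max (fst q) 0, snd q)" for q
  have FS: "F q = f q" if "q \<in> spacetime" for q using that by (cases q) (auto simp: F_def)
  have Fx: "F (t, x) = f (t, x)" using t by (simp add: F_def)
  have contF: "continuous_on UNIV F"
    unfolding F_def by (rule continuous_on_compose2[OF f]) (auto intro!: continuous_intros)
  have MF: "\<bar>F q\<bar> \<le> M" for q unfolding F_def by (rule M) auto
  obtain C' where C': "0 \<le> C'" "\<And>q. F q \<le> F (t, x) + a * (fst q - t) + p \<bullet> (snd q - x) + C' * (dist q (t, x))\<^sup>2"
  proof (rule quadratic_bound_global[of "min \<rho> t" "(t, x)" F "F (t, x)" a p C "2 * M"])
    show "0 < min \<rho> t" using \<rho> t by simp
    fix q assume q: "dist q (t, x) < min \<rho> t"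
    have "\<bar>fst q - t\<bar> < t" using dist_fst_le[of q "(t, x)"] q by (simp add: dist_real_def)
    then have "q \<in> spacetime" by (cases q) auto
    then show "F q \<le> F (t, x) + a * (fst q - fst (t, x)) + p \<bullet> (snd q - snd (t, x)) + C * (dist q (t, x))\<^sup>2"
      using touch q Fx FS by auto
  next
    show "F q \<le> F (t, x) + 2 * M" for q using MF[of q] MF[of "(t, x)"] by linarith
  next
    fix C' assume "0 \<le> C'"
      "\<And>q. F q \<le> F (t, x) + a * (fst q - fst (t, x)) + p \<bullet> (snd q - snd (t, x)) + C' * (dist q (t, x))\<^sup>2"
    then show thesis by (intro that[of C']) simp_all
  qed
  have glob: "F q \<le> F (t, x) + a * (fst q - fst (t, x)) + p \<bullet> (snd q - snd (t, x)) + C' * (dist q (t, x))\<^sup>2" for q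
    using C'(2) by simp
  have visc: "a \<le> \<mu> (sgn p) * (c x + kappa_upper \<nu> x (\<lambda>y. \<phi> (t, y))) * norm p \<or> p = 0 \<and> a \<le> 0"
    if b: "real_polynomial_function b" and \<phi>: "\<phi> = (\<lambda>q. F (t, x) + a * (fst q - t) + p \<bullet> (snd q - x) + b q * (dist q (t, x))\<^sup>2)"
      and maj: "\<And>q. F q \<le> \<phi> q" for b \<phi>
  proof -
    note q = quadratic_polynomial_derivatives[OF b \<phi>]
    have "f q - \<phi> q \<le> 0" if "q \<in> spacetime" for q using maj[of q] FS[OF that] by simp
    moreover have "f (t, x) - \<phi> (t, x) = 0" by (simp add: \<phi> Fx)
    ultimately show ?thesis
      using sub[unfolded viscosity_subsolution_def Let_def, THEN conjunct2, rule_format, of \<phi> t x] q t by auto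
  qed
  show "a \<le> \<mu> (sgn p) * norm p * (c x + level_curvature \<nu> \<delta> p {z. f (t, x) \<le> f (t, x + z)})"
  proof (cases "p = 0")
    case True
    obtain b where "real_polynomial_function b"
      "\<And>q. F q \<le> F (t, x) + a * (fst q - fst (t, x)) + p \<bullet> (snd q - snd (t, x)) + b q * (dist q (t, x))\<^sup>2"
      by (rule polynomial_test_function[OF contF glob C'(1) zero_less_one zero_less_one zero_less_one]) (rule that; assumption)
    then show ?thesis using visc[of b "\<lambda>q. F (t, x) + a * (fst q - t) + p \<bullet> (snd q - x) + b q * (dist q (t, x))\<^sup>2"] True
      by auto
  next
    case False
    define h where "h = \<mu> (sgn p) * norm p"
    have h: "0 < h" using \<mu>[of "sgn p"] False by (simp add: h_def norm_sgn)
    define g where "g z = F (t, x + z)" for z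
    have dz: "dist (t, x + z) (t, x) = norm z" for z by (simp add: dist_Pair_Pair dist_norm)
    have contg: "continuous_on UNIV g" unfolding g_def
      by (rule continuous_on_compose2[OF contF]) (auto intro!: continuous_intros)
    have gb: "\<And>z. g z \<le> g 0 + p \<bullet> z + C' * (norm z)\<^sup>2" subgoal for z using C'(2)[of "(t, x + z)"] by (simp add: g_def dz) done
    have key: "a \<le> h * (c x + (level_curvature \<nu> \<delta> p {z. g 0 \<le> g z} + \<epsilon>))" if \<epsilon>: "0 < \<epsilon>" for \<epsilon>
    proof -
      obtain \<delta>' \<gamma> R where k: "0 < \<delta>'" "0 < \<gamma>" "\<gamma> \<le> 1" "1 \<le> R"
        and K: "\<forall>\<phi> B. continuous_on UNIV \<phi> \<and> \<phi> 0 = g 0 \<and>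
           (\<forall>z. norm z \<le> R \<longrightarrow> \<phi> z \<le> g 0 + p \<bullet> z + (C' + \<gamma>) * (norm z)\<^sup>2) \<and>
           (\<forall>z. \<delta>' \<le> norm z \<and> norm z \<le> R \<longrightarrow> \<phi> z \<le> g z + \<gamma> * (norm z)\<^sup>2) \<and>
           (\<forall>z. norm z \<le> 1 \<longrightarrow> g 0 + p \<bullet> z - B * (norm z)\<^sup>2 \<le> \<phi> z) \<longrightarrow>
           measure \<nu> {z. \<phi> 0 \<le> \<phi> z \<and> p \<bullet> z \<le> 0} - measure \<nu> {z. \<phi> z < \<phi> 0 \<and> 0 < p \<bullet> z}
           \<le> level_curvature \<nu> \<delta> p {z. g 0 \<le> g z} + \<epsilon>"
        by (rule kappa_of_majorant_le[OF contg False \<delta> C'(1) gb \<epsilon>]) (rule that; assumption)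
      have R0: "0 < R" using k by simp
      obtain b where b: "real_polynomial_function b"
        "\<And>q. F q \<le> F (t, x) + a * (fst q - fst (t, x)) + p \<bullet> (snd q - snd (t, x)) + b q * (dist q (t, x))\<^sup>2"
        "\<And>q. dist q (t, x) \<le> R \<Longrightarrow> b q \<le> C' + \<gamma>"
        "\<And>q. \<delta>' \<le> dist q (t, x) \<Longrightarrow> dist q (t, x) \<le> R \<Longrightarrow>
           F (t, x) + a * (fst q - fst (t, x)) + p \<bullet> (snd q - snd (t, x)) + b q * (dist q (t, x))\<^sup>2 \<le> F q + \<gamma> * (dist q (t, x))\<^sup>2"
        by (rule polynomial_test_function[OF contF glob C'(1) k(1,2) R0]) (rule that; assumption)
      define \<phi> where "\<phi> = (\<lambda>q. F (t, x) + a * (fst q - t) + p \<bullet> (snd q - x) + b q * (dist q (t, x))\<^sup>2)"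
      have contb: "continuous_on UNIV b"
        using b(1) continuous_on_polymonial_function by (simp add: real_polynomial_function_eq)
      have v: "a \<le> h * (c x + kappa_upper \<nu> x (\<lambda>y. \<phi> (t, y)))"
        using visc[OF b(1) \<phi>_def] b(2) False by (simp add: \<phi>_def h_def mult_ac)
      have pz: "\<phi> (t, x + z) = g 0 + p \<bullet> z + b (t, x + z) * (norm z)\<^sup>2" for z by (simp add: \<phi>_def dz g_def)
      have "continuous_on (cball 0 1) (\<lambda>z. b (t, x + z))"
        by (rule continuous_on_compose2[OF contb]) (auto intro!: continuous_intros)
      then have "compact ((\<lambda>z. b (t, x + z)) ` cball 0 1)" by (intro compact_continuous_image) auto
      then have "bounded ((\<lambda>z. b (t, x + z)) ` cball 0 1)" by (rule compact_imp_bounded)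
      then obtain B where B0: "\<forall>y\<in>(\<lambda>z. b (t, x + z)) ` cball 0 1. norm y \<le> B" unfolding bounded_iff by blast
      have B: "\<bar>b (t, x + z)\<bar> \<le> B" if "norm z \<le> 1" for z
      proof -
        have "b (t, x + z) \<in> (\<lambda>z. b (t, x + z)) ` cball 0 1" using that by (intro imageI) simp
        then show ?thesis using B0 by (metis real_norm_def)
      qed
      have "measure \<nu> {z. \<phi> (t, x + 0) \<le> \<phi> (t, x + z) \<and> p \<bullet> z \<le> 0} - measure \<nu> {z. \<phi> (t, x + z) < \<phi> (t, x + 0) \<and> 0 < p \<bullet> z}
           \<le> level_curvature \<nu> \<delta> p {z. g 0 \<le> g z} + \<epsilon>"
      proof (rule K[rule_format, of "\<lambda>z. \<phi> (t, x + z)" B], intro conjI allI impI)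
        show "continuous_on UNIV (\<lambda>z. \<phi> (t, x + z))"
          unfolding pz by (intro continuous_intros continuous_on_compose2[OF contb]) auto
        show "\<phi> (t, x + 0) = g 0" using pz[of 0] by simp
        show "\<phi> (t, x + z) \<le> g 0 + p \<bullet> z + (C' + \<gamma>) * (norm z)\<^sup>2" if "norm z \<le> R" for z
          using b(3)[of "(t, x + z)"] that unfolding pz dz by (simp add: mult_right_mono)
        show "\<phi> (t, x + z) \<le> g z + \<gamma> * (norm z)\<^sup>2" if "\<delta>' \<le> norm z \<and> norm z \<le> R" for z
          using b(4)[of "(t, x + z)"] that unfolding pz dz by (simp add: g_def)
        show "g 0 + p \<bullet> z - B * (norm z)\<^sup>2 \<le> \<phi> (t, x + z)" if "norm z \<le> 1" for z
        proof -
          have "- B * (norm z)\<^sup>2 \<le> b (t, x + z) * (norm z)\<^sup>2" using B[OF that] by (intro mult_right_mono) auto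
          then show ?thesis by (simp add: pz)
        qed
      qed
      moreover have "grad (\<lambda>y. \<phi> (t, y)) x = p"
        by (rule quadratic_polynomial_derivatives(2)[OF b(1) \<phi>_def])
      ultimately have "kappa_upper \<nu> x (\<lambda>y. \<phi> (t, y)) \<le> level_curvature \<nu> \<delta> p {z. g 0 \<le> g z} + \<epsilon>"
        by (simp add: kappa_upper_def)
      then have "h * (c x + kappa_upper \<nu> x (\<lambda>y. \<phi> (t, y))) \<le> h * (c x + (level_curvature \<nu> \<delta> p {z. g 0 \<le> g z} + \<epsilon>))"
        using h by (intro mult_left_mono) auto
      then show ?thesis using v by linarith
    qed
    have "a \<le> h * (c x + level_curvature \<nu> \<delta> p {z. g 0 \<le> g z})"
    proof (rule field_le_epsilon)
      fix e :: real assume e: "0 < e"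
      then have "0 < e / h" using h by simp
      from key[OF this] show "a \<le> h * (c x + level_curvature \<nu> \<delta> p {z. g 0 \<le> g z}) + e"
        using h by (simp add: algebra_simps)
    qed
    moreover have "{z. g 0 \<le> g z} = {z. f (t, x) \<le> f (t, x + z)}" using t by (simp add: g_def F_def)
    ultimately show ?thesis by (simp add: h_def)
  qed
qed

end

section \<open>Continuous solutions and the reflection of \<open>u\<close> to
  \<open>- u\<close>\<close>

lemma usc_envelope_continuous:
  assumes u: "continuous_on S u" and p: "p \<in> S"
  shows "usc_envelope S u p = u p"
proof -
  have "(INF r\<in>{0<..}. SUP q\<in>ball p r \<inter> S. ereal (u q)) = ereal (u p)"
  proof (rule antisym)
    show "(INF r\<in>{0<..}. SUP q\<in>ball p r \<inter> S. ereal (u q)) \<le> ereal (u p)"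
    proof (rule ereal_le_epsilon2)
      fix e :: real assume e: "0 < e"
      obtain d where d: "0 < d" "\<And>q. q \<in> S \<Longrightarrow> dist q p < d \<Longrightarrow> dist (u q) (u p) < e"
        using u p e unfolding continuous_on_iff by metis
      have "(SUP q\<in>ball p d \<inter> S. ereal (u q)) \<le> ereal (u p) + ereal e"
      proof (rule SUP_least)
        fix q assume "q \<in> ball p d \<inter> S"
        then have "dist (u q) (u p) < e" using d(2)[of q] by (simp add: dist_commute)
        then show "ereal (u q) \<le> ereal (u p) + ereal e" by (simp add: dist_real_def)
      qed
      then show "(INF r\<in>{0<..}. SUP q\<in>ball p r \<inter> S. ereal (u q)) \<le> ereal (u p) + ereal e"
        using d(1) by (intro INF_lower2[of d]) auto
    qed
    show "ereal (u p) \<le> (INF r\<in>{0<..}. SUP q\<in>ball p r \<inter> S. ereal (u q))"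
      by (intro INF_greatest SUP_upper) (use p in auto)
  qed
  then show ?thesis by (simp add: usc_envelope_def)
qed

lemma lsc_envelope_continuous:
  assumes u: "continuous_on S u" and p: "p \<in> S"
  shows "lsc_envelope S u p = u p"
proof -
  have "(SUP r\<in>{0<..}. INF q\<in>ball p r \<inter> S. ereal (u q)) = ereal (u p)"
  proof (rule antisym)
    show "ereal (u p) \<le> (SUP r\<in>{0<..}. INF q\<in>ball p r \<inter> S. ereal (u q))"
    proof (rule ereal_le_epsilon2)
      fix e :: real assume e: "0 < e"
      obtain d where d: "0 < d" "\<And>q. q \<in> S \<Longrightarrow> dist q p < d \<Longrightarrow> dist (u q) (u p) < e"
        using u p e unfolding continuous_on_iff by metis
      have "ereal (u p - e) \<le> (INF q\<in>ball p d \<inter> S. ereal (u q))"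
      proof (rule INF_greatest)
        fix q assume "q \<in> ball p d \<inter> S"
        then have "dist (u q) (u p) < e" using d(2)[of q] by (simp add: dist_commute)
        then show "ereal (u p - e) \<le> ereal (u q)" by (simp add: dist_real_def)
      qed
      also have "\<dots> \<le> (SUP r\<in>{0<..}. INF q\<in>ball p r \<inter> S. ereal (u q))"
        using d(1) by (intro SUP_upper) auto
      finally have "ereal (u p - e) + ereal e \<le> (SUP r\<in>{0<..}. INF q\<in>ball p r \<inter> S. ereal (u q)) + ereal e"
        by (rule add_right_mono)
      then show "ereal (u p) \<le> (SUP r\<in>{0<..}. INF q\<in>ball p r \<inter> S. ereal (u q)) + ereal e" by simp
    qed
    show "(SUP r\<in>{0<..}. INF q\<in>ball p r \<inter> S. ereal (u q)) \<le> ereal (u p)"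
      by (intro SUP_least INF_lower) (use p in auto)
  qed
  then show ?thesis by (simp add: lsc_envelope_def)
qed

text \<open>The envelope of a continuous function agrees with it on \<open>spacetime\<close>; at
  negative times it has a default value.\<close>

lemma viscosity_subsolution_cong:
  assumes eq: "\<And>q. q \<in> spacetime \<Longrightarrow> f q = g q" and f: "viscosity_subsolution \<mu> c \<nu> f"
  shows "viscosity_subsolution \<mu> c \<nu> g"
proof -
  have "{p \<in> spacetime. f p < a} = {p \<in> spacetime. g p < a}" for a using eq by auto
  then have "usc_on spacetime g" using f by (simp add: viscosity_subsolution_def usc_on_def)
  moreover have "f (t, x) = g (t, x)" if "0 < t" for t x using eq[of "(t, x)"] that by auto
  moreover have "(\<forall>q\<in>spacetime. f q - \<phi> q \<le> 0) \<longleftrightarrow> (\<forall>q\<in>spacetime. g q - \<phi> q \<le> 0)" for \<phi> using eq by auto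
  ultimately have 1: "usc_on spacetime g" and 2: "\<And>t x. 0 < t \<Longrightarrow> f (t, x) = g (t, x)"
    and 3: "\<And>\<phi>. (\<forall>q\<in>spacetime. f q - \<phi> q \<le> 0) \<longleftrightarrow> (\<forall>q\<in>spacetime. g q - \<phi> q \<le> 0)" by blast+
  show ?thesis unfolding viscosity_subsolution_def
  proof (intro conjI allI impI 1)
    fix \<phi> t x
    assume "smooth \<phi> \<and> 0 < t \<and> g (t, x) - \<phi> (t, x) = 0 \<and> (\<forall>q\<in>spacetime. g q - \<phi> q \<le> 0)"
    then have "smooth \<phi> \<and> 0 < t \<and> f (t, x) - \<phi> (t, x) = 0 \<and> (\<forall>q\<in>spacetime. f q - \<phi> q \<le> 0)"
      using 2 3 by simp
    then show "let p = grad (\<lambda>y. \<phi> (t, y)) x; \<phi>\<^sub>t = deriv (\<lambda>s. \<phi> (s, x)) t in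
          (p \<noteq> 0 \<longrightarrow> \<phi>\<^sub>t \<le> \<mu> (sgn p) * (c x + kappa_upper \<nu> x (\<lambda>y. \<phi> (t, y))) * norm p) \<and>
          (p = 0 \<longrightarrow> \<phi>\<^sub>t \<le> 0)"
      using f unfolding viscosity_subsolution_def by blast
  qed
qed

lemma viscosity_supersolution_cong:
  assumes eq: "\<And>q. q \<in> spacetime \<Longrightarrow> f q = g q" and f: "viscosity_supersolution \<mu> c \<nu> f"
  shows "viscosity_supersolution \<mu> c \<nu> g"
proof -
  have "{p \<in> spacetime. a < f p} = {p \<in> spacetime. a < g p}" for a using eq by auto
  then have "lsc_on spacetime g" using f by (simp add: viscosity_supersolution_def lsc_on_def)
  moreover have "f (t, x) = g (t, x)" if "0 < t" for t x using eq[of "(t, x)"] that by auto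
  moreover have "(\<forall>q\<in>spacetime. f q - \<phi> q \<ge> 0) \<longleftrightarrow> (\<forall>q\<in>spacetime. g q - \<phi> q \<ge> 0)" for \<phi> using eq by auto
  ultimately have 1: "lsc_on spacetime g" and 2: "\<And>t x. 0 < t \<Longrightarrow> f (t, x) = g (t, x)"
    and 3: "\<And>\<phi>. (\<forall>q\<in>spacetime. f q - \<phi> q \<ge> 0) \<longleftrightarrow> (\<forall>q\<in>spacetime. g q - \<phi> q \<ge> 0)" by blast+
  show ?thesis unfolding viscosity_supersolution_def
  proof (intro conjI allI impI 1)
    fix \<phi> t x
    assume "smooth \<phi> \<and> 0 < t \<and> g (t, x) - \<phi> (t, x) = 0 \<and> (\<forall>q\<in>spacetime. g q - \<phi> q \<ge> 0)"
    then have "smooth \<phi> \<and> 0 < t \<and> f (t, x) - \<phi> (t, x) = 0 \<and> (\<forall>q\<in>spacetime. f q - \<phi> q \<ge> 0)"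
      using 2 3 by simp
    then show "let p = grad (\<lambda>y. \<phi> (t, y)) x; \<phi>\<^sub>t = deriv (\<lambda>s. \<phi> (s, x)) t in
          (p \<noteq> 0 \<longrightarrow> \<phi>\<^sub>t \<ge> \<mu> (sgn p) * (c x + kappa_lower \<nu> x (\<lambda>y. \<phi> (t, y))) * norm p) \<and>
          (p = 0 \<longrightarrow> \<phi>\<^sub>t \<ge> 0)"
      using f unfolding viscosity_supersolution_def by blast
  qed
qed

lemma Ck_uminus: "Ck k f \<Longrightarrow> Ck k (\<lambda>x. - f x)"
proof (induction k arbitrary: f)
  case (Suc k)
  have "frechet_derivative (\<lambda>x. - f x) (at x) = (\<lambda>v. - frechet_derivative f (at x) v)" for x
    using Suc.prems by (intro frechet_derivative_at[symmetric] has_derivative_minus) (simp add: frechet_derivative_works[symmetric])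
  then show ?case using Suc by auto
qed (auto intro: continuous_intros)

lemma smooth_uminus: "smooth f \<Longrightarrow> smooth (\<lambda>x. - f x)"
  by (simp add: smooth_def Ck_uminus)

text \<open>\<open>grad\<close> and \<open>deriv\<close> are given by description operators, so a
  sign can be pulled out of them only once the derivatives are known to exist.\<close>

lemma smooth_slices:
  fixes \<phi> :: "real \<times> 'a::euclidean_space \<Rightarrow> real"
  assumes "smooth \<phi>"
  shows "\<exists>D. GDERIV (\<lambda>y. \<phi> (t, y)) x :> D" "\<exists>D. DERIV (\<lambda>s. \<phi> (s, x)) t :> D"
proof -
  have "Ck (Suc 0) \<phi>" using assms unfolding smooth_def by blast
  then have "\<phi> differentiable (at (t, x))" by simp
  then obtain \<phi>' where d: "(\<phi> has_derivative \<phi>') (at (t, x))" unfolding differentiable_def by blast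
  have d1: "((\<lambda>y. \<phi> (t, y)) has_derivative (\<lambda>v. \<phi>' (0, v))) (at x)"
    by (rule has_derivative_compose[where f = "\<lambda>y. (t, y)"]) (auto intro!: derivative_eq_intros d)
  have d2: "((\<lambda>s. \<phi> (s, x)) has_derivative (\<lambda>v. \<phi>' (v, 0))) (at t)"
    by (rule has_derivative_compose[where f = "\<lambda>s. (s, x)"]) (auto intro!: derivative_eq_intros d)
  have "linear (\<lambda>v. \<phi>' (0, v))" using d1 by (rule has_derivative_linear)
  \<comment> \<open>Riesz representation: a linear functional is the inner product with the value of
    its adjoint at 1.\<close>
  then have "\<phi>' (0, v) = v \<bullet> adjoint (\<lambda>v. \<phi>' (0, v)) 1" for v by (subst adjoint_works) auto
  then have "GDERIV (\<lambda>y. \<phi> (t, y)) x :> adjoint (\<lambda>v. \<phi>' (0, v)) 1"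
    unfolding gderiv_def by (intro has_derivative_eq_rhs[OF d1] ext)
  then show "\<exists>D. GDERIV (\<lambda>y. \<phi> (t, y)) x :> D" ..
  show "\<exists>D. DERIV (\<lambda>s. \<phi> (s, x)) t :> D"
    using d2 real_differentiable_def unfolding differentiable_def by blast
qed

text \<open>Passing from \<phi> to its negative exchanges the two sets in the curvature, and the
  strict and weak inequalities fit: \<open>kappa_lower\<close> becomes minus
  \<open>kappa_upper\<close>. The normal is reversed, whence \<open>\<mu> (- e)\<close>, and the
  forcing changes sign.\<close>

lemma viscosity_supersolution_uminus:
  fixes u :: "real \<times> 'a::euclidean_space \<Rightarrow> real"
  assumes "viscosity_supersolution \<mu> c \<nu> u"
  shows "viscosity_subsolution (\<lambda>e. \<mu> (- e)) (\<lambda>x. - c x) \<nu> (\<lambda>q. - u q)"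
  unfolding viscosity_subsolution_def Let_def
proof (intro conjI allI impI; (elim conjE)?)
  have "{p \<in> spacetime. - u p < a} = {p \<in> spacetime. - a < u p}" for a by auto
  then show "usc_on spacetime (\<lambda>q. - u q)"
    using assms by (simp add: viscosity_supersolution_def lsc_on_def usc_on_def)
next
  fix \<phi> t x
  assume \<phi>: "smooth \<phi>" "0 < t" "- u (t, x) - \<phi> (t, x) = 0" "\<forall>q\<in>spacetime. - u q - \<phi> q \<le> 0"
  obtain D where D: "GDERIV (\<lambda>y. \<phi> (t, y)) x :> D" using smooth_slices(1)[OF \<phi>(1)] by blast
  obtain E where E: "DERIV (\<lambda>s. \<phi> (s, x)) t :> E" using smooth_slices(2)[OF \<phi>(1)] by blast
  have g: "grad (\<lambda>y. \<phi> (t, y)) x = D" "grad (\<lambda>y. - \<phi> (t, y)) x = - D"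
    using GDERIV_imp_grad[OF D] GDERIV_imp_grad[OF GDERIV_minus[OF D]] by auto
  have d: "deriv (\<lambda>s. \<phi> (s, x)) t = E" "deriv (\<lambda>s. - \<phi> (s, x)) t = - E"
    using DERIV_imp_deriv[OF E] DERIV_imp_deriv[OF DERIV_minus[OF E]] by auto
  have k: "kappa_lower \<nu> x (\<lambda>y. - \<phi> (t, y)) = - kappa_upper \<nu> x (\<lambda>y. \<phi> (t, y))"
    by (simp add: kappa_lower_def kappa_upper_def g)
  have "let p = grad (\<lambda>y. - \<phi> (t, y)) x; \<phi>\<^sub>t = deriv (\<lambda>s. - \<phi> (s, x)) t in
          (p \<noteq> 0 \<longrightarrow> \<phi>\<^sub>t \<ge> \<mu> (sgn p) * (c x + kappa_lower \<nu> x (\<lambda>y. - \<phi> (t, y))) * norm p) \<and>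
          (p = 0 \<longrightarrow> \<phi>\<^sub>t \<ge> 0)"
  proof (rule assms[unfolded viscosity_supersolution_def, THEN conjunct2, rule_format, of "\<lambda>q. - \<phi> q"], intro conjI ballI)
    fix q :: "real \<times> 'a" assume "q \<in> spacetime"
    then have "- u q - \<phi> q \<le> 0" using \<phi>(4) by blast
    then show "0 \<le> u q - - \<phi> q" by simp
  qed (use \<phi> smooth_uminus[OF \<phi>(1)] in auto)
  then have r: "D \<noteq> 0 \<Longrightarrow> \<mu> (- sgn D) * (c x - kappa_upper \<nu> x (\<lambda>y. \<phi> (t, y))) * norm D \<le> - E" "D = 0 \<Longrightarrow> E \<le> 0"
    unfolding g d k Let_def by (auto simp: sgn_minus)
  show "deriv (\<lambda>s. \<phi> (s, x)) t \<le> \<mu> (- sgn (grad (\<lambda>y. \<phi> (t, y)) x)) * (- c x + kappa_upper \<nu> x (\<lambda>y. \<phi> (t, y))) * norm (grad (\<lambda>y. \<phi> (t, y)) x)"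
    if "grad (\<lambda>y. \<phi> (t, y)) x \<noteq> 0"
    using r(1) that unfolding g d by (simp add: algebra_simps)
  show "deriv (\<lambda>s. \<phi> (s, x)) t \<le> 0" if "grad (\<lambda>y. \<phi> (t, y)) x = 0"
    using r(2) that unfolding g d by simp
qed

lemma level_curvature_scale: "0 < l \<Longrightarrow> level_curvature \<nu> \<delta> (l *\<^sub>R p) A = level_curvature \<nu> \<delta> p A"
  by (simp add: level_curvature_def mult_le_0_iff zero_less_mult_iff)

text \<open>Only superlevel sets enter \<open>geo_sub\<close>, whence its invariance under increasing changes of the
  unknown. For large \<open>k\<close> the change below approximates \<open>-\<infinity>\<close> on the negative reals and \<open>0\<close> on the
  nonnegative ones.\<close>

lemma geo_sub_exp:
  fixes f :: "real \<times> 'a::euclidean_space \<Rightarrow> real"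
  assumes f: "geo_sub h c \<nu> f" and h: "\<And>l p. 0 < l \<Longrightarrow> h (l *\<^sub>R p) = l * h p" and k: "0 < k"
  shows "geo_sub h c \<nu> (\<lambda>q. - exp (- k * (k * f q + 1)))"
  unfolding geo_sub_def
proof (intro allI impI, elim conjE)
  fix t a C \<rho> \<delta> :: real and x p :: 'a
  assume t: "0 < t" and \<rho>: "0 < \<rho>" and \<delta>: "0 < \<delta>" "\<delta> \<le> 1"
    and touch: "\<forall>q\<in>spacetime. dist q (t, x) < \<rho> \<longrightarrow>
      - exp (- k * (k * f q + 1)) \<le> - exp (- k * (k * f (t, x) + 1)) + a * (fst q - t) + p \<bullet> (snd q - x) + C * (dist q (t, x))\<^sup>2"
  define E where "E = exp (- k * (k * f (t, x) + 1))"
  define N where "N = \<bar>a\<bar> + norm p + \<bar>C\<bar> + 1"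
  have E: "0 < E" and N: "0 < N" by (auto simp: E_def N_def add_nonneg_pos)
  \<comment> \<open>The reciprocal of the derivative of
    \<open>r \<mapsto> - exp (- k * (k * r + 1))\<close> at \<open>f (t, x)\<close>: a quadratic
    above the changed function yields one above \<open>f\<close> with both slopes multiplied by
    \<open>l\<close>.\<close>
  define l where "l = 1 / (E * k\<^sup>2)"
  have l: "0 < l" using E k by (simp add: l_def)
  have le: "l * E * k\<^sup>2 = 1" using E k by (simp add: l_def)
  define C' where "C' = l * C + 2 * (N/E)\<^sup>2 / k\<^sup>2"
  have "l * a \<le> h (l *\<^sub>R p) * (c x + level_curvature \<nu> \<delta> (l *\<^sub>R p) {z. f (t, x) \<le> f (t, x + z)})"
  \<comment> \<open>Within the radius \<open>E / (2*N)\<close> the increment \<open>L\<close> is at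
    most \<open>E/2\<close> in absolute value, so \<open>ln (1 + x1)\<close> may be expanded to
    second order.\<close>
  proof (rule f[unfolded geo_sub_def, rule_format, of t "min \<rho> (min 1 (E / (2*N)))" \<delta> x _ _ C'], intro conjI ballI impI)
    show "0 < min \<rho> (min 1 (E / (2*N)))" using \<rho> E N by simp
    fix q :: "real \<times> 'a" assume q: "q \<in> spacetime" "dist q (t, x) < min \<rho> (min 1 (E / (2*N)))"
    define d where "d = dist q (t, x)"
    define L where "L = a * (fst q - t) + p \<bullet> (snd q - x) + C * d\<^sup>2"
    have d: "0 \<le> d" "d < 1" "d < E / (2*N)" "d < \<rho>" using q(2) by (auto simp: d_def)
    have LN: "\<bar>L\<bar> \<le> N * d"
    proof -
      have f: "\<bar>fst q - t\<bar> \<le> d" "norm (snd q - x) \<le> d"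
        using dist_fst_le[of q "(t, x)"] dist_snd_le[of q "(t, x)"] by (auto simp: d_def dist_real_def dist_norm)
      have "\<bar>a * (fst q - t)\<bar> \<le> \<bar>a\<bar> * d" using f(1) by (simp add: abs_mult mult_left_mono)
      moreover have "\<bar>p \<bullet> (snd q - x)\<bar> \<le> norm p * d"
        using Cauchy_Schwarz_ineq2[of p "snd q - x"] f(2) by (meson mult_left_mono norm_ge_zero order_trans)
      moreover have "\<bar>C * d\<^sup>2\<bar> \<le> \<bar>C\<bar> * d"
      proof -
        have "d * d \<le> 1 * d" using d by (intro mult_right_mono) auto
        then have "\<bar>C\<bar> * (d * d) \<le> \<bar>C\<bar> * d" by (intro mult_left_mono) auto
        then show ?thesis using d by (simp add: abs_mult power2_eq_square)
      qed
      moreover have "N * d = \<bar>a\<bar> * d + norm p * d + \<bar>C\<bar> * d + d" by (simp add: N_def algebra_simps)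
      ultimately show ?thesis using d(1) unfolding L_def by linarith
    qed
    define x1 where "x1 = - L / E"
    have x1N: "\<bar>x1\<bar> \<le> N / E * d" using LN E by (simp add: x1_def divide_right_mono)
    also have "\<dots> \<le> 1/2" using d(3) E N by (simp add: field_simps)
    finally have x1: "\<bar>x1\<bar> \<le> 1/2" .
    have "- exp (- k * (k * f q + 1)) \<le> - E + L"
      using touch[rule_format, OF q(1)] d(4) unfolding d_def[symmetric] by (simp add: E_def L_def)
    then have "E * (1 + x1) \<le> exp (- k * (k * f q + 1))" using E by (simp add: x1_def algebra_simps)
    moreover have "exp (- k * (k * f q + 1)) = E * exp (- k\<^sup>2 * (f q - f (t, x)))"
      unfolding E_def exp_add[symmetric] by (simp add: algebra_simps power2_eq_square)
    ultimately have "1 + x1 \<le> exp (- k\<^sup>2 * (f q - f (t, x)))" using E by simp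
    moreover have "0 < 1 + x1" using x1 by linarith
    ultimately have "ln (1 + x1) \<le> ln (exp (- k\<^sup>2 * (f q - f (t, x))))" by (subst ln_le_cancel_iff) auto
    then have "ln (1 + x1) \<le> - k\<^sup>2 * (f q - f (t, x))" by simp
    moreover have "x1 - 2 * x1\<^sup>2 \<le> ln (1 + x1)" using abs_ln_one_plus_x_minus_x_bound[OF x1] by linarith
    moreover have "x1\<^sup>2 \<le> (N/E)\<^sup>2 * d\<^sup>2"
      using power_mono[OF x1N, of 2] by (simp only: power_mult_distrib power2_abs abs_ge_zero)
    ultimately have "k\<^sup>2 * (f q - f (t, x)) \<le> - x1 + 2 * ((N/E)\<^sup>2 * d\<^sup>2)" by linarith
    then have "f q - f (t, x) \<le> (- x1 + 2 * ((N/E)\<^sup>2 * d\<^sup>2)) / k\<^sup>2" using k by (simp add: field_simps)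
    also have "\<dots> = l * L + 2 * (N/E)\<^sup>2 / k\<^sup>2 * d\<^sup>2" by (simp add: x1_def l_def add_divide_distrib)
    also have "\<dots> = l * a * (fst q - t) + (l *\<^sub>R p) \<bullet> (snd q - x) + C' * d\<^sup>2"
      by (simp add: L_def C'_def algebra_simps)
    finally show "f q \<le> f (t, x) + l * a * (fst q - t) + l *\<^sub>R p \<bullet> (snd q - x) + C' * (dist q (t, x))\<^sup>2"
      by (simp add: d_def)
  qed (use t \<delta> in auto)
  \<comment> \<open>Homogeneity of \<open>h\<close> and scale invariance of the curvature turn the
    factor \<open>l\<close> of the gradient into a common factor.\<close>
  then have "l * a \<le> l * (h p * (c x + level_curvature \<nu> \<delta> p {z. f (t, x) \<le> f (t, x + z)}))"
    using l by (simp add: h level_curvature_scale)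
  then have "a \<le> h p * (c x + level_curvature \<nu> \<delta> p {z. f (t, x) \<le> f (t, x + z)})" using l by simp
  moreover have "{z. - exp (- k * (k * f (t, x) + 1)) \<le> - exp (- k * (k * f (t, x + z) + 1))} = {z. f (t, x) \<le> f (t, x + z)}"
    using k by simp
  ultimately show "a \<le> h p * (c x + level_curvature \<nu> \<delta> p
      {z. - exp (- k * (k * f (t, x) + 1)) \<le> - exp (- k * (k * f (t, x + z) + 1))})" by simp
qed

section \<open>Barriers at the initial time\<close>

context singular_measure
begin

text \<open>By the quadratic bound on \<open>A\<close>, its points with
  \<open>p \<bullet> z \<le> 0\<close> lie in a paraboloid. The factor \<open>norm p\<close> comes
  from the speed and compensates for the growth of the measure of the paraboloid as \<open>p\<close>
  tends to 0.\<close>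

lemma inner_level_small:
  assumes \<delta>: "\<And>p C. norm p < C \<Longrightarrow> norm p * measure \<nu> (paraboloid \<delta> p C) \<le> C * \<epsilon>" and \<delta>1: "\<delta> \<le> 1"
    and A: "A \<in> sets borel" "\<And>z. z \<in> A \<Longrightarrow> 0 \<le> p \<bullet> z + C * (norm z)\<^sup>2" and p: "norm p < C'" "C \<le> C'"
  shows "norm p * measure \<nu> {z \<in> A. norm z < \<delta> \<and> p \<bullet> z \<le> 0} \<le> C' * \<epsilon>"
proof (cases "p = 0")
  case False
  have "measure \<nu> {z \<in> A. norm z < \<delta> \<and> p \<bullet> z \<le> 0} \<le> measure \<nu> (paraboloid \<delta> p C')"
  proof (rule measure_mono_fmeasurable)
    show "{z \<in> A. norm z < \<delta> \<and> p \<bullet> z \<le> 0} \<subseteq> paraboloid \<delta> p C'"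
    proof
      fix z assume z: "z \<in> {z \<in> A. norm z < \<delta> \<and> p \<bullet> z \<le> 0}"
      have "C * (norm z)\<^sup>2 \<le> C' * (norm z)\<^sup>2" using p by (intro mult_right_mono) auto
      then show "z \<in> paraboloid \<delta> p C'" using A(2)[of z] z by (simp add: paraboloid_def)
    qed
    show "{z \<in> A. norm z < \<delta> \<and> p \<bullet> z \<le> 0} \<in> sets \<nu>" using A(1) by simp
  qed (rule fmeasurable_paraboloid[OF False \<delta>1])
  then have "norm p * measure \<nu> {z \<in> A. norm z < \<delta> \<and> p \<bullet> z \<le> 0} \<le> norm p * measure \<nu> (paraboloid \<delta> p C')"
    by (intro mult_left_mono) auto
  also have "\<dots> \<le> C' * \<epsilon>" by (rule \<delta>[OF p(1)])
  finally show ?thesis .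
qed (use \<delta>[OF p(1)] in simp)

lemma measure_outside_le:
  "0 < \<delta> \<Longrightarrow> A \<in> sets borel \<Longrightarrow> A \<subseteq> - ball 0 \<delta> \<Longrightarrow> measure \<nu> A \<le> measure \<nu> (- ball 0 \<delta>)"
  by (intro measure_mono_fmeasurable fmeasurable_outside) auto

text \<open>If \<open>f\<close> exceeded \<open>A + K * t\<close> at \<open>xb\<close>, then after
  subtracting \<open>A\<close>, \<open>K * t\<close> and \<open>B\<close> times the squared distance
  to \<open>xb\<close> it would have a positive maximum, at a positive time by the initial bound,
  where the slope \<open>K\<close> in time is more than the equation allows. The bound by
  \<open>D\<close> confines this maximum, so an upper bound of \<open>c\<close> near
  \<open>xb\<close> suffices. \<open>K\<close> is independent of \<open>f\<close>: it will be fixed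
  before the exponential change of unknown.\<close>

lemma barrier:
  assumes H: "0 \<le> H" and B: "0 < B" and D: "0 \<le> D" and N: "0 \<le> N"
  obtains K where "0 \<le> K"
    "\<And>h c f xb A t. (\<And>p. 0 \<le> h p \<and> h p \<le> H * norm p) \<Longrightarrow> geo_sub h c \<nu> f \<Longrightarrow> continuous_on spacetime f \<Longrightarrow>
       (\<And>q. q \<in> spacetime \<Longrightarrow> f q \<le> A + D) \<Longrightarrow> (\<And>x. f (0, x) \<le> A + B * (norm (x - xb))\<^sup>2) \<Longrightarrow>
       (\<And>x. B * (norm (x - xb))\<^sup>2 \<le> D \<Longrightarrow> c x \<le> N) \<Longrightarrow> 0 \<le> t \<Longrightarrow> f (t, xb) \<le> A + K * t"
proof -
  obtain \<delta> where \<delta>: "0 < \<delta>" "\<delta> \<le> 1"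
    and \<delta>s: "\<And>\<delta>' p C. 0 < \<delta>' \<Longrightarrow> \<delta>' \<le> \<delta> \<Longrightarrow> norm p < C \<Longrightarrow> norm p * measure \<nu> (paraboloid \<delta>' p C) \<le> C * 1"
    using measure_paraboloid_small[OF zero_less_one] by blast
  define P where "P = 2 * B * sqrt (D / B)"
  define C' where "C' = B + P + 1"
  define V where "V = measure \<nu> (- ball 0 \<delta>)"
  \<comment> \<open>On the confined region the gradient is at most \<open>P\<close>, so the
    right-hand side of the equation is at most \<open>H * (P * N + C' + P * V)\<close>; the summand
    1 makes the contradiction strict.\<close>
  define K where "K = H * (P * N + C' + P * V) + 1"
  have P: "0 \<le> P" using B D by (simp add: P_def)
  have V: "0 \<le> V" by (simp add: V_def)
  have K: "1 \<le> K" using H P B N V by (simp add: K_def C'_def)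
  show ?thesis
  proof (rule that)
    fix h c f xb A t
    assume h: "\<And>p. 0 \<le> h p \<and> h p \<le> H * norm p" and geo: "geo_sub h c \<nu> f" and cont: "continuous_on spacetime f"
      and fD: "\<And>q. q \<in> spacetime \<Longrightarrow> f q \<le> A + D" and f0: "\<And>x. f (0, x) \<le> A + B * (norm (x - xb))\<^sup>2"
      and cN: "\<And>x. B * (norm (x - xb))\<^sup>2 \<le> D \<Longrightarrow> c x \<le> N" and t: "0 \<le> (t::real)"
    show "f (t, xb) \<le> A + K * t"
    proof (rule ccontr)
      assume neg: "\<not> ?thesis"
      define G where "G q = f q - A - B * (norm (snd q - xb))\<^sup>2 - K * fst q" for q
      have contG: "continuous_on spacetime G" unfolding G_def by (intro continuous_intros cont)
      define S where "S = {q \<in> spacetime. 0 \<le> G q}"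
      have Sb: "K * fst q \<le> D \<and> B * (norm (snd q - xb))\<^sup>2 \<le> D" if "q \<in> S" for q
      proof -
        have "0 \<le> B * (norm (snd q - xb))\<^sup>2" using B by simp
        moreover have "0 \<le> K * fst q" using that K by (auto simp: S_def)
        moreover have "f q \<le> A + D" using fD that by (simp add: S_def)
        ultimately show ?thesis using that by (simp add: S_def G_def)
      qed
      have "closed S"
      proof -
        have cl: "closed (spacetime :: (real \<times> 'a) set)" by (intro closed_Times) auto
        have "S = spacetime \<inter> G -` {0..}" by (auto simp: S_def)
        then show ?thesis using continuous_closed_preimage[OF contG cl, of "{0..}"] by simp
      qed
      moreover have "bounded S"
      proof (rule bounded_subset)
        show "bounded ({0..D} \<times> cball xb (sqrt (D / B)))" by (intro bounded_Times) auto
        show "S \<subseteq> {0..D} \<times> cball xb (sqrt (D / B))"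
        proof
          fix q assume q: "q \<in> S"
          have "0 \<le> fst q" using q by (auto simp: S_def)
          then have "fst q \<le> K * fst q" using K by (simp add: mult_le_cancel_right1)
          then have "fst q \<le> D" using Sb[OF q] by linarith
          moreover have "(norm (snd q - xb))\<^sup>2 \<le> D / B" using Sb[OF q] B by (simp add: field_simps)
          then have "norm (snd q - xb) \<le> sqrt (D / B)" by (rule real_le_rsqrt)
          ultimately show "q \<in> {0..D} \<times> cball xb (sqrt (D / B))"
            using \<open>0 \<le> fst q\<close> by (cases q) (auto simp: dist_norm norm_minus_commute)
        qed
      qed
      ultimately have "compact S" by (simp add: compact_eq_bounded_closed)
      moreover have tS: "(t, xb) \<in> S" using neg t by (auto simp: S_def G_def)
      moreover have "continuous_on S G" by (rule continuous_on_subset[OF contG]) (auto simp: S_def)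
      ultimately obtain q0 where q0: "q0 \<in> S" "\<And>q. q \<in> S \<Longrightarrow> G q \<le> G q0"
        using continuous_attains_sup[of S G] by blast
      obtain t0 x0 where q0e: "q0 = (t0, x0)" by fastforce
      have G0: "0 < G q0" using q0(2)[OF tS] neg by (simp add: G_def)
      have t0: "0 < t0"
      proof (rule ccontr)
        assume "\<not> 0 < t0"
        then have "t0 = 0" using q0(1) by (auto simp: q0e S_def)
        then show False using G0 f0[of x0] by (simp add: q0e G_def)
      qed
      define p where "p = (2 * B) *\<^sub>R (x0 - xb)"
      have Gmax: "G q \<le> G q0" if "q \<in> spacetime" for q
        using q0(2)[of q] that G0 by (cases "0 \<le> G q") (auto simp: S_def)
      have touch: "f q \<le> f (t0, x0) + K * (fst q - t0) + p \<bullet> (snd q - x0) + B * (norm (snd q - x0))\<^sup>2" if "q \<in> spacetime" for q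
      proof -
        have "snd q - xb = (snd q - x0) + (x0 - xb)" by simp
        then have "(norm (snd q - xb))\<^sup>2 = ((snd q - x0) + (x0 - xb)) \<bullet> ((snd q - x0) + (x0 - xb))"
          by (simp only: power2_norm_eq_inner)
        also have "\<dots> = (norm (snd q - x0))\<^sup>2 + 2 * ((x0 - xb) \<bullet> (snd q - x0)) + (norm (x0 - xb))\<^sup>2"
          unfolding power2_norm_eq_inner inner_add_left inner_add_right by (simp only: inner_commute mult_2 add_ac)
        finally have "(norm (snd q - xb))\<^sup>2 = (norm (snd q - x0))\<^sup>2 + 2 * ((x0 - xb) \<bullet> (snd q - x0)) + (norm (x0 - xb))\<^sup>2" .
        moreover have "p \<bullet> (snd q - x0) = 2 * B * ((x0 - xb) \<bullet> (snd q - x0))" by (simp add: p_def)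
        ultimately have "B * (norm (snd q - xb))\<^sup>2 = B * (norm (snd q - x0))\<^sup>2 + p \<bullet> (snd q - x0) + B * (norm (x0 - xb))\<^sup>2"
          by (simp only: distrib_left mult_ac)
        then show ?thesis using Gmax[OF that] by (simp add: G_def q0e algebra_simps)
      qed
      have geo0: "K \<le> h p * (c x0 + level_curvature \<nu> \<delta> p {z. f (t0, x0) \<le> f (t0, x0 + z)})"
      proof (rule geo[unfolded geo_sub_def, rule_format, of t0 1 \<delta> x0 K p B], intro conjI ballI impI)
        fix q :: "real \<times> 'a" assume q: "q \<in> spacetime"
        have "norm (snd q - x0) \<le> dist q (t0, x0)" using dist_snd_le[of q "(t0, x0)"] by (simp add: dist_norm)
        then have "B * (norm (snd q - x0))\<^sup>2 \<le> B * (dist q (t0, x0))\<^sup>2" using B by (intro mult_left_mono power_mono) auto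
        then show "f q \<le> f (t0, x0) + K * (fst q - t0) + p \<bullet> (snd q - x0) + B * (dist q (t0, x0))\<^sup>2"
          using touch[OF q] by linarith
      qed (use t0 \<delta> in auto)
      have BD: "B * (norm (x0 - xb))\<^sup>2 \<le> D" using Sb[OF q0(1)] by (simp add: q0e)
      have pP: "norm p \<le> P"
      proof -
        have "(norm (x0 - xb))\<^sup>2 \<le> D / B" using BD B by (simp add: field_simps)
        then have "norm (x0 - xb) \<le> sqrt (D / B)" by (rule real_le_rsqrt)
        then show ?thesis using B by (simp add: p_def P_def)
      qed
      define A' where "A' = {z. f (t0, x0) \<le> f (t0, x0 + z)}"
      have "continuous_on UNIV (\<lambda>z. f (t0, x0 + z))"
        by (rule continuous_on_compose2[OF cont]) (use t0 in \<open>auto intro!: continuous_intros\<close>)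
      then have A'm[measurable]: "A' \<in> sets borel" unfolding A'_def by (rule measurable_level_sets)
      have A'i: "0 \<le> p \<bullet> z + B * (norm z)\<^sup>2" if "z \<in> A'" for z
        using touch[of "(t0, x0 + z)"] that t0 by (auto simp: A'_def)
      have "norm p * measure \<nu> {z \<in> A'. norm z < \<delta> \<and> p \<bullet> z \<le> 0} \<le> C' * 1"
        by (rule inner_level_small[OF _ \<delta>(2) A'm A'i]) (use \<delta>s[OF \<delta>(1) order_refl] pP B P in \<open>auto simp: C'_def\<close>)
      moreover have "level_curvature \<nu> \<delta> p A' \<le> measure \<nu> {z \<in> A'. norm z < \<delta> \<and> p \<bullet> z \<le> 0} + V"
      proof -
        have "measure \<nu> (A' - ball 0 \<delta>) \<le> V" unfolding V_def by (rule measure_outside_le[OF \<delta>(1)]) auto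
        then show ?thesis
          unfolding level_curvature_def using measure_nonneg[of \<nu> "{z \<in> - ball 0 \<delta>. 0 < p \<bullet> z}"] by linarith
      qed
      ultimately have lc: "norm p * level_curvature \<nu> \<delta> p A' \<le> C' + P * V"
      proof -
        assume a: "norm p * measure \<nu> {z \<in> A'. norm z < \<delta> \<and> p \<bullet> z \<le> 0} \<le> C' * 1"
          "level_curvature \<nu> \<delta> p A' \<le> measure \<nu> {z \<in> A'. norm z < \<delta> \<and> p \<bullet> z \<le> 0} + V"
        have "norm p * level_curvature \<nu> \<delta> p A' \<le> norm p * (measure \<nu> {z \<in> A'. norm z < \<delta> \<and> p \<bullet> z \<le> 0} + V)"
          using a(2) by (intro mult_left_mono) auto
        also have "\<dots> \<le> C' + P * V"
          using a(1) mult_right_mono[OF pP V] by (simp add: distrib_left)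
        finally show ?thesis .
      qed
      have "c x0 \<le> N" by (rule cN[OF BD])
      then have "norm p * c x0 \<le> norm p * N" by (intro mult_left_mono) auto
      also have "\<dots> \<le> P * N" using pP N by (intro mult_right_mono) auto
      finally have "norm p * c x0 \<le> P * N" .
      then have np: "norm p * (c x0 + level_curvature \<nu> \<delta> p A') \<le> P * N + C' + P * V" using lc by (simp add: distrib_left)
      have np0: "0 \<le> P * N + C' + P * V" using P N V B by (simp add: C'_def)
      have "h p * (c x0 + level_curvature \<nu> \<delta> p A') \<le> H * (P * N + C' + P * V)"
      proof (cases "0 \<le> c x0 + level_curvature \<nu> \<delta> p A'")
        case True
        have "h p * (c x0 + level_curvature \<nu> \<delta> p A') \<le> H * norm p * (c x0 + level_curvature \<nu> \<delta> p A')"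
          using h True by (intro mult_right_mono) auto
        also have "\<dots> \<le> H * (P * N + C' + P * V)" using np H by (simp add: mult.assoc mult_left_mono)
        finally show ?thesis .
      next
        case False
        then have "h p * (c x0 + level_curvature \<nu> \<delta> p A') \<le> 0" using h[of p] by (simp add: mult_nonneg_nonpos)
        also have "\<dots> \<le> H * (P * N + C' + P * V)" using H np0 by simp
        finally show ?thesis .
      qed
      then show False using geo0 unfolding A'_def[symmetric] by (simp add: K_def)
    qed
  qed (use K in simp)
qed

end

section \<open>The nonlocal terms at a maximum point\<close>

context singular_measure
begin

lemma level_curvature_bounds:
  assumes \<delta>: "0 < \<delta>" and A: "A \<in> sets borel"
  shows "level_curvature \<nu> \<delta> p A \<le> measure \<nu> {z \<in> A. norm z < \<delta> \<and> p \<bullet> z \<le> 0} + measure \<nu> (- ball 0 \<delta>)"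
    "- measure \<nu> (- ball 0 \<delta>) \<le> level_curvature \<nu> \<delta> p A"
proof -
  have "measure \<nu> (A - ball 0 \<delta>) \<le> measure \<nu> (- ball 0 \<delta>)"
    using A by (intro measure_outside_le[OF \<delta>]) auto
  moreover have "measure \<nu> {z \<in> - ball 0 \<delta>. 0 < p \<bullet> z} \<le> measure \<nu> (- ball 0 \<delta>)"
    by (rule measure_outside_le[OF \<delta>]) auto
  moreover have "0 \<le> measure \<nu> {z \<in> - ball 0 \<delta>. 0 < p \<bullet> z}" "0 \<le> measure \<nu> (A - ball 0 \<delta>)"
    "0 \<le> measure \<nu> {z \<in> A. norm z < \<delta> \<and> p \<bullet> z \<le> 0}" by auto
  ultimately show "level_curvature \<nu> \<delta> p A \<le> measure \<nu> {z \<in> A. norm z < \<delta> \<and> p \<bullet> z \<le> 0} + measure \<nu> (- ball 0 \<delta>)"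
    "- measure \<nu> (- ball 0 \<delta>) \<le> level_curvature \<nu> \<delta> p A"
    unfolding level_curvature_def by linarith+
qed

text \<open>The estimate replacing monotonicity of the curvature at a maximum point: there \<open>A\<close> and
  \<open>- B\<close> are the superlevel sets of a subsolution and of a supersolution, and up to a small
  translation they are nested.\<close>

lemma nonlocal_estimate:
  fixes h :: "'a \<Rightarrow> real"
  assumes h: "continuous_on UNIV h" "\<And>p. 0 \<le> h p" "\<And>p. h p \<le> H * norm p"
    and H: "0 \<le> H" and P: "0 \<le> P" and C: "0 \<le> C" and \<epsilon>: "0 < \<epsilon>"
  obtains \<delta> p1 \<theta> r R V where "0 < \<delta>" "\<delta> \<le> 1" "0 < p1" "0 < \<theta>" "0 < r" "0 < R" "0 \<le> V"
    "\<And>p p' A B. A \<in> sets borel \<Longrightarrow> B \<in> sets borel \<Longrightarrow> norm p \<le> P \<Longrightarrow> norm p' \<le> P \<Longrightarrow> norm (p - p') \<le> \<theta> \<Longrightarrow>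
       (\<And>z. z \<in> A \<Longrightarrow> 0 \<le> p \<bullet> z + C * (norm z)\<^sup>2) \<Longrightarrow> (\<And>z. z \<in> B \<Longrightarrow> 0 \<le> - p' \<bullet> z + C * (norm z)\<^sup>2) \<Longrightarrow>
       (p1 \<le> norm p \<Longrightarrow> \<exists>k. norm k \<le> r \<and> (\<forall>z\<in>A. norm z < R \<longrightarrow> z + k \<notin> B)) \<Longrightarrow>
       h p * level_curvature \<nu> \<delta> p A + h p' * level_curvature \<nu> \<delta> (- p') B \<le> \<epsilon>"
    "\<And>p y A. A \<in> sets borel \<Longrightarrow> norm p \<le> P \<Longrightarrow> 0 \<le> y \<Longrightarrow> y \<le> H * norm p \<Longrightarrow>
       (\<And>z. z \<in> A \<Longrightarrow> 0 \<le> p \<bullet> z + C * (norm z)\<^sup>2) \<Longrightarrow> \<bar>y * level_curvature \<nu> \<delta> p A\<bar> \<le> V"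
proof -
  have frac: "X * (\<epsilon> / (6 * X)) = \<epsilon>/6" if "0 < X" for X :: real using that by simp
  define C' where "C' = max C P + 1"
  have C': "0 < C'" "C \<le> C'" "P < C'" using C by (auto simp: C'_def)
  define \<epsilon>0 where "\<epsilon>0 = \<epsilon> / (6 * ((H + 1) * C'))"
  have \<epsilon>0: "0 < \<epsilon>0" using \<epsilon> H C' by (simp add: \<epsilon>0_def)
  obtain \<delta> where \<delta>: "0 < \<delta>" "\<delta> \<le> 1"
    and \<delta>s: "\<And>\<delta>' p C. 0 < \<delta>' \<Longrightarrow> \<delta>' \<le> \<delta> \<Longrightarrow> norm p < C \<Longrightarrow> norm p * measure \<nu> (paraboloid \<delta>' p C) \<le> C * \<epsilon>0"
    using measure_paraboloid_small[OF \<epsilon>0] by blast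
  define U where "U = measure \<nu> (- ball 0 \<delta>)"
  have U: "0 \<le> U" by (simp add: U_def)
  \<comment> \<open>Below \<open>p1\<close> no separation of the sets is available, but there the
    speed times the whole outer mass \<open>U\<close> is already small.\<close>
  define p1 where "p1 = \<epsilon> / (6 * ((H + 1) * (U + 1)))"
  have p1: "0 < p1" using \<epsilon> H U by (simp add: p1_def)
  have p1U: "H * p1 * U \<le> \<epsilon>/6"
  proof -
    have "H * U \<le> (H + 1) * (U + 1)" using H U by (simp add: algebra_simps)
    then have "(H * U) * p1 \<le> ((H + 1) * (U + 1)) * p1" using p1 by (intro mult_right_mono) auto
    also have "\<dots> = \<epsilon>/6" unfolding p1_def by (rule frac) (use H U in simp)
    finally show ?thesis by (simp add: mult_ac)
  qed
  define \<epsilon>1 where "\<epsilon>1 = \<epsilon> / (6 * ((H + 1) * (P + 1))) / 3"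
  have \<epsilon>1: "0 < \<epsilon>1" using \<epsilon> H P by (simp add: \<epsilon>1_def)
  have HP1: "H * P * (3 * \<epsilon>1) \<le> \<epsilon>/6"
  proof -
    have "H * P \<le> (H + 1) * (P + 1)" using H P by (simp add: algebra_simps)
    then have "(H * P) * (3 * \<epsilon>1) \<le> ((H + 1) * (P + 1)) * (3 * \<epsilon>1)" using \<epsilon>1 by (intro mult_right_mono) auto
    also have "\<dots> = ((H + 1) * (P + 1)) * (\<epsilon> / (6 * ((H + 1) * (P + 1))))" by (simp add: \<epsilon>1_def)
    also have "\<dots> = \<epsilon>/6" by (rule frac) (use H P in simp)
    finally show ?thesis .
  qed
  obtain \<theta>1 where \<theta>1: "0 < \<theta>1"
    "\<And>p p'. p1 \<le> norm p \<Longrightarrow> norm (p - p') \<le> \<theta>1 \<Longrightarrow>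
      U - \<epsilon>1 \<le> measure \<nu> {z \<in> - ball 0 \<delta>. 0 < p \<bullet> z} + measure \<nu> {z \<in> - ball 0 \<delta>. p' \<bullet> z < 0}"
    unfolding U_def using halfspaces_cover[OF \<delta>(1) \<epsilon>1 p1] by blast
  obtain r where r: "0 < r"
    "\<And>(k::'a) A B. norm k \<le> r \<Longrightarrow> A \<in> sets borel \<Longrightarrow> B \<in> sets borel \<Longrightarrow> (\<And>z. z \<in> A \<Longrightarrow> z + k \<notin> B) \<Longrightarrow>
      measure \<nu> (A - ball 0 \<delta>) + measure \<nu> (B - ball 0 \<delta>) \<le> U + \<epsilon>1"
    unfolding U_def using translated_disjoint[OF \<delta>(1) \<epsilon>1] by blast
  obtain R where R: "1 \<le> R" "measure \<nu> (- ball 0 R) \<le> \<epsilon>1" using tail_small[OF \<epsilon>1] by blast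
  define \<epsilon>2 where "\<epsilon>2 = \<epsilon> / (6 * (U + 1))"
  have \<epsilon>2: "0 < \<epsilon>2" using \<epsilon> U by (simp add: \<epsilon>2_def)
  have \<epsilon>2U: "\<epsilon>2 * U \<le> \<epsilon>/6"
  proof -
    have "\<epsilon>2 * U \<le> \<epsilon>2 * (U + 1)" using \<epsilon>2 by (intro mult_left_mono) auto
    also have "\<dots> = (U + 1) * (\<epsilon> / (6 * (U + 1)))" by (simp only: \<epsilon>2_def mult.commute)
    also have "\<dots> = \<epsilon>/6" by (rule frac) (use U in simp)
    finally show ?thesis .
  qed
  have "uniformly_continuous_on (cball 0 P) h"
    by (rule compact_uniformly_continuous[OF continuous_on_subset[OF h(1)]]) auto
  then obtain \<theta>2 where \<theta>2: "0 < \<theta>2"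
    "\<And>p p'. p \<in> cball 0 P \<Longrightarrow> p' \<in> cball 0 P \<Longrightarrow> dist p' p < \<theta>2 \<Longrightarrow> dist (h p') (h p) < \<epsilon>2"
    using \<epsilon>2 unfolding uniformly_continuous_on_def by blast
  define \<theta> where "\<theta> = min p1 (min \<theta>1 (\<theta>2/2))"
  have inner: "y * measure \<nu> {z \<in> A. norm z < \<delta> \<and> p \<bullet> z \<le> 0} \<le> \<epsilon>/6"
    if A: "A \<in> sets borel" and p: "norm p \<le> P" and y: "y \<le> H * norm p"
      and Ai: "\<And>z. z \<in> A \<Longrightarrow> 0 \<le> p \<bullet> z + C * (norm z)\<^sup>2" for p y A
  proof -
    have pC: "norm p < C'" using p C'(3) by linarith
    have "norm p * measure \<nu> {z \<in> A. norm z < \<delta> \<and> p \<bullet> z \<le> 0} \<le> C' * \<epsilon>0"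
      by (rule inner_level_small[OF \<delta>s[OF \<delta>(1) order_refl] \<delta>(2) A Ai pC C'(2)])
    then have "H * (norm p * measure \<nu> {z \<in> A. norm z < \<delta> \<and> p \<bullet> z \<le> 0}) \<le> H * (C' * \<epsilon>0)"
      using H by (intro mult_left_mono)
    also have "\<dots> \<le> (H + 1) * (C' * \<epsilon>0)" using C' \<epsilon>0 by (intro mult_right_mono) auto
    also have "\<dots> = ((H + 1) * C') * (\<epsilon> / (6 * ((H + 1) * C')))" by (simp only: \<epsilon>0_def mult.assoc)
    also have "\<dots> = \<epsilon>/6" by (rule frac) (use H C' in simp)
    finally have "H * norm p * measure \<nu> {z \<in> A. norm z < \<delta> \<and> p \<bullet> z \<le> 0} \<le> \<epsilon>/6" by (simp add: mult.assoc)
    moreover have "y * measure \<nu> {z \<in> A. norm z < \<delta> \<and> p \<bullet> z \<le> 0} \<le> H * norm p * measure \<nu> {z \<in> A. norm z < \<delta> \<and> p \<bullet> z \<le> 0}"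
      using y by (intro mult_right_mono) auto
    ultimately show ?thesis by linarith
  qed
  define V where "V = \<epsilon>/6 + H * P * U"
  have HPU: "0 \<le> H * P * U" using H P U by simp
  show ?thesis
  proof (rule that[OF \<delta> p1 _ r(1)])
    show "0 < \<theta>" using p1 \<theta>1(1) \<theta>2(1) by (simp add: \<theta>_def)
    show "0 < R" using R(1) by simp
    show "0 \<le> V" using \<epsilon> HPU by (simp add: V_def)
    fix p :: 'a and y A assume A: "A \<in> sets borel" and p: "norm p \<le> P" and y: "0 \<le> y" "y \<le> H * norm p"
      and Ai: "\<And>z. z \<in> A \<Longrightarrow> 0 \<le> p \<bullet> z + C * (norm z)\<^sup>2"
    note b = level_curvature_bounds[OF \<delta>(1) A, of p, folded U_def]
    have "H * norm p \<le> H * P" using p H by (intro mult_left_mono)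
    then have yU: "y * U \<le> H * P * U" using y U by (intro mult_right_mono) auto
    have "y * level_curvature \<nu> \<delta> p A \<le> y * (measure \<nu> {z \<in> A. norm z < \<delta> \<and> p \<bullet> z \<le> 0} + U)"
      using b(1) y by (intro mult_left_mono)
    then have 1: "y * level_curvature \<nu> \<delta> p A \<le> V" using inner[OF A p y(2) Ai] yU by (simp add: distrib_left V_def)
    have "y * (- U) \<le> y * level_curvature \<nu> \<delta> p A" using b(2) y by (intro mult_left_mono)
    then have "- V \<le> y * level_curvature \<nu> \<delta> p A" using yU \<epsilon> by (simp add: V_def)
    then show "\<bar>y * level_curvature \<nu> \<delta> p A\<bar> \<le> V" using 1 by linarith
  next
    fix p p' :: 'a and A B assume A: "A \<in> sets borel" and B: "B \<in> sets borel" and p: "norm p \<le> P" "norm p' \<le> P"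
      and pp: "norm (p - p') \<le> \<theta>" and Ai: "\<And>z. z \<in> A \<Longrightarrow> 0 \<le> p \<bullet> z + C * (norm z)\<^sup>2"
      and Bi: "\<And>z. z \<in> B \<Longrightarrow> 0 \<le> - p' \<bullet> z + C * (norm z)\<^sup>2"
      and sep: "p1 \<le> norm p \<Longrightarrow> \<exists>k. norm k \<le> r \<and> (\<forall>z\<in>A. norm z < R \<longrightarrow> z + k \<notin> B)"
    define IA where "IA = measure \<nu> {z \<in> A. norm z < \<delta> \<and> p \<bullet> z \<le> 0}"
    define IB where "IB = measure \<nu> {z \<in> B. norm z < \<delta> \<and> - p' \<bullet> z \<le> 0}"
    have iA: "h p * IA \<le> \<epsilon>/6" unfolding IA_def by (rule inner[OF A p(1) h(3) Ai])
    have iB: "h p' * IB \<le> \<epsilon>/6" unfolding IB_def by (rule inner[OF B]) (use p h(3)[of p'] Bi in auto)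
    show "h p * level_curvature \<nu> \<delta> p A + h p' * level_curvature \<nu> \<delta> (- p') B \<le> \<epsilon>"
    proof (cases "p1 \<le> norm p")
      case False
      have "norm p' \<le> norm p + norm (p - p')" using norm_triangle_ineq4[of p "p - p'"] by simp
      then have n: "norm p \<le> p1" "norm p' \<le> 2 * p1" using False pp by (auto simp: \<theta>_def)
      have "H * norm p \<le> H * p1" "H * norm p' \<le> H * (2 * p1)" using n H by (auto intro: mult_left_mono)
      then have "h p * U \<le> (H * p1) * U" "h p' * U \<le> (H * (2 * p1)) * U"
        using h(3)[of p] h(3)[of p'] U by (auto intro!: mult_right_mono)
      then have u: "h p * U \<le> \<epsilon>/6" "h p' * U \<le> \<epsilon>/3" using p1U by (auto simp: algebra_simps)
      have "h p * level_curvature \<nu> \<delta> p A \<le> h p * (IA + U)"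
        unfolding IA_def U_def by (intro mult_left_mono level_curvature_bounds(1)[OF \<delta>(1) A] h)
      moreover have "h p' * level_curvature \<nu> \<delta> (- p') B \<le> h p' * (IB + U)"
        unfolding IB_def U_def by (intro mult_left_mono level_curvature_bounds(1)[OF \<delta>(1) B] h)
      ultimately show ?thesis using u iA iB \<epsilon> by (simp add: distrib_left)
    next
      case True
      obtain k where k: "norm k \<le> r" "\<And>z. z \<in> A \<Longrightarrow> norm z < R \<Longrightarrow> z + k \<notin> B" using sep[OF True] by blast
      define X where "X = measure \<nu> (A - ball 0 \<delta>)"
      define Y where "Y = measure \<nu> (B - ball 0 \<delta>)"
      define S where "S = measure \<nu> {z \<in> - ball 0 \<delta>. 0 < p \<bullet> z}"
      define T where "T = measure \<nu> {z \<in> - ball 0 \<delta>. p' \<bullet> z < 0}"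
      have lc: "level_curvature \<nu> \<delta> p A = IA + X - S" "level_curvature \<nu> \<delta> (- p') B = IB + Y - T"
        by (simp_all add: level_curvature_def IA_def IB_def X_def Y_def S_def T_def)
      have st: "U - \<epsilon>1 \<le> S + T" unfolding S_def T_def using True pp by (intro \<theta>1(2)) (auto simp: \<theta>_def)
      have "measure \<nu> ((A \<inter> ball 0 R) - ball 0 \<delta>) + Y \<le> U + \<epsilon>1"
        unfolding Y_def by (rule r(2)[OF k(1)]) (use A B k(2) in auto)
      moreover have "X \<le> measure \<nu> ((A \<inter> ball 0 R) - ball 0 \<delta>) + \<epsilon>1"
      proof -
        have R0: "0 < R" using R(1) by simp
        have f: "(A \<inter> ball 0 R) - ball 0 \<delta> \<in> fmeasurable \<nu>" "- ball (0::'a) R \<in> fmeasurable \<nu>"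
          using A fmeasurable_outside[OF \<delta>(1), of "(A \<inter> ball 0 R) - ball 0 \<delta>"] fmeasurable_outside[OF R0, of "- ball 0 R"] by auto
        have "X \<le> measure \<nu> (((A \<inter> ball 0 R) - ball 0 \<delta>) \<union> - ball 0 R)"
          unfolding X_def using A f by (intro measure_mono_fmeasurable fmeasurable.Un) auto
        also have "\<dots> \<le> measure \<nu> ((A \<inter> ball 0 R) - ball 0 \<delta>) + measure \<nu> (- ball 0 R)"
          using f by (intro measure_Un_le) auto
        finally show ?thesis using R(2) by linarith
      qed
      \<comment> \<open>\<open>X + Y\<close> exceeds \<open>U\<close> by at most
        \<open>2 * \<epsilon>1\<close> (translation and tail), and \<open>S + T\<close> falls short
        of \<open>U\<close> by at most \<open>\<epsilon>1\<close>.\<close>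
      ultimately have xy: "X + Y - S - T \<le> 3 * \<epsilon>1" using st by linarith
      have "h p * (X + Y - S - T) \<le> h p * (3 * \<epsilon>1)" using xy h by (intro mult_left_mono)
      also have "\<dots> \<le> H * P * (3 * \<epsilon>1)"
      proof (rule mult_right_mono)
        have "H * norm p \<le> H * P" using p H by (intro mult_left_mono)
        then show "h p \<le> H * P" using h(3)[of p] by linarith
      qed (use \<epsilon>1 in simp)
      finally have 1: "h p * (X + Y - S - T) \<le> \<epsilon>/6" using HP1 by linarith
      have "dist p' p < \<theta>2" using pp \<theta>2(1) by (simp add: \<theta>_def dist_norm norm_minus_commute)
      then have hh: "\<bar>h p' - h p\<bar> \<le> \<epsilon>2" using \<theta>2(2)[of p p'] p by (simp add: dist_real_def)
      have "0 \<le> Y" "Y \<le> U" "0 \<le> T" "T \<le> U"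
        unfolding Y_def T_def U_def using B by (auto intro!: measure_outside_le[OF \<delta>(1)])
      then have "\<bar>Y - T\<bar> \<le> U" by linarith
      then have "\<bar>h p' - h p\<bar> * \<bar>Y - T\<bar> \<le> \<epsilon>2 * U" using hh \<epsilon>2 by (intro mult_mono) auto
      then have 2: "(h p' - h p) * (Y - T) \<le> \<epsilon>/6" using \<epsilon>2U by (metis abs_ge_self abs_mult order_trans)
      \<comment> \<open>With the common factor \<open>h p\<close> the outer terms form the
        difference just estimated; the defect \<open>h p' - h p\<close> multiplies only the bounded
        quantity \<open>Y - T\<close>.\<close>
      have "h p * level_curvature \<nu> \<delta> p A + h p' * level_curvature \<nu> \<delta> (- p') B
         = h p * IA + h p' * IB + h p * (X + Y - S - T) + (h p' - h p) * (Y - T)"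
        unfolding lc by (simp add: algebra_simps)
      then show ?thesis using iA iB 1 2 \<epsilon> by linarith
    qed
  qed
qed

end

section \<open>The doubled penalty\<close>

lemma exp_le_quadratic:
  assumes "\<bar>x\<bar> \<le> (1::real)" shows "exp x \<le> 1 + x + x\<^sup>2"
proof (cases "0 \<le> x")
  case True
  then show ?thesis using assms exp_bound[of x] by simp
next
  case False
  define y where "y = - x"
  have y: "0 < y" using False by (simp add: y_def)
  have "exp (- y) = 1 / exp y" by (simp add: exp_minus inverse_eq_divide)
  also have "\<dots> \<le> 1 / (1 + y)" using y exp_ge_add_one_self[of y] by (intro divide_left_mono) auto
  also have "\<dots> \<le> 1 - y + y\<^sup>2"
  proof -
    have "(1 - y + y\<^sup>2) * (1 + y) = 1 + y^3" by (simp add: algebra_simps power2_eq_square power3_eq_cube)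
    then have "1 \<le> (1 - y + y\<^sup>2) * (1 + y)" using y by simp
    then show ?thesis using y by (simp add: divide_le_eq)
  qed
  finally show ?thesis by (simp add: y_def)
qed

lemma power2_norm_add: "(norm (v + w :: 'a::real_inner))\<^sup>2 = (norm v)\<^sup>2 + 2 * (v \<bullet> w) + (norm w)\<^sup>2"
  unfolding power2_norm_eq_inner inner_add_left inner_add_right by (simp add: inner_commute)

text \<open>Second-order expansion of the quadratic term of the penalty below, with an explicit
  remainder as \<open>geo_sub\<close> asks for; \<open>q\<close> stands for the distance in
  space-time.\<close>

lemma exp_mult_power2_norm_expansion:
  fixes D v :: "'a::real_inner"
  assumes \<Lambda>: "0 \<le> \<Lambda>" and \<tau>: "\<bar>\<tau>\<bar> \<le> q" and v: "norm v \<le> q" and q: "q \<le> 1" "\<Lambda> * q \<le> 1"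
  shows "exp (\<Lambda> * \<tau>) * (norm (D + v))\<^sup>2 \<le> (norm D)\<^sup>2 + 2 * (D \<bullet> v) + \<Lambda> * \<tau> * (norm D)\<^sup>2
     + (1 + \<Lambda> * (2 * norm D + 1) + \<Lambda>\<^sup>2 * (norm D + 1)\<^sup>2) * q\<^sup>2"
proof -
  define d where "d = \<Lambda> * \<tau>"
  have q0: "0 \<le> q" using \<tau> by linarith
  have d: "\<bar>d\<bar> \<le> \<Lambda> * q" using \<tau> \<Lambda> by (simp add: d_def abs_mult mult_left_mono)
  then have "exp d \<le> 1 + d + d\<^sup>2" using q(2) by (intro exp_le_quadratic) linarith
  then have "exp d * (norm (D + v))\<^sup>2 \<le> (1 + d + d\<^sup>2) * (norm (D + v))\<^sup>2" by (intro mult_right_mono) auto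
  also have "\<dots> = (norm D)\<^sup>2 + 2 * (D \<bullet> v) + d * (norm D)\<^sup>2 + ((norm v)\<^sup>2 + d * (2 * (D \<bullet> v) + (norm v)\<^sup>2) + d\<^sup>2 * (norm (D + v))\<^sup>2)"
    by (simp add: power2_norm_add algebra_simps)
  also have "\<dots> \<le> (norm D)\<^sup>2 + 2 * (D \<bullet> v) + d * (norm D)\<^sup>2 + (q\<^sup>2 + \<Lambda> * (2 * norm D + 1) * q\<^sup>2 + \<Lambda>\<^sup>2 * (norm D + 1)\<^sup>2 * q\<^sup>2)"
  proof (intro add_mono order_refl)
    show v2: "(norm v)\<^sup>2 \<le> q\<^sup>2" using v by (intro power_mono) auto
    have "\<bar>D \<bullet> v\<bar> \<le> norm D * q"
      using Cauchy_Schwarz_ineq2[of D v] mult_left_mono[OF v norm_ge_zero[of D]] by linarith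
    moreover have "q\<^sup>2 \<le> q" using q(1) q0 by (simp add: power2_eq_square mult_left_le)
    ultimately have "\<bar>2 * (D \<bullet> v) + (norm v)\<^sup>2\<bar> \<le> (2 * norm D + 1) * q"
      unfolding distrib_right using v2 zero_le_power2[of "norm v"] q0 by (intro abs_leI) linarith+
    then have "\<bar>d\<bar> * \<bar>2 * (D \<bullet> v) + (norm v)\<^sup>2\<bar> \<le> (\<Lambda> * q) * ((2 * norm D + 1) * q)"
      using d \<Lambda> q0 by (intro mult_mono) auto
    moreover have "d * (2 * (D \<bullet> v) + (norm v)\<^sup>2) \<le> \<bar>d\<bar> * \<bar>2 * (D \<bullet> v) + (norm v)\<^sup>2\<bar>"
      by (metis abs_ge_self abs_mult)
    ultimately show "d * (2 * (D \<bullet> v) + (norm v)\<^sup>2) \<le> \<Lambda> * (2 * norm D + 1) * q\<^sup>2"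
      by (simp add: power2_eq_square mult_ac)
    have "d\<^sup>2 \<le> (\<Lambda> * q)\<^sup>2" using power_mono[OF d, of 2] by simp
    moreover have "(norm (D + v))\<^sup>2 \<le> (norm D + 1)\<^sup>2"
      using norm_triangle_ineq[of D v] v q(1) by (intro power_mono) auto
    ultimately have "d\<^sup>2 * (norm (D + v))\<^sup>2 \<le> (\<Lambda> * q)\<^sup>2 * (norm D + 1)\<^sup>2" by (intro mult_mono) auto
    then show "d\<^sup>2 * (norm (D + v))\<^sup>2 \<le> \<Lambda>\<^sup>2 * (norm D + 1)\<^sup>2 * q\<^sup>2" by (simp add: power_mult_distrib mult_ac)
  qed
  finally show ?thesis by (simp add: d_def algebra_simps)
qed

text \<open>The logarithm makes the norm of the gradient,
  \<open>norm \<xi> / (1 + (norm \<xi>)\<^sup>2)\<close>, decay so fast that its product with a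
  function of linear growth such as \<open>c\<^sub>1\<close> stays bounded, while the penalty still
  tends to infinity.\<close>

definition loc_pen :: "'a::euclidean_space \<Rightarrow> real" where
  "loc_pen \<xi> = ln (1 + (norm \<xi>)\<^sup>2) / 2"

lemma loc_pen_nonneg: "0 \<le> loc_pen \<xi>"
  by (simp add: loc_pen_def)

lemma continuous_loc_pen: "continuous_on UNIV loc_pen"
  unfolding loc_pen_def
  by (intro continuous_intros) (auto simp: add_nonneg_eq_0_iff)

lemma loc_pen_bound:
  assumes "loc_pen \<xi> \<le> m" shows "norm \<xi> \<le> exp m"
proof -
  have p: "0 < 1 + (norm \<xi>)\<^sup>2" by (simp add: add_pos_nonneg)
  have "ln (1 + (norm \<xi>)\<^sup>2) \<le> 2 * m" using assms by (simp add: loc_pen_def)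
  then have "1 + (norm \<xi>)\<^sup>2 \<le> exp (2 * m)" using p by (metis exp_le_cancel_iff exp_ln)
  then have "(norm \<xi>)\<^sup>2 \<le> exp (2 * m)" by linarith
  then have "(norm \<xi>)\<^sup>2 \<le> (exp m)\<^sup>2" by (simp only: exp_double)
  then show ?thesis by (rule power2_le_imp_le) simp
qed

text \<open>From \<open>ln a \<le> a - 1\<close> with \<open>a\<close> the quotient of the
  arguments. The slope is the norm of the gradient at \<xi>, and the denominator under the quadratic
  term is at least 1.\<close>

lemma loc_pen_increment:
  "loc_pen y - loc_pen \<xi> \<le> norm (y - \<xi>) * (norm \<xi> / (1 + (norm \<xi>)\<^sup>2)) + (norm (y - \<xi>))\<^sup>2 / 2"
proof -
  define Q where "Q = 1 + (norm \<xi>)\<^sup>2"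
  have Q: "1 \<le> Q" by (simp add: Q_def)
  define D where "D = 2 * (\<xi> \<bullet> (y - \<xi>)) + (norm (y - \<xi>))\<^sup>2"
  have e: "1 + (norm y)\<^sup>2 = Q + D" using power2_norm_add[of \<xi> "y - \<xi>"] by (simp add: Q_def D_def)
  have y: "0 < 1 + (norm y)\<^sup>2" by (simp add: add_pos_nonneg)
  have "ln (1 + (norm y)\<^sup>2) - ln Q = ln ((1 + (norm y)\<^sup>2) / Q)" using y Q by (simp add: ln_div)
  also have "\<dots> \<le> (1 + (norm y)\<^sup>2) / Q - 1" using y Q by (intro ln_le_minus_one) simp
  also have "\<dots> = D / Q" using Q by (simp add: e field_simps)
  also have "\<dots> \<le> (2 * (norm \<xi> * norm (y - \<xi>)) + (norm (y - \<xi>))\<^sup>2) / Q"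
    using Cauchy_Schwarz_ineq2[of \<xi> "y - \<xi>"] Q by (intro divide_right_mono) (auto simp: D_def)
  also have "\<dots> = 2 * (norm (y - \<xi>) * (norm \<xi> / Q)) + (norm (y - \<xi>))\<^sup>2 / Q" by (simp add: add_divide_distrib mult_ac)
  also have "\<dots> \<le> 2 * (norm (y - \<xi>) * (norm \<xi> / Q)) + (norm (y - \<xi>))\<^sup>2 / 1"
    using Q by (intro add_left_mono divide_left_mono) auto
  finally show ?thesis by (simp add: loc_pen_def Q_def)
qed

lemma norm_div_bounds:
  fixes \<xi> :: "'a::real_normed_vector"
  shows "norm \<xi> / (1 + (norm \<xi>)\<^sup>2) \<le> 1" "norm \<xi> / (1 + (norm \<xi>)\<^sup>2) * (1 + norm \<xi>) \<le> 2"
proof -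
  have p: "0 < 1 + (norm \<xi>)\<^sup>2" by (simp add: add_pos_nonneg)
  have "0 \<le> (norm \<xi> - 1)\<^sup>2" by simp
  then have n: "2 * norm \<xi> \<le> 1 + (norm \<xi>)\<^sup>2" by (simp add: power2_diff)
  then have n1: "norm \<xi> \<le> 1 + (norm \<xi>)\<^sup>2" using norm_ge_zero[of \<xi>] by linarith
  then show "norm \<xi> / (1 + (norm \<xi>)\<^sup>2) \<le> 1" using p by (simp add: divide_le_eq)
  have "norm \<xi> * (1 + norm \<xi>) = norm \<xi> + (norm \<xi>)\<^sup>2" by (simp add: distrib_left power2_eq_square)
  also have "\<dots> \<le> (1 + (norm \<xi>)\<^sup>2) + (1 + (norm \<xi>)\<^sup>2)" using n1 by (intro add_mono) auto
  also have "\<dots> = 2 * (1 + (norm \<xi>)\<^sup>2)" by simp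
  finally have "norm \<xi> * (1 + norm \<xi>) / (1 + (norm \<xi>)\<^sup>2) \<le> 2" using p by (simp add: divide_le_eq)
  then show "norm \<xi> / (1 + (norm \<xi>)\<^sup>2) * (1 + norm \<xi>) \<le> 2" by simp
qed

text \<open>The factor \<open>exp (\<Lambda> t)\<close> absorbs the Lipschitz dependence on \<open>c\<close>; the square in the time
  variables enforces \<open>s\<close> close to \<open>t + \<theta> S(\<xi>) (1 + t)\<close>, where the slope of this map in \<open>t\<close> gives the
  gain for large \<open>|c|\<close> and its offset at \<open>t = 0\<close> keeps the maximum away from the initial time on
  the side where no barrier is available.\<close>

definition penalty :: "real \<Rightarrow> real \<Rightarrow> real \<Rightarrow> real \<Rightarrow> ('a \<Rightarrow> real) \<Rightarrow> real \<Rightarrow> real \<Rightarrow>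
    real \<Rightarrow> 'a::euclidean_space \<Rightarrow> real \<Rightarrow> 'a \<Rightarrow> 'a \<Rightarrow> real" where
  "penalty \<epsilon> \<Lambda> \<eta> \<theta> S \<beta> \<alpha> t x s y \<xi> = exp (\<Lambda> * t) * (norm (x - y))\<^sup>2 / (2 * \<epsilon>) + \<eta> * t
     + (s - t - \<theta> * S \<xi> * (1 + t))\<^sup>2 / (2 * \<beta>) + (norm (y - \<xi>))\<^sup>2 / 2 + \<alpha> * loc_pen \<xi>"

lemma penalty_bounds:
  assumes pos: "0 < \<epsilon>" "0 \<le> \<Lambda>" "0 < \<eta>" "0 < \<beta>" "0 < \<alpha>" and t: "0 \<le> t"
    and le: "penalty \<epsilon> \<Lambda> \<eta> \<theta> S \<beta> \<alpha> t x s y \<xi> \<le> M"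
  shows "\<eta> * t \<le> M" "(norm (x - y))\<^sup>2 \<le> 2 * \<epsilon> * M" "(s - t - \<theta> * S \<xi> * (1 + t))\<^sup>2 \<le> 2 * \<beta> * M"
    "(norm (y - \<xi>))\<^sup>2 \<le> 2 * M" "\<alpha> * loc_pen \<xi> \<le> M"
proof -
  have n: "0 \<le> exp (\<Lambda> * t) * (norm (x - y))\<^sup>2 / (2 * \<epsilon>)" "0 \<le> \<eta> * t" "0 \<le> (s - t - \<theta> * S \<xi> * (1 + t))\<^sup>2 / (2 * \<beta>)"
    "0 \<le> (norm (y - \<xi>))\<^sup>2 / 2" "0 \<le> \<alpha> * loc_pen \<xi>"
    using pos t loc_pen_nonneg[of \<xi>] by auto
  show "\<eta> * t \<le> M" "(norm (y - \<xi>))\<^sup>2 \<le> 2 * M" "\<alpha> * loc_pen \<xi> \<le> M"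
    using le n unfolding penalty_def by linarith+
  have "(s - t - \<theta> * S \<xi> * (1 + t))\<^sup>2 / (2 * \<beta>) \<le> M" using le n unfolding penalty_def by linarith
  then show "(s - t - \<theta> * S \<xi> * (1 + t))\<^sup>2 \<le> 2 * \<beta> * M" using pos by (simp add: field_simps)
  have "1 * (norm (x - y))\<^sup>2 \<le> exp (\<Lambda> * t) * (norm (x - y))\<^sup>2" using pos t by (intro mult_right_mono) auto
  moreover have "exp (\<Lambda> * t) * (norm (x - y))\<^sup>2 / (2 * \<epsilon>) \<le> M" using le n unfolding penalty_def by linarith
  then have "exp (\<Lambda> * t) * (norm (x - y))\<^sup>2 \<le> 2 * \<epsilon> * M" using pos by (simp add: field_simps)
  ultimately show "(norm (x - y))\<^sup>2 \<le> 2 * \<epsilon> * M" by linarith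
qed

text \<open>The terms of the penalty bound the variables in turn: the localisation bounds \<xi>,
  hence \<open>y\<close>, hence \<open>x\<close>; \<open>\<eta> * t\<close> bounds \<open>t\<close>,
  and with it the time square bounds \<open>s\<close>. So the superlevel sets in question are
  compact.\<close>

lemma penalized_max_exists:
  fixes w u :: "real \<times> 'a::euclidean_space \<Rightarrow> real"
  assumes w: "continuous_on spacetime w" and u: "continuous_on spacetime u"
    and M: "\<And>q q'. q \<in> spacetime \<Longrightarrow> q' \<in> spacetime \<Longrightarrow> w q - u q' \<le> M"
    and S: "continuous_on UNIV S" "\<And>\<xi>. \<bar>S \<xi>\<bar> \<le> 1"
    and pos: "0 < \<epsilon>" "0 \<le> \<Lambda>" "0 < \<eta>" "0 < \<beta>" "0 < \<alpha>" "0 \<le> \<theta>"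
    and m: "0 \<le> m" "0 \<le> ta" "0 \<le> sa" "m \<le> w (ta, xa) - u (sa, ya) - penalty \<epsilon> \<Lambda> \<eta> \<theta> S \<beta> \<alpha> ta xa sa ya \<xi>a"
  obtains t x s y \<xi> where "0 \<le> t" "0 \<le> s"
    "m \<le> w (t, x) - u (s, y) - penalty \<epsilon> \<Lambda> \<eta> \<theta> S \<beta> \<alpha> t x s y \<xi>"
    "\<And>t' x' s' y' \<xi>'. 0 \<le> t' \<Longrightarrow> 0 \<le> s' \<Longrightarrow> w (t', x') - u (s', y') - penalty \<epsilon> \<Lambda> \<eta> \<theta> S \<beta> \<alpha> t' x' s' y' \<xi>'
       \<le> w (t, x) - u (s, y) - penalty \<epsilon> \<Lambda> \<eta> \<theta> S \<beta> \<alpha> t x s y \<xi>"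
proof -
  define F where "F = (\<lambda>(t, x, s, y, \<xi>). w (t, x) - u (s, y) - penalty \<epsilon> \<Lambda> \<eta> \<theta> S \<beta> \<alpha> t x s y \<xi>)"
  define Z :: "(real \<times> 'a \<times> real \<times> 'a \<times> 'a) set" where "Z = {0..} \<times> UNIV \<times> {0..} \<times> UNIV \<times> UNIV"
  have cont: "continuous_on Z F"
    unfolding F_def Z_def penalty_def case_prod_unfold
    by (intro continuous_intros continuous_on_compose2[OF w] continuous_on_compose2[OF u]
        continuous_on_compose2[OF S(1)] continuous_on_compose2[OF continuous_loc_pen]) (use pos in auto)
  define Y where "Y = {z \<in> Z. m \<le> F z}"
  have "closed Z" unfolding Z_def by (intro closed_Times) auto
  moreover have "Y = Z \<inter> F -` {m..}" by (auto simp: Y_def)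
  ultimately have "closed Y" using continuous_closed_preimage[OF cont, of "{m..}"] by simp
  moreover have "bounded Y"
  proof -
    define T where "T = M / \<eta>"
    define r where "r = exp (M / \<alpha>)"
    define sb where "sb = sqrt (2 * \<beta> * M) + T + \<theta> * (1 + T)"
    define yb where "yb = r + sqrt (2 * M)"
    define xb where "xb = yb + sqrt (2 * \<epsilon> * M)"
    have "Y \<subseteq> {0..T} \<times> cball 0 xb \<times> {0..sb} \<times> cball 0 yb \<times> cball 0 r"
    proof
      fix z assume z: "z \<in> Y"
      obtain t x s y \<xi> where ze: "z = (t, x, s, y, \<xi>)" using prod_cases5 by blast
      have ts: "0 \<le> t" "0 \<le> s" using z by (auto simp: Y_def Z_def ze)
      have "m \<le> w (t, x) - u (s, y) - penalty \<epsilon> \<Lambda> \<eta> \<theta> S \<beta> \<alpha> t x s y \<xi>" using z by (simp add: Y_def F_def ze)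
      moreover have "w (t, x) - u (s, y) \<le> M" using ts by (intro M) auto
      ultimately have "penalty \<epsilon> \<Lambda> \<eta> \<theta> S \<beta> \<alpha> t x s y \<xi> \<le> M" using m(1) by linarith
      note b = penalty_bounds[OF pos(1-5) ts(1) this]
      have t: "t \<le> T" using b(1) pos by (simp add: T_def field_simps)
      have xi: "norm \<xi> \<le> r" unfolding r_def using b(5) pos by (intro loc_pen_bound) (simp add: field_simps)
      have "norm (y - \<xi>) \<le> sqrt (2 * M)" using b(4) by (rule real_le_rsqrt)
      then have y: "norm y \<le> yb" using xi norm_triangle_sub[of y \<xi>] by (simp add: yb_def)
      have "norm (x - y) \<le> sqrt (2 * \<epsilon> * M)" using b(2) by (rule real_le_rsqrt)
      then have x: "norm x \<le> xb" using y norm_triangle_sub[of x y] by (simp add: xb_def)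
      have "s - t - \<theta> * S \<xi> * (1 + t) \<le> sqrt (2 * \<beta> * M)" using b(3) by (rule real_le_rsqrt)
      moreover have "\<theta> * S \<xi> * (1 + t) \<le> \<theta> * (1 + T)"
      proof -
        have "\<theta> * S \<xi> \<le> \<theta> * 1" using S(2)[of \<xi>] pos by (intro mult_left_mono) auto
        then have "\<theta> * S \<xi> * (1 + t) \<le> \<theta> * (1 + t)" using ts by (intro mult_right_mono) auto
        also have "\<dots> \<le> \<theta> * (1 + T)" using t pos by (intro mult_left_mono) auto
        finally show ?thesis .
      qed
      ultimately have "s \<le> sb" using t by (simp add: sb_def)
      then show "z \<in> {0..T} \<times> cball 0 xb \<times> {0..sb} \<times> cball 0 yb \<times> cball 0 r"
        using ts t x y xi by (simp add: ze)
    qed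
    moreover have "bounded ({0..T} \<times> cball (0::'a) xb \<times> {0..sb} \<times> cball (0::'a) yb \<times> cball (0::'a) r)"
      by (intro bounded_Times) auto
    ultimately show ?thesis by (rule bounded_subset[rotated])
  qed
  ultimately have "compact Y" by (simp add: compact_eq_bounded_closed)
  moreover have a: "(ta, xa, sa, ya, \<xi>a) \<in> Y" using m by (simp add: Y_def Z_def F_def)
  moreover have "continuous_on Y F" by (rule continuous_on_subset[OF cont]) (auto simp: Y_def)
  ultimately obtain z where z: "z \<in> Y" "\<And>z'. z' \<in> Y \<Longrightarrow> F z' \<le> F z"
    using continuous_attains_sup[of Y F] by blast
  obtain t x s y \<xi> where ze: "z = (t, x, s, y, \<xi>)" using prod_cases5 by blast
  have all: "F z' \<le> F z" if "z' \<in> Z" for z'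
  proof (cases "m \<le> F z'")
    case True
    then show ?thesis using that z(2) by (simp add: Y_def)
  next
    case False
    then show ?thesis using z(1) by (simp add: Y_def)
  qed
  show ?thesis
  proof (rule that)
    show "0 \<le> t" "0 \<le> s" "m \<le> w (t, x) - u (s, y) - penalty \<epsilon> \<Lambda> \<eta> \<theta> S \<beta> \<alpha> t x s y \<xi>"
      using z(1) by (auto simp: Y_def Z_def F_def ze)
    fix t' s' :: real and x' y' \<xi>' :: 'a assume "0 \<le> t'" "0 \<le> s'"
    then have "(t', x', s', y', \<xi>') \<in> Z" by (simp add: Z_def)
    from all[OF this] show "w (t', x') - u (s', y') - penalty \<epsilon> \<Lambda> \<eta> \<theta> S \<beta> \<alpha> t' x' s' y' \<xi>'
       \<le> w (t, x) - u (s, y) - penalty \<epsilon> \<Lambda> \<eta> \<theta> S \<beta> \<alpha> t x s y \<xi>"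
      by (simp add: F_def ze)
  qed
qed

lemma power2_norm_diff: "(norm (v - w :: 'a::real_inner))\<^sup>2 = (norm v)\<^sup>2 - 2 * (v \<bullet> w) + (norm w)\<^sup>2"
  using power2_norm_add[of v "- w"] by simp

text \<open>Each claim tests the maximum against one competitor: \<open>x\<close> moved,
  \<open>y\<close> moved, all three space points moved, and \<xi> replaced by \<open>y\<close>. In
  the third, \<open>y\<close> and \<xi> move by \<open>z + k\<close> but \<open>x\<close> by
  \<open>z\<close>: the difference \<open>y - \<xi>\<close> is unchanged and \<open>x - y\<close>
  becomes \<open>x - y - k\<close>, which is where the translation pays.\<close>

lemma penalized_max_space:
  fixes w u :: "real \<times> 'a::euclidean_space \<Rightarrow> real" and t s \<epsilon> \<Lambda> \<eta> \<theta> \<beta> \<alpha> :: real and x y \<xi> :: 'a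
  assumes pos: "0 < \<epsilon>" and ts: "0 \<le> t" "0 \<le> s"
    and max: "\<And>t' x' s' y' \<xi>'. 0 \<le> t' \<Longrightarrow> 0 \<le> s' \<Longrightarrow> w (t', x') - u (s', y') - penalty \<epsilon> \<Lambda> \<eta> \<theta> S \<beta> \<alpha> t' x' s' y' \<xi>'
       \<le> w (t, x) - u (s, y) - penalty \<epsilon> \<Lambda> \<eta> \<theta> S \<beta> \<alpha> t x s y \<xi>"
    and E: "E = exp (\<Lambda> * t)" and p: "p = (E / \<epsilon>) *\<^sub>R (x - y)" and p': "p' = p - (y - \<xi>)"
    and T: "T = (\<lambda>\<xi>'. (s - t - \<theta> * S \<xi>' * (1 + t))\<^sup>2 / (2 * \<beta>))"
  shows "w (t, x) \<le> w (t, x + z) \<Longrightarrow> 0 \<le> p \<bullet> z + (E / \<epsilon> + 1) * (norm z)\<^sup>2"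
    "u (s, y + z) \<le> u (s, y) \<Longrightarrow> 0 \<le> - p' \<bullet> z + (E / \<epsilon> + 1) * (norm z)\<^sup>2"
    "w (t, x) \<le> w (t, x + z) \<Longrightarrow> u (s, y) + E * ((norm (x - y))\<^sup>2 - (norm (x - y - k))\<^sup>2) / (2 * \<epsilon>)
       - (T (\<xi> + z + k) - T \<xi>) - \<alpha> * (loc_pen (\<xi> + z + k) - loc_pen \<xi>) \<le> u (s, y + z + k)"
    "(norm (y - \<xi>))\<^sup>2 / 2 + T \<xi> + \<alpha> * loc_pen \<xi> \<le> T y + \<alpha> * loc_pen y"
proof -
  have E0: "0 < E" by (simp add: E)
  show "0 \<le> p \<bullet> z + (E / \<epsilon> + 1) * (norm z)\<^sup>2" if "w (t, x) \<le> w (t, x + z)"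
  proof -
    have "E * (norm (x - y))\<^sup>2 / (2 * \<epsilon>) \<le> E * (norm ((x - y) + z))\<^sup>2 / (2 * \<epsilon>)"
      using max[of t s "x + z" y \<xi>] ts that by (simp add: penalty_def E algebra_simps)
    also have "\<dots> = E * (norm (x - y))\<^sup>2 / (2 * \<epsilon>) + p \<bullet> z + E / (2 * \<epsilon>) * (norm z)\<^sup>2"
    proof -
      have pz: "p \<bullet> z = E / \<epsilon> * ((x - y) \<bullet> z)" by (simp add: p)
      show ?thesis unfolding power2_norm_add pz using pos by (simp add: field_simps)
    qed
    also have "\<dots> \<le> E * (norm (x - y))\<^sup>2 / (2 * \<epsilon>) + p \<bullet> z + (E / \<epsilon> + 1) * (norm z)\<^sup>2"
      using pos E0 by (intro add_left_mono mult_right_mono) (auto simp: field_simps)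
    finally show ?thesis by simp
  qed
  show "0 \<le> - p' \<bullet> z + (E / \<epsilon> + 1) * (norm z)\<^sup>2" if "u (s, y + z) \<le> u (s, y)"
  proof -
    have e: "x - (y + z) = (x - y) - z" "y + z - \<xi> = (y - \<xi>) + z" by simp_all
    have "E * (norm (x - y))\<^sup>2 / (2 * \<epsilon>) + (norm (y - \<xi>))\<^sup>2 / 2
      \<le> E * (norm ((x - y) - z))\<^sup>2 / (2 * \<epsilon>) + (norm ((y - \<xi>) + z))\<^sup>2 / 2"
      using max[of t s x "y + z" \<xi>] ts that unfolding penalty_def E e by simp
    also have "\<dots> = E * (norm (x - y))\<^sup>2 / (2 * \<epsilon>) + (norm (y - \<xi>))\<^sup>2 / 2 - p' \<bullet> z + (E / (2 * \<epsilon>) + 1/2) * (norm z)\<^sup>2"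
    proof -
      have pz: "p' \<bullet> z = E / \<epsilon> * ((x - y) \<bullet> z) - (y - \<xi>) \<bullet> z"
        by (simp only: p' p inner_diff_left[of "(E / \<epsilon>) *\<^sub>R (x - y)" "y - \<xi>" z] inner_scaleR_left)
      show ?thesis unfolding power2_norm_add power2_norm_diff pz using pos by (simp add: field_simps)
    qed
    also have "\<dots> \<le> E * (norm (x - y))\<^sup>2 / (2 * \<epsilon>) + (norm (y - \<xi>))\<^sup>2 / 2 - p' \<bullet> z + (E / \<epsilon> + 1) * (norm z)\<^sup>2"
      using pos E0 by (intro add_left_mono mult_right_mono add_mono) (auto simp: field_simps)
    finally show ?thesis by simp
  qed
  show "u (s, y) + E * ((norm (x - y))\<^sup>2 - (norm (x - y - k))\<^sup>2) / (2 * \<epsilon>)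
       - (T (\<xi> + z + k) - T \<xi>) - \<alpha> * (loc_pen (\<xi> + z + k) - loc_pen \<xi>) \<le> u (s, y + z + k)"
    if "w (t, x) \<le> w (t, x + z)"
  proof -
    have e: "x + z - (y + z + k) = x - y - k" "y + z + k - (\<xi> + z + k) = y - \<xi>" by simp_all
    show ?thesis
      using max[of t s "x + z" "y + z + k" "\<xi> + z + k"] ts that unfolding penalty_def e E T
      by (simp add: right_diff_distrib diff_divide_distrib)
  qed
  show "(norm (y - \<xi>))\<^sup>2 / 2 + T \<xi> + \<alpha> * loc_pen \<xi> \<le> T y + \<alpha> * loc_pen y"
    using max[of t s x y y] ts unfolding penalty_def T by simp
qed

text \<open>The penalty touches \<open>w\<close> in the variables \<open>(t, x)\<close> and
  \<open>- u\<close> in \<open>(s, y)\<close>; \<xi> is frozen in both, so \<open>S\<close> is not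
  differentiated. The time square has derivative \<open>- b\<close> in \<open>s\<close> but
  \<open>(1 + \<theta> * S \<xi>) * b\<close> in \<open>t\<close>, and this mismatch is the gain.
  The term in \<Lambda> comes from differentiating \<open>exp (\<Lambda> * t)\<close>.\<close>

lemma penalized_max_geo:
  fixes w u :: "real \<times> 'a::euclidean_space \<Rightarrow> real" and t s \<epsilon> \<Lambda> \<eta> \<theta> \<beta> \<alpha> :: real and x y \<xi> :: 'a
  assumes gw: "geo_sub h c \<nu> w" and gu: "geo_sub (\<lambda>p. h (- p)) (\<lambda>x. - c x) \<nu> (\<lambda>q. - u q)"
    and pos: "0 < \<epsilon>" "0 \<le> \<Lambda>" "0 < \<beta>" and ts: "0 < t" "0 < s" and \<delta>: "0 < \<delta>" "\<delta> \<le> 1"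
    and max: "\<And>t' x' s' y' \<xi>'. 0 \<le> t' \<Longrightarrow> 0 \<le> s' \<Longrightarrow> w (t', x') - u (s', y') - penalty \<epsilon> \<Lambda> \<eta> \<theta> S \<beta> \<alpha> t' x' s' y' \<xi>'
       \<le> w (t, x) - u (s, y) - penalty \<epsilon> \<Lambda> \<eta> \<theta> S \<beta> \<alpha> t x s y \<xi>"
    and E: "E = exp (\<Lambda> * t)" and p: "p = (E / \<epsilon>) *\<^sub>R (x - y)" and p': "p' = p - (y - \<xi>)"
    and b: "b = - (s - t - \<theta> * S \<xi> * (1 + t)) / \<beta>"
  shows "\<Lambda> * (E * (norm (x - y))\<^sup>2 / (2 * \<epsilon>)) + \<eta> + (1 + \<theta> * S \<xi>) * b
       \<le> h p * (c x + level_curvature \<nu> \<delta> p {z. w (t, x) \<le> w (t, x + z)})"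
    "- b \<le> h p' * (- c y + level_curvature \<nu> \<delta> (- p') {z. u (s, y + z) \<le> u (s, y)})"
proof -
  have E0: "0 < E" by (simp add: E)
  define e where "e = s - t - \<theta> * S \<xi> * (1 + t)"
  define \<kappa> where "\<kappa> = 1 + \<theta> * S \<xi>"
  define D where "D = x - y"
  have be: "e = - b * \<beta>" using pos by (simp add: b e_def)
  define C1 where "C1 = 1 + \<Lambda> * (2 * norm D + 1) + \<Lambda>\<^sup>2 * (norm D + 1)\<^sup>2"
  define C where "C = E * C1 / (2 * \<epsilon>) + \<kappa>\<^sup>2 / (2 * \<beta>)"
  show "\<Lambda> * (E * (norm (x - y))\<^sup>2 / (2 * \<epsilon>)) + \<eta> + (1 + \<theta> * S \<xi>) * b
       \<le> h p * (c x + level_curvature \<nu> \<delta> p {z. w (t, x) \<le> w (t, x + z)})"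
  proof (rule gw[unfolded geo_sub_def, rule_format, of t "1 / (1 + \<Lambda>)" \<delta> x _ p C], intro conjI ballI impI)
    show "0 < 1 / (1 + \<Lambda>)" using pos by simp
    fix q :: "real \<times> 'a" assume q: "q \<in> spacetime" "dist q (t, x) < 1 / (1 + \<Lambda>)"
    obtain t' x' where qe: "q = (t', x')" by fastforce
    have t': "0 \<le> t'" using q by (simp add: qe)
    define d where "d = dist q (t, x)"
    have d0: "0 \<le> d" by (simp add: d_def)
    have dL: "d * (1 + \<Lambda>) \<le> 1" using q(2) pos by (simp add: d_def field_simps)
    then have "d + \<Lambda> * d \<le> 1" by (simp add: algebra_simps)
    then have d1: "d \<le> 1" "\<Lambda> * d \<le> 1" using d0 mult_nonneg_nonneg[OF pos(2) d0] by linarith+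
    define \<tau> where "\<tau> = t' - t"
    define v where "v = x' - x"
    have v: "\<bar>\<tau>\<bar> \<le> d" "norm v \<le> d"
      using dist_fst_le[of q "(t, x)"] dist_snd_le[of q "(t, x)"] by (auto simp: d_def qe dist_real_def dist_norm \<tau>_def v_def)
    have "exp (\<Lambda> * \<tau>) * (norm (D + v))\<^sup>2 \<le> (norm D)\<^sup>2 + 2 * (D \<bullet> v) + \<Lambda> * \<tau> * (norm D)\<^sup>2 + C1 * d\<^sup>2"
      unfolding C1_def by (rule exp_mult_power2_norm_expansion[OF pos(2) v d1])
    then have "E / (2 * \<epsilon>) * (exp (\<Lambda> * \<tau>) * (norm (D + v))\<^sup>2)
        \<le> E / (2 * \<epsilon>) * ((norm D)\<^sup>2 + 2 * (D \<bullet> v) + \<Lambda> * \<tau> * (norm D)\<^sup>2 + C1 * d\<^sup>2)"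
      using E0 pos by (intro mult_left_mono) auto
    moreover have "E / (2 * \<epsilon>) * (exp (\<Lambda> * \<tau>) * (norm (D + v))\<^sup>2) = exp (\<Lambda> * t') * (norm (x' - y))\<^sup>2 / (2 * \<epsilon>)"
    proof -
      have "E * exp (\<Lambda> * \<tau>) = exp (\<Lambda> * t')" by (simp add: E \<tau>_def exp_add[symmetric] algebra_simps)
      moreover have "D + v = x' - y" by (simp add: D_def v_def)
      ultimately show ?thesis by simp
    qed
    moreover have "E / (2 * \<epsilon>) * ((norm D)\<^sup>2 + 2 * (D \<bullet> v) + \<Lambda> * \<tau> * (norm D)\<^sup>2 + C1 * d\<^sup>2)
      = E * (norm D)\<^sup>2 / (2 * \<epsilon>) + p \<bullet> v + \<Lambda> * (E * (norm D)\<^sup>2 / (2 * \<epsilon>)) * \<tau> + E * C1 / (2 * \<epsilon>) * d\<^sup>2"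
      using pos unfolding p D_def[symmetric] by (simp add: field_simps)
    ultimately have g1: "exp (\<Lambda> * t') * (norm (x' - y))\<^sup>2 / (2 * \<epsilon>) - E * (norm D)\<^sup>2 / (2 * \<epsilon>)
      \<le> p \<bullet> v + \<Lambda> * (E * (norm D)\<^sup>2 / (2 * \<epsilon>)) * \<tau> + E * C1 / (2 * \<epsilon>) * d\<^sup>2" by linarith
    have g2: "(s - t' - \<theta> * S \<xi> * (1 + t'))\<^sup>2 / (2 * \<beta>) - e\<^sup>2 / (2 * \<beta>) \<le> \<kappa> * b * \<tau> + \<kappa>\<^sup>2 / (2 * \<beta>) * d\<^sup>2"
    proof -
      have eq: "s - t' - \<theta> * S \<xi> * (1 + t') = e - \<kappa> * \<tau>" by (simp add: e_def \<kappa>_def \<tau>_def algebra_simps)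
      have "(s - t' - \<theta> * S \<xi> * (1 + t'))\<^sup>2 / (2 * \<beta>) - e\<^sup>2 / (2 * \<beta>) = \<kappa> * b * \<tau> + \<kappa>\<^sup>2 / (2 * \<beta>) * \<tau>\<^sup>2"
        unfolding eq be using pos by (simp add: field_simps power2_eq_square)
      moreover have "\<tau>\<^sup>2 \<le> d\<^sup>2" using power_mono[OF v(1), of 2] by simp
      then have "\<kappa>\<^sup>2 / (2 * \<beta>) * \<tau>\<^sup>2 \<le> \<kappa>\<^sup>2 / (2 * \<beta>) * d\<^sup>2" using pos by (intro mult_left_mono) auto
      ultimately show ?thesis by linarith
    qed
    have "w (t', x') - w (t, x) \<le> penalty \<epsilon> \<Lambda> \<eta> \<theta> S \<beta> \<alpha> t' x' s y \<xi> - penalty \<epsilon> \<Lambda> \<eta> \<theta> S \<beta> \<alpha> t x s y \<xi>"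
      using max[of t' s x' y \<xi>] ts t' by simp
    also have "\<dots> = (exp (\<Lambda> * t') * (norm (x' - y))\<^sup>2 / (2 * \<epsilon>) - E * (norm D)\<^sup>2 / (2 * \<epsilon>)) + \<eta> * \<tau>
       + ((s - t' - \<theta> * S \<xi> * (1 + t'))\<^sup>2 / (2 * \<beta>) - e\<^sup>2 / (2 * \<beta>))"
      by (simp add: penalty_def E D_def e_def \<tau>_def algebra_simps)
    also have "\<dots> \<le> (p \<bullet> v + \<Lambda> * (E * (norm D)\<^sup>2 / (2 * \<epsilon>)) * \<tau> + E * C1 / (2 * \<epsilon>) * d\<^sup>2) + \<eta> * \<tau>
       + (\<kappa> * b * \<tau> + \<kappa>\<^sup>2 / (2 * \<beta>) * d\<^sup>2)" using g1 g2 by (intro add_mono) auto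
    also have "\<dots> = (\<Lambda> * (E * (norm D)\<^sup>2 / (2 * \<epsilon>)) + \<eta> + \<kappa> * b) * \<tau> + p \<bullet> v + C * d\<^sup>2"
      by (simp add: C_def algebra_simps)
    finally show "w q \<le> w (t, x) + (\<Lambda> * (E * (norm (x - y))\<^sup>2 / (2 * \<epsilon>)) + \<eta> + (1 + \<theta> * S \<xi>) * b) * (fst q - t)
        + p \<bullet> (snd q - x) + C * (dist q (t, x))\<^sup>2"
      unfolding D_def[symmetric] \<kappa>_def[symmetric] d_def[symmetric] unfolding qe fst_conv snd_conv \<tau>_def[symmetric] v_def[symmetric] by linarith
  qed (use ts \<delta> in auto)
  define C' where "C' = E / (2 * \<epsilon>) + 1/2 + 1 / (2 * \<beta>)"
  define F where "F = y - \<xi>"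
  have "- b \<le> h (- (- p')) * (- c y + level_curvature \<nu> \<delta> (- p') {z. - u (s, y) \<le> - u (s, y + z)})"
  proof (rule gu[unfolded geo_sub_def, rule_format, of s 1 \<delta> y "- b" "- p'" C'], intro conjI ballI impI)
    fix q :: "real \<times> 'a" assume q: "q \<in> spacetime" "dist q (s, y) < 1"
    obtain s' y' where qe: "q = (s', y')" by fastforce
    have s': "0 \<le> s'" using q by (simp add: qe)
    define \<sigma> where "\<sigma> = s' - s"
    define v where "v = y' - y"
    have d2: "(dist q (s, y))\<^sup>2 = \<sigma>\<^sup>2 + (norm v)\<^sup>2" unfolding qe dist_Pair_Pair by (simp add: dist_real_def dist_norm \<sigma>_def v_def)
    have e1: "x - y' = D - v" "y' - \<xi> = F + v" "s' - t - \<theta> * S \<xi> * (1 + t) = e + \<sigma>"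
      by (simp_all add: D_def F_def v_def \<sigma>_def e_def)
    have "- u (s', y') + u (s, y) \<le> penalty \<epsilon> \<Lambda> \<eta> \<theta> S \<beta> \<alpha> t x s' y' \<xi> - penalty \<epsilon> \<Lambda> \<eta> \<theta> S \<beta> \<alpha> t x s y \<xi>"
      using max[of t s' x y' \<xi>] ts s' by simp
    also have "\<dots> = (E * (norm (D - v))\<^sup>2 / (2 * \<epsilon>) - E * (norm D)\<^sup>2 / (2 * \<epsilon>)) + ((e + \<sigma>)\<^sup>2 / (2 * \<beta>) - e\<^sup>2 / (2 * \<beta>))
       + ((norm (F + v))\<^sup>2 / 2 - (norm F)\<^sup>2 / 2)"
      unfolding penalty_def e1 e_def[symmetric] D_def[symmetric] F_def[symmetric] E[symmetric] by simp
    also have "E * (norm (D - v))\<^sup>2 / (2 * \<epsilon>) - E * (norm D)\<^sup>2 / (2 * \<epsilon>) = - p \<bullet> v + E / (2 * \<epsilon>) * (norm v)\<^sup>2"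
      using pos unfolding power2_norm_diff p D_def[symmetric] by (simp add: field_simps)
    also have "(e + \<sigma>)\<^sup>2 / (2 * \<beta>) - e\<^sup>2 / (2 * \<beta>) = - b * \<sigma> + 1 / (2 * \<beta>) * \<sigma>\<^sup>2"
      using pos unfolding be by (simp add: field_simps power2_eq_square)
    also have "(norm (F + v))\<^sup>2 / 2 - (norm F)\<^sup>2 / 2 = F \<bullet> v + 1/2 * (norm v)\<^sup>2" unfolding power2_norm_add by (simp add: field_simps)
    also have "- p \<bullet> v + E / (2 * \<epsilon>) * (norm v)\<^sup>2 + (- b * \<sigma> + 1 / (2 * \<beta>) * \<sigma>\<^sup>2) + (F \<bullet> v + 1/2 * (norm v)\<^sup>2)
      = - b * \<sigma> + - p' \<bullet> v + ((E / (2 * \<epsilon>) + 1/2) * (norm v)\<^sup>2 + 1 / (2 * \<beta>) * \<sigma>\<^sup>2)"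
      unfolding p' F_def[symmetric] by (simp add: inner_diff_left algebra_simps)
    also have "(E / (2 * \<epsilon>) + 1/2) * (norm v)\<^sup>2 + 1 / (2 * \<beta>) * \<sigma>\<^sup>2 \<le> C' * (norm v)\<^sup>2 + C' * \<sigma>\<^sup>2"
      using pos E0 by (intro add_mono mult_right_mono) (auto simp: C'_def)
    also have "C' * (norm v)\<^sup>2 + C' * \<sigma>\<^sup>2 = C' * (dist q (s, y))\<^sup>2" by (simp add: d2 algebra_simps)
    finally show "- u q \<le> - u (s, y) + - b * (fst q - s) + - p' \<bullet> (snd q - y) + C' * (dist q (s, y))\<^sup>2"
      by (simp add: qe \<sigma>_def v_def)
  qed (use ts \<delta> in auto)
  then show "- b \<le> h p' * (- c y + level_curvature \<nu> \<delta> (- p') {z. u (s, y + z) \<le> u (s, y)})" by simp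
qed

section \<open>Comparison of signs\<close>

lemma homogeneous_bound:
  fixes h :: "'a::euclidean_space \<Rightarrow> real"
  assumes h: "continuous_on UNIV h" "\<And>l p. 0 < l \<Longrightarrow> h (l *\<^sub>R p) = l * h p" "h 0 = 0" "\<And>p. p \<noteq> 0 \<Longrightarrow> 0 < h p"
  obtains H where "0 < H" "\<And>p. 0 \<le> h p \<and> h p \<le> H * norm p"
proof -
  have "compact (h ` sphere 0 1)"
    by (intro compact_continuous_image continuous_on_subset[OF h(1)]) auto
  then have "bounded (h ` sphere 0 1)" by (rule compact_imp_bounded)
  then obtain B where B: "\<forall>y\<in>h ` sphere 0 1. norm y \<le> B" unfolding bounded_iff by blast
  define H where "H = \<bar>B\<bar> + 1"
  have "h p \<le> H * norm p" for p
  proof (cases "p = 0")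
    case False
    have "h (sgn p) \<in> h ` sphere 0 1" using False by (intro imageI) (simp add: norm_sgn)
    then have "norm (h (sgn p)) \<le> B" using B by blast
    then have "h (sgn p) \<le> H" by (simp add: H_def)
    moreover have "h p = norm p * h (sgn p)" using h(2)[of "norm p" "sgn p"] False by (simp add: sgn_div_norm)
    moreover have "norm p * h (sgn p) \<le> norm p * H" using \<open>h (sgn p) \<le> H\<close> by (intro mult_left_mono) auto
    ultimately show ?thesis by (simp add: mult.commute)
  qed (simp add: h(3))
  moreover have "0 \<le> h p" for p using h(3,4) by (cases "p = 0") (auto simp: less_imp_le)
  ultimately show ?thesis by (intro that[of H]) (auto simp: H_def)
qed

text \<open>By homogeneity one may normalise \<open>norm p = 1\<close>; on the unit sphere
  \<open>h\<close> has a positive minimum, so its uniform continuity gives a relative bound. The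
  factors \<open>1 + \<theta>\<close> and \<open>1 - \<theta>\<close> are those produced by the time
  square of the penalty.\<close>

lemma homogeneous_ratio:
  fixes h :: "'a::euclidean_space \<Rightarrow> real"
  assumes h: "continuous_on UNIV h" "\<And>l p. 0 < l \<Longrightarrow> h (l *\<^sub>R p) = l * h p" "h 0 = 0" "\<And>p. p \<noteq> 0 \<Longrightarrow> 0 < h p"
    and \<theta>: "0 < \<theta>" "\<theta> \<le> 1"
  obtains \<kappa> where "0 < \<kappa>" "\<And>p p'. norm (p - p') \<le> \<kappa> * norm p \<Longrightarrow> h p \<le> (1 + \<theta>) * h p' \<and> (1 - \<theta>) * h p' \<le> h p"
proof -
  obtain b :: 'a where b: "b \<in> Basis" using nonempty_Basis by blast
  have ne: "sphere (0::'a) 1 \<noteq> {}" using b norm_Basis by force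
  obtain e0 where e0: "e0 \<in> sphere 0 1" "\<And>e. e \<in> sphere 0 1 \<Longrightarrow> h e0 \<le> h e"
    using continuous_attains_inf[OF _ ne continuous_on_subset[OF h(1)]] by auto
  define m where "m = h e0"
  have "e0 \<noteq> 0" using e0(1) by auto
  then have m: "0 < m" unfolding m_def by (rule h(4))
  define d where "d = \<theta> * m / 2"
  have d: "0 < d" using \<theta> m by (simp add: d_def)
  have "uniformly_continuous_on (cball 0 2) h"
    by (rule compact_uniformly_continuous[OF continuous_on_subset[OF h(1)]]) auto
  then obtain k where k: "0 < k" "\<And>e e'. e \<in> cball 0 2 \<Longrightarrow> e' \<in> cball 0 2 \<Longrightarrow> dist e' e < k \<Longrightarrow> dist (h e') (h e) < d"
    using d unfolding uniformly_continuous_on_def by blast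
  define \<kappa> where "\<kappa> = min 1 (k/2)"
  show ?thesis
  proof (rule that)
    show "0 < \<kappa>" using k by (simp add: \<kappa>_def)
    fix p p' :: 'a assume pp: "norm (p - p') \<le> \<kappa> * norm p"
    show "h p \<le> (1 + \<theta>) * h p' \<and> (1 - \<theta>) * h p' \<le> h p"
    proof (cases "p = 0")
      case True
      then have "p' = 0" using pp by simp
      then show ?thesis using True h(3) by simp
    next
      case False
      define n where "n = norm p"
      have n: "0 < n" using False by (simp add: n_def)
      define e where "e = (1/n) *\<^sub>R p"
      define e' where "e' = (1/n) *\<^sub>R p'"
      have hs: "h e = h p / n" "h e' = h p' / n"
        using h(2)[of "1/n" p] h(2)[of "1/n" p'] n by (simp_all add: e_def e'_def)
      have e: "norm e = 1" using n by (simp add: e_def n_def)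
      have "norm (e - e') = norm (p - p') / n" using n by (simp add: e_def e'_def scaleR_diff_right[symmetric])
      also have "\<dots> \<le> \<kappa>" using pp n by (simp add: n_def divide_le_eq)
      finally have ee: "norm (e - e') \<le> \<kappa>" .
      have "norm e' \<le> norm e + norm (e - e')" using norm_triangle_ineq4[of e "e - e'"] by simp
      then have "norm e' \<le> 2" using e ee by (simp add: \<kappa>_def)
      moreover have "dist e' e < k" using ee k(1) by (simp add: \<kappa>_def dist_norm norm_minus_commute)
      ultimately have "dist (h e') (h e) < d" using e by (intro k(2)) auto
      then have de: "\<bar>h e' - h e\<bar> < d" by (simp add: dist_real_def)
      have "m \<le> h e" unfolding m_def using e by (intro e0(2)) simp
      then have "m - d \<le> h e'" using de by linarith
      moreover have "d \<le> m / 2" using \<theta> m by (simp add: d_def)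
      ultimately have "m / 2 \<le> h e'" by linarith
      then have "\<theta> * (m / 2) \<le> \<theta> * h e'" using \<theta> by (intro mult_left_mono) auto
      then have "d \<le> \<theta> * h e'" by (simp add: d_def)
      then have "h e \<le> (1 + \<theta>) * h e'" "(1 - \<theta>) * h e' \<le> h e" using de by (auto simp: algebra_simps)
      then have "n * h e \<le> n * ((1 + \<theta>) * h e')" "n * ((1 - \<theta>) * h e') \<le> n * h e"
        using n by (auto intro: mult_left_mono)
      moreover have "n * h e = h p" "n * h e' = h p'" using hs n by auto
      ultimately show ?thesis by (metis mult.left_commute)
    qed
  qed
qed

text \<open>On the compact set where \<open>u \<le> - e\<close>, \<open>f\<close> is at most some
  negative \<open>- d\<close>, and a large \<open>k\<close> pushes the changed unknown below
  \<open>- M\<close>. Elsewhere in the ball it is negative, hence below \<open>u + e\<close>. The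
  condition \<open>exp (- k) \<le> e\<close> keeps it near 0 where \<open>f\<close> is
  nonnegative.\<close>

lemma exponential_change_below:
  fixes f u :: "'a::euclidean_space \<Rightarrow> real"
  assumes f: "continuous_on UNIV f" and u: "continuous_on UNIV u" "\<And>x. - M \<le> u x"
    and init: "\<And>x. u x < 0 \<Longrightarrow> f x < 0" and e: "0 < e" and M: "0 \<le> M"
  obtains k where "0 < k" "exp (- k) \<le> e" "\<And>x. norm x \<le> R \<Longrightarrow> - exp (- k * (k * f x + 1)) \<le> u x + e"
proof -
  define K where "K = cball 0 R \<inter> {x. u x \<le> - e}"
  have "closed {x. u x \<le> - e}" using closed_Collect_le[OF u(1) continuous_on_const] by simp
  then have K: "compact K" unfolding K_def by (intro compact_Int_closed) auto
  obtain d where d: "0 < d" "\<And>x. x \<in> K \<Longrightarrow> f x \<le> - d"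
  proof (cases "K = {}")
    case False
    obtain x0 where x0: "x0 \<in> K" "\<And>x. x \<in> K \<Longrightarrow> f x \<le> f x0"
      using continuous_attains_sup[OF K False continuous_on_subset[OF f]] by auto
    have "u x0 < 0" using x0(1) e by (simp add: K_def)
    then have "f x0 < 0" by (rule init)
    then show ?thesis using x0(2) by (intro that[of "- f x0"]) auto
  qed (auto intro: that[of 1])
  define k where "k = max (max 1 (1/e)) ((M + 1) / d)"
  have k: "1 \<le> k" "1/e \<le> k" "(M + 1) / d \<le> k" by (auto simp: k_def)
  show ?thesis
  proof (rule that)
    show "0 < k" using k by simp
    have "exp (- k) = 1 / exp k" by (simp add: exp_minus inverse_eq_divide)
    also have "\<dots> \<le> 1 / k"
    proof -
      have "k \<le> exp k" using exp_ge_add_one_self[of k] by linarith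
      then show ?thesis using k(1) by (intro divide_left_mono) auto
    qed
    also have "\<dots> \<le> e" using k e by (simp add: divide_le_eq mult.commute)
    finally show "exp (- k) \<le> e" .
    fix x :: 'a assume x: "norm x \<le> R"
    show "- exp (- k * (k * f x + 1)) \<le> u x + e"
    proof (cases "x \<in> K")
      case True
      have "M + 1 \<le> k * d" using k(3) d(1) by (simp add: divide_le_eq)
      moreover have "k * d \<le> k * (- f x)" using d(2)[OF True] k by (intro mult_left_mono) auto
      ultimately have 1: "M \<le> - (k * f x + 1)" by simp
      then have "M * 1 \<le> - (k * f x + 1) * k" using k M by (intro mult_mono) auto
      then have "M \<le> - k * (k * f x + 1)" by (simp add: algebra_simps)
      also have "\<dots> \<le> exp (- k * (k * f x + 1))" using exp_ge_add_one_self[of "- k * (k * f x + 1)"] by linarith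
      finally show ?thesis using u(2)[of x] e by linarith
    next
      case False
      then have "- e < u x" using x by (simp add: K_def)
      then show ?thesis using exp_gt_zero[of "- k * (k * f x + 1)"] by linarith
    qed
  qed
qed

text \<open>The smallness conditions on \<theta> and on \<alpha> are all brought into this form, so
  that each parameter is chosen once for a whole list.\<close>

lemma eventually_small_mult: "0 < b \<Longrightarrow> \<forall>\<^sub>F \<theta> in at_right (0::real). \<theta> * a \<le> b"
proof -
  assume b: "0 < b"
  have "((\<lambda>\<theta>. \<theta> * a) \<longlongrightarrow> 0 * a) (at_right 0)" by (intro tendsto_intros)
  then have "\<forall>\<^sub>F \<theta> in at_right 0. \<theta> * a < b" using b by (intro order_tendstoD(2)) auto
  then show ?thesis by eventually_elim simp
qed

lemma clamp_lipschitz: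
  assumes c: "\<And>x y :: 'a::real_normed_vector. \<bar>c x - c y\<bar> \<le> L * norm (x - y)" and N: "0 < N" "L \<le> l * N"
  shows "\<bar>max (-1) (min 1 (c x / N)) - max (-1) (min 1 (c y / N))\<bar> \<le> l * norm (x - y)"
proof -
  have "\<bar>max (-1) (min 1 a) - max (-1) (min 1 b)\<bar> \<le> \<bar>a - b\<bar>" for a b :: real by (auto simp: max_def min_def)
  then have "\<bar>max (-1) (min 1 (c x / N)) - max (-1) (min 1 (c y / N))\<bar> \<le> \<bar>c x / N - c y / N\<bar>" .
  also have "\<dots> = \<bar>c x - c y\<bar> / N" using N by (simp add: diff_divide_distrib[symmetric])
  also have "\<dots> \<le> l * norm (x - y)"
  proof -
    have "\<bar>c x - c y\<bar> \<le> (l * N) * norm (x - y)"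
      using c[of x y] mult_right_mono[OF N(2) norm_ge_zero[of "x - y"]] by linarith
    then show ?thesis using N by (simp add: divide_le_eq mult_ac)
  qed
  finally show ?thesis .
qed

context singular_measure
begin

text \<open>If \<open>f (ta, xa)\<close> were nonnegative, the changed unknown \<open>w\<close>
  would be close to 0 at that point and exceed \<open>u\<close> by almost
  \<open>- u (ta, xa)\<close>, although initially, on a large ball, it exceeds \<open>u\<close> by
  at most a small fraction of this.\<close>

lemma sign_comparison:
  fixes f u :: "real \<times> 'a \<Rightarrow> real" and h c :: "'a \<Rightarrow> real"
  assumes h: "continuous_on UNIV h" "\<And>l p. 0 < l \<Longrightarrow> h (l *\<^sub>R p) = l * h p" "h 0 = 0" "\<And>p. p \<noteq> 0 \<Longrightarrow> 0 < h p"
    and lip: "0 \<le> L" "\<And>x y. \<bar>c x - c y\<bar> \<le> L * norm (x - y)"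
    and f: "continuous_on spacetime f" "geo_sub h c \<nu> f"
    and u: "continuous_on spacetime u" "geo_sub (\<lambda>p. h (- p)) (\<lambda>x. - c x) \<nu> (\<lambda>q. - u q)"
    and M: "0 < M" "\<And>q. q \<in> spacetime \<Longrightarrow> \<bar>u q\<bar> \<le> M"
    and lip0: "0 \<le> L0" "\<And>x y. \<bar>u (0, x) - u (0, y)\<bar> \<le> L0 * norm (x - y)"
    and init: "\<And>x. u (0, x) < 0 \<Longrightarrow> f (0, x) < 0"
    and ta: "0 < ta" and neg: "u (ta, xa) < 0"
  shows "f (ta, xa) < 0"
proof (rule ccontr)
  assume "\<not> f (ta, xa) < 0"
  then have fa: "0 \<le> f (ta, xa)" by simp
  define \<sigma> where "\<sigma> = - u (ta, xa)"
  have \<sigma>: "0 < \<sigma>" using neg by (simp add: \<sigma>_def)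
  obtain H where H: "0 < H" and hb: "\<And>p. 0 \<le> h p \<and> h p \<le> H * norm p" using homogeneous_bound[OF h] by blast
  \<comment> \<open>\<eta> is the strictness to be contradicted: errors in the differential
    inequalities are measured against it, those at the initial time and at the starting point
    against \<sigma>. As the penalty is at most \<open>M\<close> at the maximum,
    \<open>t \<le> T\<close> there.\<close>
  define \<eta> where "\<eta> = \<sigma> / (8 * (1 + ta))"
  have \<eta>: "0 < \<eta>" "\<eta> * ta \<le> \<sigma>/8" using \<sigma> ta by (auto simp: \<eta>_def field_simps)
  define T where "T = M / \<eta>"
  have T: "0 < T" using M \<eta> by (simp add: T_def)
  \<comment> \<open>With this value the term from \<open>exp (\<Lambda> * t)\<close> equals
    \<open>H * norm p * (L * norm (x - y))\<close>, the cost of replacing \<open>c x\<close> by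
    \<open>c y\<close>.\<close>
  define \<Lambda> where "\<Lambda> = 2 * H * L"
  have \<Lambda>: "0 \<le> \<Lambda>" using H lip by (simp add: \<Lambda>_def)
  define \<Gamma> where "\<Gamma> = exp (\<Lambda> * T)"
  have \<Gamma>: "1 \<le> \<Gamma>" using \<Lambda> T by (simp add: \<Gamma>_def)
  define rm where "rm = \<sigma> / (16 * (L0 + 1))"
  have rm: "0 < rm" "L0 * rm \<le> \<sigma>/16"
  proof -
    show "0 < rm" using \<sigma> lip0 by (simp add: rm_def)
    have "L0 * rm \<le> (L0 + 1) * rm" using \<open>0 < rm\<close> by (intro mult_right_mono) auto
    also have "\<dots> = \<sigma>/16" using lip0 by (simp add: rm_def field_simps)
    finally show "L0 * rm \<le> \<sigma>/16" .
  qed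
  \<comment> \<open>A penalty of at most \<open>M\<close> then forces
    \<open>norm (x - y) \<le> rm\<close>, and over this distance the initial datum of
    \<open>u\<close> varies by at most \<open>\<sigma>/16\<close>.\<close>
  define \<epsilon> where "\<epsilon> = rm\<^sup>2 / (2 * M)"
  have \<epsilon>: "0 < \<epsilon>" "2 * \<epsilon> * M = rm\<^sup>2" using rm M by (auto simp: \<epsilon>_def)
  define \<rho> where "\<rho> = sqrt (2 * M)"
  have \<rho>: "0 < \<rho>" "\<rho>\<^sup>2 = 2 * M" using M by (auto simp: \<rho>_def)
  define P where "P = \<Gamma> * rm / \<epsilon> + \<rho>"
  have P: "0 < P" using \<Gamma> rm \<epsilon> \<rho> by (simp add: P_def add_nonneg_pos)
  define C where "C = \<Gamma> / \<epsilon> + 1"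
  have C: "0 \<le> C" using \<Gamma> \<epsilon> by (simp add: C_def)
  have H0: "0 \<le> H" and P0: "0 \<le> P" and \<eta>4: "0 < \<eta>/4" using H P \<eta> by auto
  obtain \<delta> p1 \<zeta> k0 R V where nl: "0 < \<delta>" "\<delta> \<le> 1" "0 < p1" "0 < \<zeta>" "0 < k0" "0 < R" "0 \<le> V"
    and nl_sum: "\<And>p p' A B. A \<in> sets borel \<Longrightarrow> B \<in> sets borel \<Longrightarrow> norm p \<le> P \<Longrightarrow> norm p' \<le> P \<Longrightarrow> norm (p - p') \<le> \<zeta> \<Longrightarrow>
       (\<And>z. z \<in> A \<Longrightarrow> 0 \<le> p \<bullet> z + C * (norm z)\<^sup>2) \<Longrightarrow> (\<And>z. z \<in> B \<Longrightarrow> 0 \<le> - p' \<bullet> z + C * (norm z)\<^sup>2) \<Longrightarrow>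
       (p1 \<le> norm p \<Longrightarrow> \<exists>k. norm k \<le> k0 \<and> (\<forall>z\<in>A. norm z < R \<longrightarrow> z + k \<notin> B)) \<Longrightarrow>
       h p * level_curvature \<nu> \<delta> p A + h p' * level_curvature \<nu> \<delta> (- p') B \<le> \<eta>/4"
    and nl_abs: "\<And>p y A. A \<in> sets borel \<Longrightarrow> norm p \<le> P \<Longrightarrow> 0 \<le> y \<Longrightarrow> y \<le> H * norm p \<Longrightarrow>
       (\<And>z. z \<in> A \<Longrightarrow> 0 \<le> p \<bullet> z + C * (norm z)\<^sup>2) \<Longrightarrow> \<bar>y * level_curvature \<nu> \<delta> p A\<bar> \<le> V"
  proof (rule nonlocal_estimate[OF h(1) conjunct1[OF hb] conjunct2[OF hb] H0 P0 C \<eta>4])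
    fix \<delta> p1 \<zeta> k0 R V :: real
    assume a: "0 < \<delta>" "\<delta> \<le> 1" "0 < p1" "0 < \<zeta>" "0 < k0" "0 < R" "0 \<le> V"
    and b: "\<And>p p' A B. A \<in> sets borel \<Longrightarrow> B \<in> sets borel \<Longrightarrow> norm p \<le> P \<Longrightarrow> norm p' \<le> P \<Longrightarrow> norm (p - p') \<le> \<zeta> \<Longrightarrow>
       (\<And>z. z \<in> A \<Longrightarrow> 0 \<le> p \<bullet> z + C * (norm z)\<^sup>2) \<Longrightarrow> (\<And>z. z \<in> B \<Longrightarrow> 0 \<le> - p' \<bullet> z + C * (norm z)\<^sup>2) \<Longrightarrow>
       (p1 \<le> norm p \<Longrightarrow> \<exists>k. norm k \<le> k0 \<and> (\<forall>z\<in>A. norm z < R \<longrightarrow> z + k \<notin> B)) \<Longrightarrow>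
       h p * level_curvature \<nu> \<delta> p A + h p' * level_curvature \<nu> \<delta> (- p') B \<le> \<eta>/4"
    and c: "\<And>p y A. A \<in> sets borel \<Longrightarrow> norm p \<le> P \<Longrightarrow> 0 \<le> y \<Longrightarrow> y \<le> H * norm p \<Longrightarrow>
       (\<And>z. z \<in> A \<Longrightarrow> 0 \<le> p \<bullet> z + C * (norm z)\<^sup>2) \<Longrightarrow> \<bar>y * level_curvature \<nu> \<delta> p A\<bar> \<le> V"
    show thesis by (rule that) (fact a b c)+
  qed
  \<comment> \<open>Order of choice: \<open>\<epsilon>\<close>, then \<open>\<delta>\<close> and the scales of the nonlocal estimate, then \<open>gap\<close>, the
    strict separation gained by translating by \<open>lam *\<^sub>R (x - y)\<close>, then the width \<open>N\<close> of the
    transition of \<open>S\<close>, then \<open>\<theta>\<close> and \<open>\<beta>\<close>, then \<open>\<alpha>\<close>, and \<open>k\<close> last.\<close>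
  define lam where "lam = min 1 (k0 / rm)"
  have lam: "0 < lam" "lam \<le> 1" "lam * rm \<le> k0"
    using nl(5) rm by (auto simp: lam_def min_def field_simps)
  \<comment> \<open>A lower bound for \<open>norm (x - y)\<close> when
    \<open>p1 \<le> norm p\<close>; \<open>gap\<close> is what the shift then saves in the quadratic
    penalty.\<close>
  define r1 where "r1 = \<epsilon> * p1 / \<Gamma>"
  have r1: "0 < r1" using \<epsilon> nl \<Gamma> by (simp add: r1_def)
  define gap where "gap = lam * r1\<^sup>2 / (2 * \<epsilon>)"
  have gap: "0 < gap" using lam r1 \<epsilon> by (simp add: gap_def)
  define R' where "R' = R + rm"
  have R': "0 < R'" using nl rm by (simp add: R'_def)
  define G where "G = 4 * M * (1 + T)\<^sup>2"
  have G: "0 < G" using M T by (simp add: G_def)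
  \<comment> \<open>Moving \<xi> by \<open>n\<close> changes the time square by a linear term and by
    at most \<open>G * l\<^sup>2 * n\<^sup>2\<close>. The linear term will carry a factor \<theta>;
    the quadratic one will not, because \<beta> is proportional to \<open>\<theta>\<^sup>2\<close>,
    and has to be made small by the slope \<open>l\<close> of \<open>S\<close>, that is, by a wide
    transition.\<close>
  define l where "l = sqrt (min (1/8) (gap / (4 * R'\<^sup>2)) / G)"
  have l: "0 < l" "G * l\<^sup>2 \<le> 1/8" "G * l\<^sup>2 * R'\<^sup>2 \<le> gap/4"
  proof -
    have m: "0 < min (1/8) (gap / (4 * R'\<^sup>2)) / G" using gap R' G by simp
    then show "0 < l" by (simp add: l_def)
    have "l\<^sup>2 = min (1/8) (gap / (4 * R'\<^sup>2)) / G" unfolding l_def by (rule real_sqrt_pow2) (use m in simp)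
    then have Gl: "G * l\<^sup>2 = min (1/8) (gap / (4 * R'\<^sup>2))" using G by simp
    then show "G * l\<^sup>2 \<le> 1/8" by simp
    have "G * l\<^sup>2 * R'\<^sup>2 \<le> gap / (4 * R'\<^sup>2) * R'\<^sup>2" unfolding Gl by (intro mult_right_mono) auto
    then show "G * l\<^sup>2 * R'\<^sup>2 \<le> gap/4" using R' by simp
  qed
  define N where "N = (L + 1) / l"
  have N: "0 < N" "L \<le> l * N" using lip l by (auto simp: N_def)
  define S where "S \<xi> = max (-1) (min 1 (c \<xi> / N))" for \<xi>
  have Slip: "\<bar>S x - S y\<bar> \<le> l * norm (x - y)" for x y unfolding S_def by (rule clamp_lipschitz[OF lip(2) N])
  have S1: "\<bar>S x\<bar> \<le> 1" for x by (auto simp: S_def)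
  have Spos: "S x = 1" if "N \<le> c x" for x using that N by (simp add: S_def)
  have Sneg: "S x = -1" if "c x \<le> - N" for x
  proof -
    have "c x / N \<le> -1" using that N by (simp add: divide_le_eq)
    then show ?thesis by (simp add: S_def)
  qed
  have contc: "continuous_on UNIV c"
  proof (rule lipschitz_on_continuous_on)
    show "L-lipschitz_on UNIV c" using lip by (auto intro!: lipschitz_onI simp: dist_real_def dist_norm)
  qed
  have contS: "continuous_on UNIV S" unfolding S_def using N by (intro continuous_intros contc) auto
  \<comment> \<open>If \<open>\<bar>c y\<bar>\<close> exceeds \<open>N2\<close>, then
    \<open>S\<close> is constantly 1 or constantly -1 within distance \<open>\<rho> + R'\<close> of
    \<open>y\<close>, in particular at \<xi>.\<close>
  define N2 where "N2 = N + L * (\<rho> + R')"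
  have N2: "N \<le> N2" "0 < N2" using N lip \<rho> R' by (auto simp: N2_def add_pos_nonneg)
  \<comment> \<open>Bounds \<open>\<bar>b\<bar>\<close> where
    \<open>\<bar>c y\<bar> \<le> N2\<close>; the factor 2 makes up for
    \<open>1/2 \<le> 1 + \<theta> * S \<xi>\<close>.\<close>
  define Cb where "Cb = 2 * (H * P * N2 + V)"
  have Cb: "0 \<le> Cb" using H P N2 nl by (simp add: Cb_def)
  \<comment> \<open>The barrier asks for a quadratic bound on the initial data. Near its centre this
    comes from the Lipschitz bound by Young's inequality; for \<open>w\<close>, at distance at least
    1, from \<open>M \<le> B0\<close>.\<close>
  define B0 where "B0 = M + 4 * L0\<^sup>2 / \<sigma>"
  have B0: "0 < B0" "M \<le> B0" using M \<sigma> by (auto simp: B0_def add_pos_nonneg)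
  have young: "L0 * r \<le> \<sigma>/16 + B0 * r\<^sup>2" for r
  proof -
    have "0 \<le> (\<sigma>/4 - 2 * L0 * r)\<^sup>2 / \<sigma>" using \<sigma> by simp
    also have "\<dots> = \<sigma>/16 - L0 * r + 4 * L0\<^sup>2 / \<sigma> * r\<^sup>2" using \<sigma> by (simp add: field_simps power2_eq_square)
    also have "\<dots> \<le> \<sigma>/16 - L0 * r + B0 * r\<^sup>2" using M by (intro add_left_mono mult_right_mono) (auto simp: B0_def)
    finally show ?thesis by simp
  qed
  define rb where "rb = sqrt (2 * M / B0)"
  have rb: "0 \<le> rb" using M B0 by (simp add: rb_def)
  define Nb where "Nb = N2 + L * (rm + rb)"
  have Nb: "0 \<le> Nb" using N2 lip rm rb by (simp add: Nb_def)
  have M2: "0 \<le> 2 * M" using M by simp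
  obtain K where K: "0 \<le> K"
    "\<And>h c f xb A t. (\<And>p. 0 \<le> h p \<and> h p \<le> H * norm p) \<Longrightarrow> geo_sub h c \<nu> f \<Longrightarrow> continuous_on spacetime f \<Longrightarrow>
       (\<And>q. q \<in> spacetime \<Longrightarrow> f q \<le> A + 2 * M) \<Longrightarrow> (\<And>x. f (0, x) \<le> A + B0 * (norm (x - xb))\<^sup>2) \<Longrightarrow>
       (\<And>x. B0 * (norm (x - xb))\<^sup>2 \<le> 2 * M \<Longrightarrow> c x \<le> Nb) \<Longrightarrow> 0 \<le> t \<Longrightarrow> f (t, xb) \<le> A + K * t"
  proof (rule barrier[OF H0 B0(1) M2 Nb])
    fix K :: real assume a: "0 \<le> K" and b:
    "\<And>h c f xb A t. (\<And>p. 0 \<le> h p \<and> h p \<le> H * norm p) \<Longrightarrow> geo_sub h c \<nu> f \<Longrightarrow> continuous_on spacetime f \<Longrightarrow>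
       (\<And>q. q \<in> spacetime \<Longrightarrow> f q \<le> A + 2 * M) \<Longrightarrow> (\<And>x. f (0, x) \<le> A + B0 * (norm (x - xb))\<^sup>2) \<Longrightarrow>
       (\<And>x. B0 * (norm (x - xb))\<^sup>2 \<le> 2 * M \<Longrightarrow> c x \<le> Nb) \<Longrightarrow> 0 \<le> t \<Longrightarrow> f (t, xb) \<le> A + K * t"
    show thesis by (rule that) (fact a b)+
  qed
  have "uniformly_continuous_on (cball 0 P) h"
    by (rule compact_uniformly_continuous[OF continuous_on_subset[OF h(1)]]) auto
  moreover have "0 < \<eta> / (8 * N2)" using \<eta> N2 by simp
  ultimately obtain \<zeta>2 where \<zeta>2: "0 < \<zeta>2"
    "\<And>p p'. p \<in> cball 0 P \<Longrightarrow> p' \<in> cball 0 P \<Longrightarrow> dist p' p < \<zeta>2 \<Longrightarrow> dist (h p') (h p) < \<eta> / (8 * N2)"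
    unfolding uniformly_continuous_on_def by blast
  define \<zeta>0 where "\<zeta>0 = min \<zeta> (\<zeta>2/2)"
  have \<zeta>0: "0 < \<zeta>0" "\<zeta>0 \<le> \<zeta>" "\<zeta>0 < \<zeta>2" using nl(4) \<zeta>2(1) by (auto simp: \<zeta>0_def)
  obtain d0 where d0: "0 < d0" "\<And>q. q \<in> spacetime \<Longrightarrow> dist q (ta, xa) < d0 \<Longrightarrow> dist (u q) (u (ta, xa)) < \<sigma>/8"
    using u(1)[unfolded continuous_on_iff, rule_format, of "(ta, xa)" "\<sigma>/8"] ta \<sigma> by auto
  \<comment> \<open>In this order: \<open>1 + \<theta> * S \<xi>\<close> stays above 1/2, the time
    \<open>sa\<close> is admissible and close to \<open>ta\<close>, the linear change of the time
    square is below the gap, \<open>p'\<close> is close to \<open>p\<close>, the change of speed is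
    harmless for moderate \<open>c\<close> and in the curvature term, and the barriers are low up to
    time \<open>3 * \<theta>\<close>.\<close>
  have "\<forall>\<^sub>F \<theta> in at_right (0::real). 0 < \<theta> \<and> \<theta> * 1 \<le> 1/2 \<and> \<theta> * (1 + ta) \<le> min ta (d0/2) \<and>
      \<theta> * (Cb * (1 + T) * l * R') \<le> gap/4 \<and> \<theta> * (8 * (Cb * (1 + T) * l)) \<le> \<zeta>0 \<and> \<theta> * Cb \<le> \<eta>/8 \<and>
      \<theta> * V \<le> \<eta>/8 \<and> \<theta> * (3 * K) \<le> \<sigma>/16"
    by (intro eventually_conj eventually_small_mult eventually_at_right_less)
       (use ta d0 gap \<zeta>0 \<eta> \<sigma> in auto)
  then obtain \<theta> where \<theta>: "0 < \<theta>" "\<theta> * 1 \<le> 1/2" "\<theta> * (1 + ta) \<le> min ta (d0/2)"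
      "\<theta> * (Cb * (1 + T) * l * R') \<le> gap/4" "\<theta> * (8 * (Cb * (1 + T) * l)) \<le> \<zeta>0" "\<theta> * Cb \<le> \<eta>/8"
      "\<theta> * V \<le> \<eta>/8" "\<theta> * (3 * K) \<le> \<sigma>/16"
    using eventually_happens'[OF trivial_limit_at_right_real] by blast
  have \<theta>01: "0 \<le> \<theta>" "\<theta> \<le> 1" using \<theta>(1,2) by auto
  obtain \<kappa> where \<kappa>: "0 < \<kappa>" "\<And>p p'. norm (p - p') \<le> \<kappa> * norm p \<Longrightarrow> h p \<le> (1 + \<theta>) * h p' \<and> (1 - \<theta>) * h p' \<le> h p"
    using homogeneous_ratio[OF h \<theta>(1) \<theta>01(2)] by blast
  \<comment> \<open>Then \<open>\<bar>s - t - \<theta> * S \<xi> * (1 + t)\<bar> \<le>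
    \<theta>/2\<close> at the maximum, half of the offset that is present where \<open>S\<close> is
    1 or -1.\<close>
  define \<beta> where "\<beta> = \<theta>\<^sup>2 / (8 * M)"
  have \<beta>: "0 < \<beta>" "2 * \<beta> * M = (\<theta>/2)\<^sup>2" using \<theta> M by (auto simp: \<beta>_def power_divide)
  define cc where "cc = H * (1 + 1/\<kappa>) * (\<bar>c 0\<bar> + 2 * L) * 8"
  have "\<forall>\<^sub>F \<alpha> in at_right (0::real). 0 < \<alpha> \<and> \<alpha> * 1 \<le> 1/4 \<and> \<alpha> * loc_pen xa \<le> \<sigma>/16 \<and>
      \<alpha> * (R' + R'\<^sup>2) \<le> gap/8 \<and> \<alpha> * 8 \<le> \<zeta>0 \<and> \<alpha> * cc \<le> \<eta>/8"
    by (intro eventually_conj eventually_small_mult eventually_at_right_less)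
       (use gap \<zeta>0 \<eta> \<sigma> in auto)
  then obtain \<alpha> where \<alpha>: "0 < \<alpha>" "\<alpha> * 1 \<le> 1/4" "\<alpha> * loc_pen xa \<le> \<sigma>/16"
      "\<alpha> * (R' + R'\<^sup>2) \<le> gap/8" "\<alpha> * 8 \<le> \<zeta>0" "\<alpha> * cc \<le> \<eta>/8"
    using eventually_happens'[OF trivial_limit_at_right_real] by blast
  \<comment> \<open>Bounds for \<xi>, \<open>y\<close> and \<open>x\<close> in succession, and room
    for the unit ball around \<open>x\<close> in the barrier argument.\<close>
  define Rk where "Rk = exp (M / \<alpha>) + \<rho> + rm + 1"
  have contf0: "continuous_on UNIV (\<lambda>x. f (0, x))"
    by (rule continuous_on_compose2[OF f(1)]) (auto intro!: continuous_intros)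
  have contu0: "continuous_on UNIV (\<lambda>x. u (0, x))"
    by (rule continuous_on_compose2[OF u(1)]) (auto intro!: continuous_intros)
  have uM: "- M \<le> u q" "u q \<le> M" if "q \<in> spacetime" for q using M(2)[OF that] by auto
  have u0M: "- M \<le> u (0, x)" for x by (rule uM) auto
  have \<sigma>16: "0 < \<sigma>/16" and M0: "0 \<le> M" using \<sigma> M by auto
  obtain k where k: "0 < k" "exp (- k) \<le> \<sigma>/16"
    "\<And>x. norm x \<le> Rk \<Longrightarrow> - exp (- k * (k * f (0, x) + 1)) \<le> u (0, x) + \<sigma>/16"
  proof (rule exponential_change_below[where R = Rk, OF contf0 contu0 u0M _ \<sigma>16 M0])
    show "f (0, x) < 0" if "u (0, x) < 0" for x using that by (rule init)
    fix k :: real assume a: "0 < k" "exp (- k) \<le> \<sigma>/16"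
      "\<And>x. norm x \<le> Rk \<Longrightarrow> - exp (- k * (k * f (0, x) + 1)) \<le> u (0, x) + \<sigma>/16"
    show thesis by (rule that) (fact a)+
  qed
  define w where "w = (\<lambda>q. - exp (- k * (k * f q + 1)))"
  have gw: "geo_sub h c \<nu> w" unfolding w_def by (rule geo_sub_exp[OF f(2) h(2) k(1)])
  have contw: "continuous_on spacetime w" unfolding w_def by (intro continuous_intros f(1))
  have w0: "w q < 0" for q by (simp add: w_def)
  have w0k: "w (0, x) \<le> u (0, x) + \<sigma>/16" if "norm x \<le> Rk" for x using k(3)[OF that] by (simp add: w_def)
  have wa: "- (\<sigma>/16) \<le> w (ta, xa)"
  proof -
    have "- k * (k * f (ta, xa) + 1) \<le> - k" using fa k(1) by (simp add: algebra_simps)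
    then have "exp (- k * (k * f (ta, xa) + 1)) \<le> exp (- k)" by simp
    then show ?thesis using k(2) unfolding w_def by linarith
  qed
  have wuM: "w q - u q' \<le> M" if "q' \<in> spacetime" for q q' using w0[of q] uM[OF that] by linarith
  \<comment> \<open>This makes the time square vanish, so that at the starting point only
    \<open>\<eta> * ta\<close> and the localisation are paid.\<close>
  define sa where "sa = ta + \<theta> * S xa * (1 + ta)"
  have Sa: "\<bar>\<theta> * S xa * (1 + ta)\<bar> \<le> \<theta> * (1 + ta)"
  proof -
    have "\<bar>\<theta> * S xa * (1 + ta)\<bar> = \<theta> * (1 + ta) * \<bar>S xa\<bar>" using \<theta> ta by (simp add: abs_mult)
    also have "\<dots> \<le> \<theta> * (1 + ta)" using S1[of xa] \<theta> ta by (intro mult_left_le) auto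
    finally show ?thesis .
  qed
  have \<theta>3: "\<theta> * (1 + ta) \<le> ta" "\<theta> * (1 + ta) \<le> d0/2" using \<theta>(3) by auto
  have sa: "0 \<le> sa" using Sa \<theta>3(1) unfolding sa_def by linarith
  have usa: "u (sa, xa) \<le> - \<sigma> + \<sigma>/8"
  proof -
    have "dist (sa, xa) (ta, xa) < d0" using Sa \<theta>3(2) d0(1) by (simp add: sa_def dist_Pair_Pair dist_real_def)
    then have "dist (u (sa, xa)) (u (ta, xa)) < \<sigma>/8" using sa by (intro d0) auto
    then show ?thesis by (simp add: dist_real_def \<sigma>_def)
  qed
  have start: "\<sigma>/2 \<le> w (ta, xa) - u (sa, xa) - penalty \<epsilon> \<Lambda> \<eta> \<theta> S \<beta> \<alpha> ta xa sa xa xa"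
  proof -
    have "penalty \<epsilon> \<Lambda> \<eta> \<theta> S \<beta> \<alpha> ta xa sa xa xa = \<eta> * ta + \<alpha> * loc_pen xa" by (simp add: penalty_def sa_def)
    then show ?thesis using wa usa \<eta>(2) \<alpha>(3) \<sigma> by linarith
  qed
  have \<sigma>2: "0 \<le> \<sigma>/2" and ta0: "0 \<le> ta" using \<sigma> ta by auto
  obtain t x s y \<xi> where ts: "0 \<le> t" "0 \<le> s"
    and val: "\<sigma>/2 \<le> w (t, x) - u (s, y) - penalty \<epsilon> \<Lambda> \<eta> \<theta> S \<beta> \<alpha> t x s y \<xi>"
    and max: "\<And>t' x' s' y' \<xi>'. 0 \<le> t' \<Longrightarrow> 0 \<le> s' \<Longrightarrow> w (t', x') - u (s', y') - penalty \<epsilon> \<Lambda> \<eta> \<theta> S \<beta> \<alpha> t' x' s' y' \<xi>'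
       \<le> w (t, x) - u (s, y) - penalty \<epsilon> \<Lambda> \<eta> \<theta> S \<beta> \<alpha> t x s y \<xi>"
  proof (rule penalized_max_exists[OF contw u(1) _ contS S1 \<epsilon>(1) \<Lambda> \<eta>(1) \<beta>(1) \<alpha>(1) \<theta>01(1) \<sigma>2 ta0 sa start])
    show "w q - u q' \<le> M" if "q' \<in> spacetime" for q q' using that by (rule wuM)
    fix t s :: real and x y \<xi> :: 'a assume a: "0 \<le> t" "0 \<le> s"
    and b: "\<sigma>/2 \<le> w (t, x) - u (s, y) - penalty \<epsilon> \<Lambda> \<eta> \<theta> S \<beta> \<alpha> t x s y \<xi>"
    and c: "\<And>t' x' s' y' \<xi>'. 0 \<le> t' \<Longrightarrow> 0 \<le> s' \<Longrightarrow> w (t', x') - u (s', y') - penalty \<epsilon> \<Lambda> \<eta> \<theta> S \<beta> \<alpha> t' x' s' y' \<xi>'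
       \<le> w (t, x) - u (s, y) - penalty \<epsilon> \<Lambda> \<eta> \<theta> S \<beta> \<alpha> t x s y \<xi>"
    show thesis by (rule that) (fact a b c)+
  qed
  have sS: "(s, y) \<in> spacetime" "(t, x) \<in> spacetime" using ts by auto
  have penM: "penalty \<epsilon> \<Lambda> \<eta> \<theta> S \<beta> \<alpha> t x s y \<xi> \<le> M" using val wuM[OF sS(1), of "(t, x)"] \<sigma> by linarith
  note pb = penalty_bounds[OF \<epsilon>(1) \<Lambda> \<eta>(1) \<beta>(1) \<alpha>(1) ts(1) penM]
  have pen0: "0 \<le> penalty \<epsilon> \<Lambda> \<eta> \<theta> S \<beta> \<alpha> t x s y \<xi>"
    unfolding penalty_def using \<epsilon> \<eta> \<beta> \<alpha> ts loc_pen_nonneg[of \<xi>] by (intro add_nonneg_nonneg) auto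
  have wu: "\<sigma>/2 \<le> w (t, x) - u (s, y)" using val pen0 by linarith
  have tT: "t \<le> T" using pb(1) \<eta> by (simp add: T_def field_simps)
  define r where "r = norm (x - y)"
  have r: "0 \<le> r" "r \<le> rm"
  proof -
    have "r\<^sup>2 \<le> rm\<^sup>2" using pb(2) by (simp add: r_def \<epsilon>)
    then show "r \<le> rm" by (rule power2_le_imp_le) (use rm in auto)
  qed (simp add: r_def)
  define d where "d = norm (y - \<xi>)"
  have d: "0 \<le> d" "d \<le> \<rho>"
  proof -
    have "d\<^sup>2 \<le> \<rho>\<^sup>2" using pb(4) by (simp add: d_def \<rho>)
    then show "d \<le> \<rho>" by (rule power2_le_imp_le) (use \<rho> in auto)
  qed (simp add: d_def)
  define e where "e = s - t - \<theta> * S \<xi> * (1 + t)"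
  have e: "\<bar>e\<bar> \<le> \<theta>/2"
  proof -
    have "e\<^sup>2 \<le> (\<theta>/2)\<^sup>2" using pb(3) by (simp add: e_def \<beta>)
    then show ?thesis using abs_le_square_iff[of e "\<theta>/2"] \<theta> by simp
  qed
  have cy_big: "N \<le> c z" if "N2 < c y" "norm (z - y) \<le> \<rho> + R'" for z
  proof -
    have "L * norm (z - y) \<le> L * (\<rho> + R')" using that lip by (intro mult_left_mono)
    then show ?thesis using lip(2)[of z y] that(1) by (simp add: N2_def)
  qed
  have cy_small: "c z \<le> - N" if "c y < - N2" "norm (z - y) \<le> \<rho> + R'" for z
  proof -
    have "L * norm (z - y) \<le> L * (\<rho> + R')" using that lip by (intro mult_left_mono)
    then show ?thesis using lip(2)[of z y] that(1) by (simp add: N2_def)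
  qed
  have \<xi>y: "norm (\<xi> - y) \<le> \<rho> + R'" using d R' by (simp add: d_def norm_minus_commute)
  have \<xi>_bound: "norm \<xi> \<le> exp (M / \<alpha>)"
    using pb(5) \<alpha> by (intro loc_pen_bound) (simp add: field_simps)
  have y_bound: "norm y \<le> exp (M / \<alpha>) + \<rho>" using \<xi>_bound d norm_triangle_sub[of y \<xi>] by (simp add: d_def)
  have x_bound: "norm x + 1 \<le> Rk" using y_bound r norm_triangle_sub[of x y] by (simp add: r_def Rk_def)
  \<comment> \<open>The barrier starts from the level \<open>u (0, x) + \<sigma>/8\<close>, so it is
    the Lipschitz bound of \<open>u\<close> that enters and not a modulus of continuity of
    \<open>w\<close>, which would depend on \<open>k\<close>.\<close>
  have w_upper: "w (t, x) \<le> u (0, x) + \<sigma>/8 + K * t" if cx: "t = 0 \<or> c y \<le> N2"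
  proof (cases "t = 0")
    case True
    then show ?thesis using w0k[of x] x_bound \<sigma> by simp
  next
    case False
    then have cy: "c y \<le> N2" using cx by simp
    show ?thesis
    proof (rule K(2)[OF hb gw contw _ _ _ ts(1)])
      show "w q \<le> u (0, x) + \<sigma>/8 + 2 * M" for q using w0[of q] u0M[of x] M(1) \<sigma> by linarith
      show "w (0, z) \<le> u (0, x) + \<sigma>/8 + B0 * (norm (z - x))\<^sup>2" for z
      proof (cases "norm (z - x) \<le> 1")
        case True
        have "norm z \<le> Rk" using True x_bound norm_triangle_sub[of z x] by linarith
        then show ?thesis using w0k[of z] lip0(2)[of z x] young[of "norm (z - x)"] by linarith
      next
        case False
        then have "1 \<le> (norm (z - x))\<^sup>2" by simp
        then have "B0 * 1 \<le> B0 * (norm (z - x))\<^sup>2" using B0 by (intro mult_left_mono) auto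
        then show ?thesis using w0[of "(0, z)"] u0M[of x] B0(2) \<sigma> by linarith
      qed
      show "c z \<le> Nb" if "B0 * (norm (z - x))\<^sup>2 \<le> 2 * M" for z
      proof -
        have "(norm (z - x))\<^sup>2 \<le> 2 * M / B0" using that B0 by (simp add: field_simps)
        then have "norm (z - x) \<le> rb" unfolding rb_def by (rule real_le_rsqrt)
        then have "norm (z - y) \<le> rm + rb" using r norm_triangle_ineq[of "z - x" "x - y"] by (simp add: r_def)
        then have "L * norm (z - y) \<le> L * (rm + rb)" using lip by (intro mult_left_mono)
        then show ?thesis using lip(2)[of z y] cy by (simp add: Nb_def)
      qed
    qed
  qed
  have u_lower: "u (0, y) - \<sigma>/16 - K * s \<le> u (s, y)" if cy: "s = 0 \<or> - N2 \<le> c y"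
  proof (cases "s = 0")
    case True
    then show ?thesis using \<sigma> by simp
  next
    case False
    then have cy: "- N2 \<le> c y" using cy by simp
    have hb': "0 \<le> h (- p) \<and> h (- p) \<le> H * norm p" for p using hb[of "- p"] by simp
    have "- u (s, y) \<le> (- u (0, y) + \<sigma>/16) + K * s"
    proof (rule K(2)[OF hb' u(2) _ _ _ _ ts(2)])
      show "continuous_on spacetime (\<lambda>q. - u q)" by (intro continuous_intros u(1))
      show "- u q \<le> - u (0, y) + \<sigma>/16 + 2 * M" if "q \<in> spacetime" for q
        using uM[OF that] uM[of "(0, y)"] \<sigma> by auto
      show "- u (0, z) \<le> - u (0, y) + \<sigma>/16 + B0 * (norm (z - y))\<^sup>2" for z
        using lip0(2)[of z y] young[of "norm (z - y)"] by linarith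
      show "- c z \<le> Nb" if "B0 * (norm (z - y))\<^sup>2 \<le> 2 * M" for z
      proof -
        have "(norm (z - y))\<^sup>2 \<le> 2 * M / B0" using that B0 by (simp add: field_simps)
        then have "norm (z - y) \<le> rb" unfolding rb_def by (rule real_le_rsqrt)
        then have "L * norm (z - y) \<le> L * (rm + rb)" using lip rm by (intro mult_left_mono) auto
        then show ?thesis using lip(2)[of z y] cy by (simp add: Nb_def)
      qed
    qed
    then show ?thesis by simp
  qed
  \<comment> \<open>If one time vanishes, the other is at most \<open>3 * \<theta>\<close>. A
    barrier is lacking only at a positive time with \<open>c y\<close> beyond \<open>N2\<close> on
    its bad side; then \<open>S \<xi>\<close> is 1 or -1 and the offset contradicts
    \<open>\<bar>e\<bar> \<le> \<theta>/2\<close>. With both barriers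
    \<open>w (t, x) - u (s, y)\<close> stays below \<open>\<sigma>/2\<close>.\<close>
  have ts_pos: "0 < t \<and> 0 < s"
  proof (rule ccontr)
    assume "\<not> (0 < t \<and> 0 < s)"
    then have z: "t = 0 \<or> s = 0" using ts by auto
    have \<theta>S: "\<bar>\<theta> * S \<xi>\<bar> \<le> \<theta>" using S1[of \<xi>] \<theta> by (simp add: abs_mult mult_left_le)
    have small: "t + s \<le> 3 * \<theta>"
    proof (cases "t = 0")
      case True
      then have "s = e + \<theta> * S \<xi>" by (simp add: e_def)
      then show ?thesis using True e \<theta>S \<theta> by linarith
    next
      case False
      then have s0: "s = 0" using z by simp
      then have "t + \<theta> * S \<xi> * t = - e - \<theta> * S \<xi>" by (simp add: e_def algebra_simps)
      moreover have "- (1/2) * t \<le> \<theta> * S \<xi> * t" using \<theta>S \<theta>(2) ts(1) by (intro mult_right_mono) linarith+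
      ultimately show ?thesis using e \<theta>S s0 by linarith
    qed
    have a: "t = 0 \<or> c y \<le> N2"
    proof (rule ccontr)
      assume n: "\<not> ?thesis"
      then have "S \<xi> = 1" using cy_big[OF _ \<xi>y] Spos by simp
      moreover have "s = 0" using n z by simp
      ultimately have "e = - t - \<theta> * (1 + t)" by (simp add: e_def)
      moreover have "\<theta> \<le> \<theta> * (1 + t)" using \<theta> ts by (simp add: algebra_simps)
      ultimately show False using e \<theta> ts by linarith
    qed
    have b: "s = 0 \<or> - N2 \<le> c y"
    proof (rule ccontr)
      assume n: "\<not> ?thesis"
      then have "S \<xi> = -1" using cy_small[OF _ \<xi>y] Sneg by simp
      moreover have "t = 0" using n z by simp
      ultimately have "e = s + \<theta>" by (simp add: e_def)
      then show False using e \<theta> ts by linarith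
    qed
    have "u (0, x) - u (0, y) \<le> \<sigma>/16"
      using lip0(2)[of x y] mult_left_mono[OF r(2) lip0(1)] rm(2) by (simp add: r_def)
    moreover have "K * t + K * s \<le> \<sigma>/16"
      using mult_left_mono[OF small K(1)] \<theta>(8) by (simp add: algebra_simps)
    ultimately show False using w_upper[OF a] u_lower[OF b] wu \<sigma> by linarith
  qed
  define E where "E = exp (\<Lambda> * t)"
  have E: "1 \<le> E" "E \<le> \<Gamma>" using \<Lambda> ts tT by (auto simp: E_def \<Gamma>_def mult_left_mono)
  define p where "p = (E / \<epsilon>) *\<^sub>R (x - y)"
  define p' where "p' = p - (y - \<xi>)"
  have np: "norm p = E / \<epsilon> * r" using E \<epsilon> by (simp add: p_def r_def)
  have pp': "norm (p - p') = d" by (simp add: p'_def d_def)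
  have pP1: "norm p \<le> \<Gamma> * rm / \<epsilon>"
  proof -
    have "E / \<epsilon> * r \<le> \<Gamma> / \<epsilon> * rm" using E \<epsilon> r by (intro mult_mono divide_right_mono) auto
    then show ?thesis by (simp add: np)
  qed
  then have pP: "norm p \<le> P" using \<rho> by (simp add: P_def)
  have p'P: "norm p' \<le> P"
    using pP1 d norm_triangle_ineq4[of p "y - \<xi>"] by (simp add: P_def p'_def d_def)
  define A where "A = {z. w (t, x) \<le> w (t, x + z)}"
  define B where "B = {z. u (s, y + z) \<le> u (s, y)}"
  have Am: "A \<in> sets borel"
  proof -
    have "continuous_on UNIV (\<lambda>z. w (t, x + z))"
      by (rule continuous_on_compose2[OF contw]) (use ts in \<open>auto intro!: continuous_intros\<close>)
    then show ?thesis unfolding A_def by (rule measurable_level_sets)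
  qed
  have Bm: "B \<in> sets borel"
  proof -
    have "continuous_on UNIV (\<lambda>z. - u (s, y + z))"
      by (intro continuous_intros continuous_on_compose2[OF u(1)]) (use ts in auto)
    then have "{z. - u (s, y) \<le> - u (s, y + z)} \<in> sets borel" by (rule measurable_level_sets)
    then show ?thesis by (simp add: B_def)
  qed
  define Tt where "Tt = (\<lambda>\<xi>'. (s - t - \<theta> * S \<xi>' * (1 + t))\<^sup>2 / (2 * \<beta>))"
  note sp = penalized_max_space[OF \<epsilon>(1) ts max E_def p_def p'_def Tt_def]
  have EC: "(E / \<epsilon> + 1) * (norm z)\<^sup>2 \<le> C * (norm z)\<^sup>2" for z :: 'a
    using E \<epsilon> by (intro mult_right_mono) (auto simp: C_def divide_right_mono)
  have Ai: "0 \<le> p \<bullet> z + C * (norm z)\<^sup>2" if "z \<in> A" for z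
    using sp(1)[of z] that EC[of z] by (simp add: A_def)
  have Bi: "0 \<le> - p' \<bullet> z + C * (norm z)\<^sup>2" if "z \<in> B" for z
    using sp(2)[of z] that EC[of z] by (simp add: B_def)
  define b where "b = - (s - t - \<theta> * S \<xi> * (1 + t)) / \<beta>"
  define KA where "KA = level_curvature \<nu> \<delta> p A"
  define KB where "KB = level_curvature \<nu> \<delta> (- p') B"
  have t0: "0 < t" and s0: "0 < s" using ts_pos by auto
  note geo = penalized_max_geo[OF gw u(2) \<epsilon>(1) \<Lambda> \<beta>(1) t0 s0 nl(1,2) max E_def p_def p'_def b_def]
  have i1: "\<Lambda> * (E * r\<^sup>2 / (2 * \<epsilon>)) + \<eta> + (1 + \<theta> * S \<xi>) * b \<le> h p * (c x + KA)"
    unfolding KA_def A_def r_def by (rule geo(1))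
  have i2: "- b \<le> h p' * (- c y + KB)" unfolding KB_def B_def by (rule geo(2))
  have absA: "\<bar>h p * KA\<bar> \<le> V" unfolding KA_def by (rule nl_abs[OF Am pP _ _ Ai]) (use hb in auto)
  have absB: "\<bar>h p' * KB\<bar> \<le> V"
    unfolding KB_def by (rule nl_abs[OF Bm]) (use hb[of p'] p'P Bi in auto)
  have j1: "\<eta> + (1 + \<theta> * S \<xi>) * b \<le> h p * c y + h p * KA"
  proof -
    have "h p * (c x - c y) \<le> h p * (L * r)"
      using lip(2)[of x y] hb by (intro mult_left_mono) (auto simp: r_def)
    also have "\<dots> \<le> (H * norm p) * (L * r)" using hb lip r by (intro mult_right_mono) auto
    also have "\<dots> = \<Lambda> * (E * r\<^sup>2 / (2 * \<epsilon>))" using \<epsilon> by (simp add: np \<Lambda>_def field_simps power2_eq_square)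
    finally show ?thesis using i1 by (simp add: algebra_simps)
  qed
  have j2: "h p' * c y \<le> b + h p' * KB" using i2 by (simp add: algebra_simps)
  have \<tau>: "1/2 \<le> 1 + \<theta> * S \<xi>"
  proof -
    have "\<theta> * (-1) \<le> \<theta> * S \<xi>" using S1[of \<xi>] \<theta> by (intro mult_left_mono) auto
    then show ?thesis using \<theta>(2) by linarith
  qed
  \<comment> \<open>\<open>b\<close> links the two inequalities: once \<open>c y\<close> is bounded,
    the one for \<open>u\<close> bounds it from below and the one for \<open>w\<close> from
    above.\<close>
  have bCb: "\<bar>b\<bar> \<le> Cb" if cy: "\<bar>c y\<bar> \<le> N2"
  proof -
    have hcy: "\<bar>h q * c y\<bar> \<le> H * P * N2" if "norm q \<le> P" for q
    proof -
      have "h q \<le> H * P" using hb[of q] mult_left_mono[OF that H0] by linarith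
      then have "h q * \<bar>c y\<bar> \<le> H * P * N2" using cy hb[of q] H0 P0 by (intro mult_mono) auto
      then show ?thesis using hb[of q] by (simp add: abs_mult)
    qed
    have lo: "- (H * P * N2 + V) \<le> b" using j2 hcy[OF p'P] absB by linarith
    show ?thesis
    proof (cases "0 \<le> b")
      case True
      then have "1/2 * b \<le> (1 + \<theta> * S \<xi>) * b" using \<tau> by (intro mult_right_mono)
      then show ?thesis using j1 hcy[OF pP] absA \<eta>(1) True unfolding Cb_def distrib_left by linarith
    next
      case False
      have "0 \<le> H * P * N2 + V" using H0 P0 N2 nl by simp
      then show ?thesis using lo False unfolding Cb_def distrib_left by linarith
    qed
  qed
  \<comment> \<open>The slope in \<xi> of the time square. It vanishes for large
    \<open>\<bar>c y\<bar>\<close>, where \<open>S\<close> is locally constant, and then \<alpha>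
    alone controls \<open>y - \<xi>\<close>.\<close>
  define \<omega> where "\<omega> = (if \<bar>c y\<bar> \<le> N2 then \<theta> * (Cb * (1 + T) * l) else 0)"
  have \<omega>: "0 \<le> \<omega>" "\<omega> \<le> \<theta> * (Cb * (1 + T) * l)" using \<theta>01 Cb T l by (auto simp: \<omega>_def)
  have Tt: "Tt \<xi>' - Tt \<xi> \<le> \<omega> * norm (\<xi>' - \<xi>) + G * l\<^sup>2 * (norm (\<xi>' - \<xi>))\<^sup>2"
    if near: "norm (\<xi>' - \<xi>) \<le> R' \<or> \<xi>' = y" for \<xi>'
  proof -
    define n where "n = norm (\<xi>' - \<xi>)"
    define D where "D = S \<xi>' - S \<xi>"
    have Dn: "\<bar>D\<bar> \<le> l * n" unfolding D_def n_def by (rule Slip)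
    have eb: "e = - b * \<beta>" using \<beta> by (simp add: b_def e_def)
    have eq: "s - t - \<theta> * S \<xi>' * (1 + t) = e - \<theta> * (1 + t) * D" by (simp add: e_def D_def algebra_simps)
    have "Tt \<xi>' - Tt \<xi> = (e - \<theta> * (1 + t) * D)\<^sup>2 / (2 * \<beta>) - e\<^sup>2 / (2 * \<beta>)"
      unfolding Tt_def eq e_def[symmetric] ..
    also have "\<dots> = \<theta> * (1 + t) * (b * D) + (\<theta> * (1 + t) * D)\<^sup>2 / (2 * \<beta>)"
      unfolding eb using \<beta> by (simp add: field_simps power2_eq_square)
    also have "(\<theta> * (1 + t) * D)\<^sup>2 / (2 * \<beta>) = 4 * M * (1 + t)\<^sup>2 * D\<^sup>2"
      using \<theta> M by (simp add: \<beta>_def field_simps power2_eq_square)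
    finally have T1: "Tt \<xi>' - Tt \<xi> = \<theta> * (1 + t) * (b * D) + 4 * M * (1 + t)\<^sup>2 * D\<^sup>2" .
    show ?thesis
    proof (cases "\<bar>c y\<bar> \<le> N2")
      case True
      have "b * D \<le> \<bar>b\<bar> * \<bar>D\<bar>" by (metis abs_ge_self abs_mult)
      also have "\<dots> \<le> Cb * (l * n)" using bCb[OF True] Dn by (intro mult_mono) (use Cb in auto)
      finally have "\<theta> * (1 + t) * (b * D) \<le> \<theta> * (1 + t) * (Cb * (l * n))"
        using \<theta>01 ts by (intro mult_left_mono) auto
      also have "\<dots> \<le> \<theta> * (1 + T) * (Cb * (l * n))"
        using \<theta>01 tT Cb l by (intro mult_right_mono mult_left_mono) (auto simp: n_def)
      also have "\<dots> = \<omega> * n" using True by (simp add: \<omega>_def mult_ac)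
      finally have a: "\<theta> * (1 + t) * (b * D) \<le> \<omega> * n" .
      have "D\<^sup>2 \<le> (l * n)\<^sup>2" using power_mono[OF Dn, of 2] by simp
      moreover have "4 * M * (1 + t)\<^sup>2 \<le> G" unfolding G_def using M tT ts by (intro mult_left_mono power_mono) auto
      ultimately have "4 * M * (1 + t)\<^sup>2 * D\<^sup>2 \<le> G * (l * n)\<^sup>2" using G by (intro mult_mono) auto
      then show ?thesis using T1 a by (simp add: n_def power_mult_distrib mult_ac)
    next
      case False
      have "norm (\<xi>' - y) \<le> \<rho> + R'"
      proof (cases "\<xi>' = y")
        case F: False
        then show ?thesis using near d norm_triangle_ineq[of "\<xi>' - \<xi>" "\<xi> - y"] by (simp add: d_def norm_minus_commute)
      qed (use \<rho> R' in simp)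
      then have "D = 0"
        using False cy_big[OF _ \<xi>y] cy_big[of \<xi>'] cy_small[OF _ \<xi>y] cy_small[of \<xi>'] Spos Sneg
        by (cases "N2 < c y") (auto simp: D_def)
      then show ?thesis using T1 \<omega> G by (simp add: n_def)
    qed
  qed
  define g where "g = norm \<xi> / (1 + (norm \<xi>)\<^sup>2)"
  have g: "0 \<le> g" "g \<le> 1" "g * (1 + norm \<xi>) \<le> 2" using norm_div_bounds[of \<xi>] by (auto simp: g_def)
  \<comment> \<open>Competitor with \<xi> replaced by \<open>y\<close>: the quadratic remainders of
    the time square and of the localisation use up at most half of \<open>d\<^sup>2 / 2\<close>, and
    one factor \<open>d\<close> cancels.\<close>
  have d_small: "d \<le> 4 * (\<omega> + \<alpha> * g)"
  proof (cases "d = 0")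
    case False
    have "\<alpha> * (loc_pen y - loc_pen \<xi>) \<le> \<alpha> * (d * g + d\<^sup>2 / 2)"
      using loc_pen_increment[of y \<xi>] \<alpha>(1) by (intro mult_left_mono) (auto simp: d_def g_def)
    moreover have "\<alpha> * d\<^sup>2 \<le> 1/4 * d\<^sup>2" using \<alpha>(2) by (intro mult_right_mono) auto
    moreover have "G * l\<^sup>2 * d\<^sup>2 \<le> 1/8 * d\<^sup>2" using l(2) by (intro mult_right_mono) auto
    moreover have "d\<^sup>2 / 2 + Tt \<xi> + \<alpha> * loc_pen \<xi> \<le> Tt y + \<alpha> * loc_pen y" using sp(4) by (simp add: d_def)
    moreover have "Tt y - Tt \<xi> \<le> \<omega> * d + G * l\<^sup>2 * d\<^sup>2" using Tt[of y] by (simp add: d_def)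
    ultimately have "d\<^sup>2 / 4 \<le> \<omega> * d + \<alpha> * (d * g)" by (simp add: algebra_simps)
    then have "d * d \<le> (4 * (\<omega> + \<alpha> * g)) * d" by (simp add: power2_eq_square algebra_simps)
    then show ?thesis using False d(1) by simp
  qed (use \<omega> \<alpha> g in simp)
  have d\<zeta>: "d \<le> \<zeta>0"
  proof -
    have "\<alpha> * g \<le> \<alpha> * 1" using g \<alpha> by (intro mult_left_mono) auto
    then show ?thesis using d_small[unfolded distrib_left] \<omega>(2) \<theta>(5) \<alpha>(5) by linarith
  qed
  \<comment> \<open>The shift by \<open>lam *\<^sub>R (x - y)\<close> gains at least
    \<open>gap\<close>; the time square loses at most \<open>gap/2\<close> and the localisation
    \<open>gap/8\<close>, so points of \<open>A\<close> are moved strictly out of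
    \<open>B\<close>.\<close>
  have sep: "\<exists>k. norm k \<le> k0 \<and> (\<forall>z\<in>A. norm z < R \<longrightarrow> z + k \<notin> B)" if p1: "p1 \<le> norm p"
  proof (intro exI conjI ballI impI)
    have "p1 * \<epsilon> \<le> E * r" using p1 \<epsilon> by (simp add: np field_simps)
    also have "\<dots> \<le> \<Gamma> * r" using E r by (intro mult_right_mono) auto
    finally have r1r: "r1 \<le> r" using \<Gamma> by (simp add: r1_def divide_le_eq mult_ac)
    define kk where "kk = lam *\<^sub>R (x - y)"
    have nk: "norm kk = lam * r" using lam by (simp add: kk_def r_def)
    have "lam * r \<le> lam * rm" using lam r by (intro mult_left_mono) auto
    then show "norm (lam *\<^sub>R (x - y)) \<le> k0" using lam(3) nk by (simp add: kk_def)
    have "lam * r \<le> 1 * rm" using lam r by (intro mult_mono) auto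
    then have nk2: "norm kk \<le> rm" by (simp add: nk)
    fix z assume z: "z \<in> A" "norm z < R"
    define n where "n = norm (z + kk)"
    have n: "0 \<le> n" "n \<le> R'" using norm_triangle_ineq[of z kk] nk2 z(2) by (auto simp: n_def R'_def)
    have e1: "\<xi> + z + kk - \<xi> = z + kk" by simp
    have "Tt (\<xi> + z + kk) - Tt \<xi> \<le> \<omega> * n + G * l\<^sup>2 * n\<^sup>2" using Tt[of "\<xi> + z + kk"] n unfolding e1 by (simp add: n_def)
    also have "\<dots> \<le> \<theta> * (Cb * (1 + T) * l) * R' + G * l\<^sup>2 * R'\<^sup>2"
      using \<omega> n G \<theta>01 Cb T l by (intro add_mono mult_mono mult_left_mono power_mono) auto
    also have "\<dots> \<le> gap/4 + gap/4" using \<theta>(4) l(3) by (intro add_mono) (auto simp: mult_ac)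
    finally have q1: "Tt (\<xi> + z + kk) - Tt \<xi> \<le> gap/2" by simp
    have "loc_pen (\<xi> + z + kk) - loc_pen \<xi> \<le> n * g + n\<^sup>2 / 2"
      using loc_pen_increment[of "\<xi> + z + kk" \<xi>] unfolding e1 by (simp add: n_def g_def)
    also have "\<dots> \<le> R' * 1 + R'\<^sup>2"
    proof (intro add_mono mult_mono)
      have "n\<^sup>2 \<le> R'\<^sup>2" using n by (intro power_mono) auto
      then show "n\<^sup>2 / 2 \<le> R'\<^sup>2" using zero_le_power2[of n] by linarith
    qed (use n g R' in auto)
    finally have "\<alpha> * (loc_pen (\<xi> + z + kk) - loc_pen \<xi>) \<le> \<alpha> * (R' + R'\<^sup>2)" using \<alpha>(1) by (intro mult_left_mono) auto
    then have q2: "\<alpha> * (loc_pen (\<xi> + z + kk) - loc_pen \<xi>) \<le> gap/8" using \<alpha>(4) by linarith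
    have q3: "gap \<le> E * ((norm (x - y))\<^sup>2 - (norm (x - y - kk))\<^sup>2) / (2 * \<epsilon>)"
    proof -
      have "x - y - kk = (1 - lam) *\<^sub>R (x - y)" by (simp add: kk_def scaleR_left_diff_distrib)
      then have nr: "norm (x - y - kk) = (1 - lam) * r" using lam by (simp add: r_def)
      have "(norm (x - y))\<^sup>2 - (norm (x - y - kk))\<^sup>2 = lam * (2 - lam) * r\<^sup>2"
        unfolding nr by (simp add: r_def[symmetric] algebra_simps power2_eq_square)
      moreover have "lam * r1\<^sup>2 \<le> lam * (2 - lam) * r\<^sup>2"
      proof (rule mult_mono)
        show "r1\<^sup>2 \<le> r\<^sup>2" using r1r r1 by (intro power_mono) auto
        have "lam * 1 \<le> lam * (2 - lam)" using lam by (intro mult_left_mono) auto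
        then show "lam \<le> lam * (2 - lam)" by simp
      qed (use lam in auto)
      ultimately have a: "lam * r1\<^sup>2 \<le> (norm (x - y))\<^sup>2 - (norm (x - y - kk))\<^sup>2" by simp
      have "0 \<le> lam * r1\<^sup>2" using lam by simp
      then have "1 * (lam * r1\<^sup>2) \<le> E * ((norm (x - y))\<^sup>2 - (norm (x - y - kk))\<^sup>2)" using a E by (intro mult_mono) auto
      then show ?thesis using \<epsilon> by (simp add: gap_def divide_right_mono)
    qed
    have "u (s, y) < u (s, y + z + kk)" using sp(3)[of z kk] z(1) q1 q2 q3 gap unfolding A_def by simp
    then show "z + lam *\<^sub>R (x - y) \<notin> B" by (simp add: B_def kk_def add.assoc)
  qed
  have nlsum: "h p * KA + h p' * KB \<le> \<eta>/4"
    unfolding KA_def KB_def by (rule nl_sum[OF Am Bm pP p'P _ Ai Bi sep]) (use pp' d\<zeta> \<zeta>0 in auto)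
  show False
  proof (cases "\<bar>c y\<bar> \<le> N2")
    case True
    \<comment> \<open>For moderate \<open>c y\<close> the two inequalities are added: the errors are
      \<open>\<eta>/8\<close> from \<open>h\<close>, \<open>\<eta>/8\<close> from the speed and
      \<open>\<eta>/4\<close> from the curvatures.\<close>
    have "dist (h p) (h p') < \<eta> / (8 * N2)" using pP p'P pp' d\<zeta> \<zeta>0 by (intro \<zeta>2(2)) (auto simp: dist_norm)
    then have "\<bar>h p - h p'\<bar> * \<bar>c y\<bar> \<le> \<eta> / (8 * N2) * N2" using True by (intro mult_mono) (auto simp: dist_real_def)
    then have "(h p - h p') * c y \<le> \<eta>/8" using N2 by (simp add: abs_mult[symmetric])
    moreover have "- (\<theta> * S \<xi> * b) \<le> \<theta> * Cb"
    proof -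
      have "\<bar>\<theta> * S \<xi> * b\<bar> = \<theta> * (\<bar>S \<xi>\<bar> * \<bar>b\<bar>)" using \<theta> by (simp add: abs_mult)
      also have "\<dots> \<le> \<theta> * (1 * Cb)" using \<theta>01 S1 bCb[OF True] by (intro mult_left_mono mult_mono) auto
      finally show ?thesis by simp
    qed
    ultimately show False using j1 j2 nlsum \<theta>(6) \<eta>(1) by (simp add: algebra_simps)
  next
    case False
    have "\<omega> = 0" using False by (simp add: \<omega>_def)
    then have dg: "d \<le> 4 * (\<alpha> * g)" using d_small by simp
    have ag: "\<alpha> * g \<le> 1/4" using g(2) \<alpha> mult_mono[of \<alpha> "1/4" g 1] g(1) by simp
    \<comment> \<open>\<open>d\<close> is at most \<open>4 * (\<alpha> * g)\<close> with
      \<open>g * (1 + norm \<xi>) \<le> 2\<close>, while \<open>\<bar>c y\<bar>\<close> grows at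
      most linearly in \<xi>; the product is of order \<alpha>.\<close>
    have dcy: "d * \<bar>c y\<bar> \<le> \<alpha> * (8 * (\<bar>c 0\<bar> + 2 * L))"
    proof -
      have "\<bar>c y\<bar> \<le> \<bar>c 0\<bar> + L * norm y" using lip(2)[of y 0] by simp
      also have "\<dots> \<le> \<bar>c 0\<bar> + L * (norm \<xi> + 1)"
        using dg ag norm_triangle_sub[of y \<xi>] lip(1) by (intro add_left_mono mult_left_mono) (auto simp: d_def)
      also have "\<dots> \<le> (\<bar>c 0\<bar> + 2 * L) * (1 + norm \<xi>)" using lip(1) by (simp add: algebra_simps)
      finally have "d * \<bar>c y\<bar> \<le> (4 * (\<alpha> * g)) * ((\<bar>c 0\<bar> + 2 * L) * (1 + norm \<xi>))"
        using dg d(1) \<alpha> g by (intro mult_mono) auto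
      also have "\<dots> = (4 * \<alpha> * (\<bar>c 0\<bar> + 2 * L)) * (g * (1 + norm \<xi>))" by (simp add: mult_ac)
      also have "\<dots> \<le> (4 * \<alpha> * (\<bar>c 0\<bar> + 2 * L)) * 2" using g(3) \<alpha> lip by (intro mult_left_mono) auto
      finally show ?thesis by (simp add: mult_ac)
    qed
    \<comment> \<open>Either \<open>p\<close> and \<open>p'\<close> are nearly equal relative to their size and the gain \<open>\<theta>\<close> wins, or both
      are of the size of \<open>d\<close>, which decays fast enough to compensate the linear growth of \<open>c\<close>.\<close>
    have X0: "q * \<bar>c y\<bar> \<le> \<eta>/8" if "q \<le> H * ((1 + 1/\<kappa>) * d)" for q
    proof -
      have "q * \<bar>c y\<bar> \<le> H * ((1 + 1/\<kappa>) * d) * \<bar>c y\<bar>" using that by (intro mult_right_mono) auto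
      also have "\<dots> = H * (1 + 1/\<kappa>) * (d * \<bar>c y\<bar>)" by (simp add: mult_ac)
      also have "\<dots> \<le> H * (1 + 1/\<kappa>) * (\<alpha> * (8 * (\<bar>c 0\<bar> + 2 * L)))" using dcy H \<kappa> by (intro mult_left_mono) auto
      also have "\<dots> = \<alpha> * cc" by (simp add: cc_def mult_ac)
      finally show ?thesis using \<alpha>(6) by linarith
    qed
    have smallp: "norm p \<le> (1 + 1/\<kappa>) * d \<and> norm p' \<le> (1 + 1/\<kappa>) * d" if "\<not> d \<le> \<kappa> * norm p"
    proof -
      have a: "norm p \<le> 1/\<kappa> * d" using that \<kappa>(1) by (simp add: field_simps)
      moreover have "norm p' \<le> norm p + d" using norm_triangle_ineq4[of p "y - \<xi>"] by (simp add: p'_def d_def)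
      ultimately show ?thesis using d(1) by (simp add: algebra_simps)
    qed
    have \<theta>V: "\<theta> * \<bar>h p' * KB\<bar> \<le> \<eta>/8" using mult_left_mono[OF absB \<theta>01(1)] \<theta>(7) by linarith
    show False
    proof (cases "N2 < c y")
      case True
      then have S: "S \<xi> = 1" using cy_big[OF _ \<xi>y] Spos by simp
      have X: "(h p - (1 + \<theta>) * h p') * c y \<le> \<eta>/8"
      proof (cases "d \<le> \<kappa> * norm p")
        case T: True
        then have "h p - (1 + \<theta>) * h p' \<le> 0" using \<kappa>(2)[of p p'] pp' by simp
        then have "(h p - (1 + \<theta>) * h p') * c y \<le> 0" using True N2 by (intro mult_nonpos_nonneg) auto
        then show ?thesis using \<eta> by linarith
      next
        case F: False
        have "h p - (1 + \<theta>) * h p' \<le> H * ((1 + 1/\<kappa>) * d)"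
        proof -
          have "H * norm p \<le> H * ((1 + 1/\<kappa>) * d)" using smallp[OF F] H0 by (intro mult_left_mono) auto
          moreover have "0 \<le> (1 + \<theta>) * h p'" using hb[of p'] \<theta> by simp
          ultimately show ?thesis using hb[of p] by linarith
        qed
        then show ?thesis using X0 True N2 by fastforce
      qed
      \<comment> \<open>Multiplying the inequality for \<open>u\<close> by the speed
        \<open>1 + \<theta>\<close> eliminates \<open>b\<close>; the extra curvature term costs at
        most \<open>\<eta>/8\<close>.\<close>
      have "(1 + \<theta>) * (h p' * c y) \<le> (1 + \<theta>) * (b + h p' * KB)" using j2 \<theta> by (intro mult_left_mono) auto
      moreover have "\<theta> * (h p' * KB) \<le> \<eta>/8" using \<theta>V abs_ge_self[of "h p' * KB"] \<theta>01 by (meson mult_left_mono order_trans)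
      ultimately show False using j1 X nlsum \<eta>(1) unfolding S by (simp add: algebra_simps)
    next
      case F1: False
      then have cy: "c y < - N2" using False by auto
      then have S: "S \<xi> = -1" using cy_small[OF _ \<xi>y] Sneg by simp
      have X: "((1 - \<theta>) * h p' - h p) * (- c y) \<le> \<eta>/8"
      proof (cases "d \<le> \<kappa> * norm p")
        case T: True
        then have "(1 - \<theta>) * h p' - h p \<le> 0" using \<kappa>(2)[of p p'] pp' by simp
        then have "((1 - \<theta>) * h p' - h p) * (- c y) \<le> 0" using cy N2 by (intro mult_nonpos_nonneg) auto
        then show ?thesis using \<eta> by linarith
      next
        case F: False
        have "(1 - \<theta>) * h p' - h p \<le> H * ((1 + 1/\<kappa>) * d)"
        proof -
          have "H * norm p' \<le> H * ((1 + 1/\<kappa>) * d)" using smallp[OF F] H0 by (intro mult_left_mono) auto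
          moreover have "(1 - \<theta>) * h p' \<le> 1 * h p'" using hb[of p'] \<theta> by (intro mult_right_mono) auto
          ultimately show ?thesis using hb[of p] hb[of p'] by linarith
        qed
        from X0[OF this] show ?thesis using cy N2 by simp
      qed
      have "(1 - \<theta>) * (h p' * c y) \<le> (1 - \<theta>) * (b + h p' * KB)" using j2 \<theta>01 by (intro mult_left_mono) auto
      moreover have "- (\<theta> * (h p' * KB)) \<le> \<eta>/8"
      proof -
        have "\<theta> * (- (h p' * KB)) \<le> \<theta> * \<bar>h p' * KB\<bar>" using \<theta>01 by (intro mult_left_mono) auto
        then show ?thesis using \<theta>V by simp
      qed
      ultimately show False using j1 X nlsum \<eta>(1) unfolding S by (simp add: algebra_simps)
    qed
  qed
qed

end

section \<open>Application to the two solutions\<close>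

lemma viscosity_solution_continuous:
  assumes u: "viscosity_solution \<mu> c \<nu> u" and cont: "continuous_on spacetime u"
  shows "viscosity_subsolution \<mu> c \<nu> u" "viscosity_supersolution \<mu> c \<nu> u"
proof -
  have s: "viscosity_subsolution \<mu> c \<nu> (usc_envelope spacetime u)" "viscosity_supersolution \<mu> c \<nu> (lsc_envelope spacetime u)"
    using u by (auto simp: viscosity_solution_def)
  show "viscosity_subsolution \<mu> c \<nu> u"
    by (rule viscosity_subsolution_cong[OF usc_envelope_continuous[OF cont] s(1)])
  show "viscosity_supersolution \<mu> c \<nu> u"
    by (rule viscosity_supersolution_cong[OF lsc_envelope_continuous[OF cont] s(2)])
qed

text \<open>Away from 0 this is continuity of the direction. At 0 the direction has no limit, but
  \<mu> is bounded on the compact sphere and the factor \<open>norm p\<close> tends to 0.\<close>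

lemma continuous_homogeneous_extension:
  fixes \<mu> :: "'a::euclidean_space \<Rightarrow> real"
  assumes \<mu>: "continuous_on (sphere 0 1) \<mu>"
  shows "continuous_on UNIV (\<lambda>p. \<mu> (sgn p) * norm p)"
proof -
  have "compact (\<mu> ` sphere 0 1)" by (intro compact_continuous_image \<mu>) auto
  then have "bounded (\<mu> ` sphere 0 1)" by (rule compact_imp_bounded)
  then obtain B where B: "\<forall>y\<in>\<mu> ` sphere 0 1. norm y \<le> B" unfolding bounded_iff by blast
  have hB: "\<bar>\<mu> (sgn p) * norm p\<bar> \<le> \<bar>B\<bar> * norm p" for p
  proof (cases "p = 0")
    case False
    then have "\<mu> (sgn p) \<in> \<mu> ` sphere 0 1" by (intro imageI) (simp add: norm_sgn)
    then have "norm (\<mu> (sgn p)) \<le> B" using B by blast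
    then have "\<bar>\<mu> (sgn p)\<bar> \<le> \<bar>B\<bar>" by simp
    then show ?thesis by (simp add: abs_mult mult_right_mono)
  qed simp
  have "isCont (\<lambda>p. \<mu> (sgn p) * norm p) p" for p
  proof (cases "p = 0")
    case True
    have "((\<lambda>p. \<bar>B\<bar> * norm p) \<longlongrightarrow> \<bar>B\<bar> * norm (0::'a)) (at (0::'a))"
      by (intro tendsto_intros)
    then have lim: "((\<lambda>p::'a. \<bar>B\<bar> * norm p) \<longlongrightarrow> 0) (at 0)" by simp
    have "\<forall>\<^sub>F p in at 0. norm (\<mu> (sgn p) * norm p) \<le> \<bar>B\<bar> * norm p"
      unfolding real_norm_def by (rule always_eventually) (use hB in blast)
    then have "((\<lambda>p. \<mu> (sgn p) * norm p) \<longlongrightarrow> 0) (at 0)" using lim by (rule Lim_null_comparison)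
    then show ?thesis using True by (simp add: isCont_def)
  next
    case False
    have "continuous_on (- {0}) (\<lambda>p::'a. sgn p)" by (intro continuous_on_sgn continuous_on_id) auto
    then have "continuous_on (- {0}) (\<lambda>p. \<mu> (sgn p))"
      by (rule continuous_on_compose2[OF \<mu>]) (auto simp: norm_sgn split: if_splits)
    then have "continuous_on (- {0}) (\<lambda>p. \<mu> (sgn p) * norm p)"
      by (intro continuous_on_mult continuous_on_norm continuous_on_id)
    moreover have "open (- {0 :: 'a})" by auto
    ultimately show ?thesis using False continuous_on_eq_continuous_at by blast
  qed
  then show ?thesis by (simp add: continuous_at_imp_continuous_on)
qed

lemma bounded_imageE:
  assumes "bounded (u ` S)" obtains M :: real where "0 < M" "\<And>q. q \<in> S \<Longrightarrow> \<bar>u q\<bar> \<le> M"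
proof -
  obtain B where "\<forall>y\<in>u ` S. norm y \<le> B" using assms unfolding bounded_iff by blast
  then have "\<bar>u q\<bar> \<le> \<bar>B\<bar> + 1" if "q \<in> S" for q using that by fastforce
  then show ?thesis by (intro that[of "\<bar>B\<bar> + 1"]) auto
qed

theorem theorem6:
  fixes \<mu> c\<^sub>1 u\<^sub>0 v\<^sub>0 :: "'a::euclidean_space \<Rightarrow> real"
    and \<nu> :: "'a measure"
    and u v :: "real \<times> 'a \<Rightarrow> real"
  assumes A1: "continuous_on (sphere 0 1) \<mu>" "\<And>e. e \<in> sphere 0 1 \<Longrightarrow> \<mu> e > 0"
    and A2: "\<exists>L. L-lipschitz_on UNIV c\<^sub>1"
    and A3: "assumption_A3 \<nu>"
    and A3': "assumption_A3' \<nu>"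
    and u\<^sub>0: "bounded (range u\<^sub>0)" "\<exists>L. L-lipschitz_on UNIV u\<^sub>0"
    and v\<^sub>0: "bounded (range v\<^sub>0)" "\<exists>L. L-lipschitz_on UNIV v\<^sub>0"
    and u: "bounded (u ` spacetime)" "continuous_on spacetime u" "viscosity_solution \<mu> c\<^sub>1 \<nu> u"
      "\<And>x. u (0, x) = u\<^sub>0 x"
    and v: "bounded (v ` spacetime)" "continuous_on spacetime v" "viscosity_solution \<mu> c\<^sub>1 \<nu> v"
      "\<And>x. v (0, x) = v\<^sub>0 x"
    and same_sign: "{x. u\<^sub>0 x > 0} = {x. v\<^sub>0 x > 0}" "{x. u\<^sub>0 x < 0} = {x. v\<^sub>0 x < 0}"
  shows "\<forall>t>0. {x. u (t, x) > 0} = {x. v (t, x) > 0} \<and> {x. u (t, x) < 0} = {x. v (t, x) < 0}"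
proof -
  interpret singular_measure \<nu> by unfold_locales (fact A3 A3')+
  define h where "h = (\<lambda>p. \<mu> (sgn p) * norm p)"
  have h: "continuous_on UNIV h" "\<And>l p. 0 < l \<Longrightarrow> h (l *\<^sub>R p) = l * h p" "h 0 = 0" "\<And>p. p \<noteq> 0 \<Longrightarrow> 0 < h p"
  proof -
    show "continuous_on UNIV h" unfolding h_def by (rule continuous_homogeneous_extension[OF A1(1)])
    show "0 < h p" if "p \<noteq> 0" for p unfolding h_def using that by (intro mult_pos_pos A1(2)) (auto simp: norm_sgn)
  qed (auto simp: h_def sgn_scaleR)
  have h': "continuous_on UNIV (\<lambda>p. h (- p))" "\<And>l p. 0 < l \<Longrightarrow> h (- (l *\<^sub>R p)) = l * h (- p)" "h (- 0) = 0"
    "\<And>p. p \<noteq> 0 \<Longrightarrow> 0 < h (- p)"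
  proof -
    show "continuous_on UNIV (\<lambda>p. h (- p))" by (rule continuous_on_compose2[OF h(1)]) (auto intro: continuous_intros)
    show "h (- (l *\<^sub>R p)) = l * h (- p)" if "0 < l" for l p using h(2)[OF that, of "- p"] by simp
  qed (use h(3,4) in auto)
  obtain L where "L-lipschitz_on UNIV c\<^sub>1" using A2 by blast
  then have L: "0 \<le> L" "\<bar>c\<^sub>1 x - c\<^sub>1 y\<bar> \<le> L * norm (x - y)" for x y
    by (auto simp: lipschitz_on_def dist_real_def dist_norm)
  have L': "\<bar>- c\<^sub>1 x - - c\<^sub>1 y\<bar> \<le> L * norm (x - y)" for x y
    using L(2)[of x y] by (simp add: abs_minus_commute)
  have geo: "geo_sub h c\<^sub>1 \<nu> g" "geo_sub (\<lambda>p. h (- p)) (\<lambda>x. - c\<^sub>1 x) \<nu> (\<lambda>q. - g q)"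
    if bd: "bounded (g ` spacetime)" and cont: "continuous_on spacetime g" and sol: "viscosity_solution \<mu> c\<^sub>1 \<nu> g" for g
  proof -
    obtain M where M: "\<And>q. q \<in> spacetime \<Longrightarrow> \<bar>g q\<bar> \<le> M" using bounded_imageE[OF bd] by blast
    note s = viscosity_solution_continuous[OF sol cont]
    show "geo_sub h c\<^sub>1 \<nu> g"
      unfolding h_def by (rule viscosity_subsolution_imp_geo_sub[OF cont M _ s(1)]) (use A1(2) in auto)
    have "geo_sub (\<lambda>p. \<mu> (- sgn p) * norm p) (\<lambda>x. - c\<^sub>1 x) \<nu> (\<lambda>q. - g q)"
    proof (rule viscosity_subsolution_imp_geo_sub[OF _ _ _ viscosity_supersolution_uminus[OF s(2)]])
      show "continuous_on spacetime (\<lambda>q. - g q)" by (intro continuous_intros cont)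
      show "\<bar>- g q\<bar> \<le> M" if "q \<in> spacetime" for q using M[OF that] by simp
      show "0 < \<mu> (- e)" if "norm e = 1" for e using that by (intro A1(2)) simp
    qed
    then show "geo_sub (\<lambda>p. h (- p)) (\<lambda>x. - c\<^sub>1 x) \<nu> (\<lambda>q. - g q)" by (simp add: h_def sgn_minus)
  qed
  have sgn_le: "(g (t, x) < 0 \<longrightarrow> f (t, x) < 0) \<and> (0 < g (t, x) \<longrightarrow> 0 < f (t, x))"
    if t: "0 < t" and g: "bounded (g ` spacetime)" "continuous_on spacetime g" "viscosity_solution \<mu> c\<^sub>1 \<nu> g"
      and f: "bounded (f ` spacetime)" "continuous_on spacetime f" "viscosity_solution \<mu> c\<^sub>1 \<nu> f"
      and lip: "\<exists>L. L-lipschitz_on UNIV (\<lambda>x. g (0, x))"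
      and init: "\<And>x. g (0, x) < 0 \<longleftrightarrow> f (0, x) < 0" "\<And>x. 0 < g (0, x) \<longleftrightarrow> 0 < f (0, x)" for f g t x
  proof -
    obtain M where M: "0 < M" "\<And>q. q \<in> spacetime \<Longrightarrow> \<bar>g q\<bar> \<le> M" using bounded_imageE[OF g(1)] by blast
    obtain L0 where "L0-lipschitz_on UNIV (\<lambda>x. g (0, x))" using lip by blast
    then have L0: "0 \<le> L0" "\<bar>g (0, x) - g (0, y)\<bar> \<le> L0 * norm (x - y)" for x y
      by (auto simp: lipschitz_on_def dist_real_def dist_norm)
    have L0': "\<bar>- g (0, x) - - g (0, y)\<bar> \<le> L0 * norm (x - y)" for x y
      using L0(2)[of x y] by (simp add: abs_minus_commute)
    have "f (t, x) < 0" if "g (t, x) < 0"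
      by (rule sign_comparison[OF h L f(2) geo(1)[OF f] g(2) geo(2)[OF g] M L0 _ t that]) (use init in auto)
    \<comment> \<open>Positive values are negative values of the reflected functions, whose equation
      has speed \<open>h (- p)\<close> and forcing \<open>- c\<^sub>1\<close>.\<close>
    moreover have "- f (t, x) < 0" if "0 < g (t, x)"
    proof (rule sign_comparison[OF h' L(1) L' _ geo(2)[OF f] _ _ M(1) _ L0(1) L0' _ t])
      show "continuous_on spacetime (\<lambda>q. - f q)" "continuous_on spacetime (\<lambda>q. - g q)"
        by (intro continuous_intros f(2) g(2))+
      show "\<bar>- g q\<bar> \<le> M" if "q \<in> spacetime" for q using M(2)[OF that] by simp
      show "- f (0, x) < 0" if "- g (0, x) < 0" for x using init(2)[of x] that by simp
      show "- g (t, x) < 0" using that by simp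
      show "geo_sub (\<lambda>p. h (- (- p))) (\<lambda>x. - (- c\<^sub>1 x)) \<nu> (\<lambda>q. - (- g q))" using geo(1)[OF g] by simp
    qed
    ultimately show ?thesis by auto
  qed
  have i: "u (0, x) < 0 \<longleftrightarrow> v (0, x) < 0" "0 < u (0, x) \<longleftrightarrow> 0 < v (0, x)" for x
    using same_sign by (auto simp: u(4) v(4))
  have lu: "\<exists>L. L-lipschitz_on UNIV (\<lambda>x. u (0, x))" and lv: "\<exists>L. L-lipschitz_on UNIV (\<lambda>x. v (0, x))"
    using u\<^sub>0(2) v\<^sub>0(2) by (simp_all add: u(4) v(4))
  show ?thesis
  proof (intro allI impI)
    fix t :: real assume t: "0 < t"
    note 1 = sgn_le[OF t u(1-3) v(1-3) lu i] and 2 = sgn_le[OF t v(1-3) u(1-3) lv i(1)[symmetric] i(2)[symmetric]]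
    show "{x. u (t, x) > 0} = {x. v (t, x) > 0} \<and> {x. u (t, x) < 0} = {x. v (t, x) < 0}"
      by (intro conjI Collect_cong) (use 1 2 in blast)+
  qed
qed

end
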